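(* Let $\mathcal{A}$ be a unital $f$-algebra such that its identity element $e$ is also a strong order unit of $\mathcal{A}$, and such that it is complete in the submultiplicative order unit norm $\|\cdot\|_e$ on $\mathcal{A}$. Suppose that $\mathcal{A}^{\sim}_{\mathrm{oc}}$ separates the points of $\mathcal{A}$. Then $\mathcal{A}$ admits a (necessarily unique) Hausdorff uo-Lebesgue topology $\widehat\tau_{\mathcal{A}}$. Take an ideal $I$ of $\mathcal{A}^{\sim}_{\mathrm{oc}}$ that separates the points of $\mathcal{A}$, and take a (not necessarily unital) associative subalgebra $\mathcal{B}$ of $\mathcal{A}$. Then $$\overline{\mathcal{B}}^{\widehat\tau_{\mathcal{A}}}=\overline{\mathcal{B}}^{\sigma(\mathcal{A},I)}=\overline{\mathcal{B}}^{|\sigma|(\mathcal{A},I)}=\overline{\overline{\mathcal{B}}^{\|\cdot\|_e}}^{\widehat\tau_{\mathcal{A}}}=\overline{\overline{\mathcal{B}}^{\|\cdot\|_e}}^{\sigma(\mathcal{A},I)}=\overline{\overline{\mathcal{B}}^{\|\cdot\|_e}}^{|\sigma|(\mathcal{A},I)}$$ in $\mathcal{A}$.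
   Context: All vector lattices (in particular those underlying $f$-algebras) are real and Archimedean. An $f$-algebra is an associative algebra that is a vector lattice in which products of positive elements are positive and in which $x\wedge y=0$ and $z\ge 0$ imply $(xz)\wedge y=(zx)\wedge y=0$. That $e$ is a strong order unit means that for every $x\in\mathcal{A}$ there is $\lambda\ge0$ with $|x|\le\lambda e$; then $\|x\|_e=\inf\{\lambda\ge0:|x|\le\lambda e\}$. In a vector lattice $G$, a net $(x_\alpha)_{\alpha\in A}$ is order convergent to $x$ ($x_\alpha\xrightarrow{\mathrm{o}}x$) if there is a net $(y_\beta)_{\beta\in B}$ in $G$ with $y_\beta\downarrow 0$ such that for every $\beta_0\in B$ there is $\alpha_0\in A$ with $|x-x_\alpha|\le y_{\beta_0}$ for all $\alpha\ge\alpha_0$; it is unbounded order convergent to $x$ ($x_\alpha\xrightarrow{\mathrm{uo}}x$) if $|x_\alpha-x|\wedge y\xrightarrow{\mathrm{o}}0$ in $G$ for all $y\in G^+$. A uo-Lebesgue topology on $G$ is a locally solid linear topology $\tau$ on $G$ such that $x_\alpha\xrightarrow{\mathrm{uo}}0$ implies $x_\alpha\xrightarrow{\tau}0$ for every net; $G$ admits at most one Hausdorff one, denoted $\widehat\tau_G$. $G^{\sim}_{\mathrm{oc}}$ is the vector lattice of order continuous (order bounded) linear functionals on $G$, and an ideal of it is an order ideal (solid vector subspace). For such an ideal $I$, $\sigma(G,I)$ is the weak topology on $G$ generated by $I$, and $|\sigma|(G,I)$ is the absolute weak topology, i.e. the locally convex-solid topology on $G$ generated by the seminorms $x\mapsto|\varphi|(|x|)$,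 $\varphi\in I$. $\overline{S}^{\tau}$ is the closure of $S$ in the topology $\tau$. *)

theory Defs
  imports "HOL-Analysis.Analysis" "HOL-Library.Lattice_Algebras"
begin

section \<open>Vector lattices and f-algebras\<close>

text \<open>All vector lattices are real and Archimedean.\<close>

class vector_lattice = ordered_real_vector + lattice_ab_group_add_abs +
  assumes archimedean:
    "0 \<le> x \<Longrightarrow> (\<And>n::nat. real n *\<^sub>R x \<le> y) \<Longrightarrow> x = 0"

text \<open>Being a \<open>lattice_ring\<close> says that products of positive elements are positive.
  A unit is not part of the structure.\<close>

class f_algebra = vector_lattice + real_algebra + lattice_ring +
  assumes f_algebra_right: "inf x y = 0 \<Longrightarrow> 0 \<le> z \<Longrightarrow> inf (x * z) y = 0"
    and f_algebra_left: "inf x y = 0 \<Longrightarrow> 0 \<le> z \<Longrightarrow> inf (z * x) y = 0"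

definition identity_element :: "'a::f_algebra \<Rightarrow> bool" where
  "identity_element e \<longleftrightarrow> (\<forall>x. e * x = x \<and> x * e = x)"

definition subalgebra :: "'a::f_algebra set \<Rightarrow> bool" where
  "subalgebra B \<longleftrightarrow> subspace B \<and> (\<forall>x\<in>B. \<forall>y\<in>B. x * y \<in> B)"

definition strong_order_unit :: "'a::vector_lattice \<Rightarrow> bool" where
  "strong_order_unit e \<longleftrightarrow> (\<forall>x. \<exists>c\<ge>0. \<bar>x\<bar> \<le> c *\<^sub>R e)"

definition order_unit_norm :: "'a::vector_lattice \<Rightarrow> 'a \<Rightarrow> real" where
  "order_unit_norm e x = Inf {c. 0 \<le> c \<and> \<bar>x\<bar> \<le> c *\<^sub>R e}"

text \<open>When \<open>e\<close> is a strong order unit, this is a metric on the whole type.\<close>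

definition order_unit_dist :: "'a::vector_lattice \<Rightarrow> 'a \<Rightarrow> 'a \<Rightarrow> real" where
  "order_unit_dist e x y = order_unit_norm e (x - y)"

definition order_unit_complete :: "'a::vector_lattice \<Rightarrow> bool" where
  "order_unit_complete e \<longleftrightarrow> Metric_space.mcomplete UNIV (order_unit_dist e)"

definition order_unit_topology :: "'a::vector_lattice \<Rightarrow> 'a topology" where
  "order_unit_topology e = Metric_space.mtopology UNIV (order_unit_dist e)"


section \<open>Nets\<close>

text \<open>A net consists of an index set \<open>A\<close>, directed by the preorder \<open>r\<close> (where \<open>r \<alpha> \<beta>\<close>
  means that \<open>\<beta>\<close> is beyond \<open>\<alpha>\<close>), and a function whose values matter on \<open>A\<close> only.\<close>

definition directed :: "'i set \<Rightarrow> ('i \<Rightarrow> 'i \<Rightarrow> bool) \<Rightarrow> bool" where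
  "directed A r \<longleftrightarrow> A \<noteq> {} \<and> (\<forall>\<alpha>\<in>A. r \<alpha> \<alpha>)
     \<and> (\<forall>\<alpha>\<in>A. \<forall>\<beta>\<in>A. \<forall>\<gamma>\<in>A. r \<alpha> \<beta> \<longrightarrow> r \<beta> \<gamma> \<longrightarrow> r \<alpha> \<gamma>)
     \<and> (\<forall>\<alpha>\<in>A. \<forall>\<beta>\<in>A. \<exists>\<gamma>\<in>A. r \<alpha> \<gamma> \<and> r \<beta> \<gamma>)"

definition net_eventually :: "'i set \<Rightarrow> ('i \<Rightarrow> 'i \<Rightarrow> bool) \<Rightarrow> ('i \<Rightarrow> bool) \<Rightarrow> bool" where
  "net_eventually A r P \<longleftrightarrow> (\<exists>\<alpha>\<^sub>0\<in>A. \<forall>\<alpha>\<in>A. r \<alpha>\<^sub>0 \<alpha> \<longrightarrow> P \<alpha>)"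

definition net_converges ::
    "'a topology \<Rightarrow> 'i set \<Rightarrow> ('i \<Rightarrow> 'i \<Rightarrow> bool) \<Rightarrow> ('i \<Rightarrow> 'a) \<Rightarrow> 'a \<Rightarrow> bool" where
  "net_converges \<tau> A r x l \<longleftrightarrow>
     l \<in> topspace \<tau> \<and> (\<forall>U. openin \<tau> U \<longrightarrow> l \<in> U \<longrightarrow> net_eventually A r (\<lambda>\<alpha>. x \<alpha> \<in> U))"

definition decreases_to_zero ::
    "'i set \<Rightarrow> ('i \<Rightarrow> 'i \<Rightarrow> bool) \<Rightarrow> ('i \<Rightarrow> 'a::vector_lattice) \<Rightarrow> bool" where
  "decreases_to_zero B s y \<longleftrightarrow>
     (\<forall>\<beta>\<in>B. \<forall>\<beta>'\<in>B. s \<beta> \<beta>' \<longrightarrow> y \<beta>' \<le> y \<beta>)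
     \<and> (\<forall>\<beta>\<in>B. 0 \<le> y \<beta>) \<and> (\<forall>z. (\<forall>\<beta>\<in>B. z \<le> y \<beta>) \<longrightarrow> z \<le> 0)"

text \<open>HOL cannot quantify over the index type of the dominating net \<open>y\<close>.  Subsets of \<open>'a\<close>
  suffice as index sets, since only the range of \<open>y\<close> matters; see \<open>order_convergesI\<close>.\<close>

definition order_converges ::
    "'i set \<Rightarrow> ('i \<Rightarrow> 'i \<Rightarrow> bool) \<Rightarrow> ('i \<Rightarrow> 'a::vector_lattice) \<Rightarrow> 'a \<Rightarrow> bool" where
  "order_converges A r x l \<longleftrightarrow>
     (\<exists>(B::'a set) s y. directed B s \<and> decreases_to_zero B s y
        \<and> (\<forall>\<beta>\<in>B. net_eventually A r (\<lambda>\<alpha>. \<bar>l - x \<alpha>\<bar> \<le> y \<beta>)))"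

definition uo_converges ::
    "'i set \<Rightarrow> ('i \<Rightarrow> 'i \<Rightarrow> bool) \<Rightarrow> ('i \<Rightarrow> 'a::vector_lattice) \<Rightarrow> 'a \<Rightarrow> bool" where
  "uo_converges A r x l \<longleftrightarrow> (\<forall>y\<ge>0. order_converges A r (\<lambda>\<alpha>. inf \<bar>x \<alpha> - l\<bar> y) 0)"

lemma order_convergesI:
  fixes B :: "'b set" and y :: "'b \<Rightarrow> 'a::vector_lattice"
  assumes dir: "directed B s" and dec: "decreases_to_zero B s y"
    and ev: "\<forall>\<beta>\<in>B. net_eventually A r (\<lambda>\<alpha>. \<bar>l - x \<alpha>\<bar> \<le> y \<beta>)"
  shows "order_converges A r x l"
  unfolding order_converges_def
proof (intro exI conjI)
  show "directed (y ` B) (\<lambda>a b. b \<le> a)"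
    unfolding directed_def
  proof (intro conjI ballI impI)
    show "y ` B \<noteq> {}" using dir by (auto simp: directed_def)
    fix a b assume "a \<in> y ` B" "b \<in> y ` B"
    then obtain \<beta> \<beta>' where *: "\<beta> \<in> B" "\<beta>' \<in> B" "a = y \<beta>" "b = y \<beta>'" by auto
    with dir obtain \<gamma> where "\<gamma> \<in> B" "s \<beta> \<gamma>" "s \<beta>' \<gamma>" unfolding directed_def by metis
    with * dec show "\<exists>c\<in>y ` B. c \<le> a \<and> c \<le> b"
      unfolding decreases_to_zero_def by blast
  qed auto
  show "decreases_to_zero (y ` B) (\<lambda>a b. b \<le> a) (\<lambda>a. a)"
    using dec by (auto simp: decreases_to_zero_def)
  show "\<forall>\<beta>\<in>y ` B. net_eventually A r (\<lambda>\<alpha>. \<bar>l - x \<alpha>\<bar> \<le> \<beta>)"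
    using ev by auto
qed


text \<open>Likewise, conditions on all nets in \<open>'a\<close> are stated for index sets of type
  \<open>('a \<times> 'a set) set\<close>.  This is no restriction: every net in \<open>'a\<close> has the same
  eventual behaviour as one with such an index set.\<close>

lemma net_reindex:
  fixes x :: "'i \<Rightarrow> 'a"
  assumes dir: "directed A r"
  obtains A' :: "('a \<times> 'a set) set" and r' x'
  where "directed A' r'"
    and "\<And>P. net_eventually A' r' (\<lambda>\<alpha>. P (x' \<alpha>)) \<longleftrightarrow> net_eventually A r (\<lambda>\<alpha>. P (x \<alpha>))"
proof -
  define T where "T \<beta> = x ` {\<alpha>\<in>A. r \<beta> \<alpha>}" for \<beta>
  define A' where "A' = {(a, T \<beta>) | a \<beta>. \<beta> \<in> A \<and> a \<in> T \<beta>}"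
  define r' :: "'a \<times> 'a set \<Rightarrow> 'a \<times> 'a set \<Rightarrow> bool" where "r' p q \<longleftrightarrow> snd q \<subseteq> snd p" for p q
  have ne: "x \<beta> \<in> T \<beta>" if "\<beta> \<in> A" for \<beta>
    using dir that unfolding T_def directed_def by blast
  have mono: "T \<gamma> \<subseteq> T \<beta>" if "r \<beta> \<gamma>" "\<beta> \<in> A" "\<gamma> \<in> A" for \<beta> \<gamma>
    using dir that unfolding T_def directed_def by blast
  have inA': "(x \<beta>, T \<beta>) \<in> A'" if "\<beta> \<in> A" for \<beta>
    using ne[OF that] that unfolding A'_def by blast
  have "directed A' r'"
    unfolding directed_def
  proof (intro conjI ballI impI)
    show "A' \<noteq> {}" using dir inA' by (auto simp: directed_def)
    fix p q assume "p \<in> A'" "q \<in> A'"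
    then obtain \<beta> \<gamma> where *: "\<beta> \<in> A" "\<gamma> \<in> A" "snd p = T \<beta>" "snd q = T \<gamma>"
      unfolding A'_def by auto
    with dir obtain \<delta> where "\<delta> \<in> A" "r \<beta> \<delta>" "r \<gamma> \<delta>" unfolding directed_def by metis
    then show "\<exists>t\<in>A'. r' p t \<and> r' q t"
      using * mono inA' by (intro bexI[of _ "(x \<delta>, T \<delta>)"]) (auto simp: r'_def)
  qed (auto simp: r'_def)
  moreover have "net_eventually A' r' (\<lambda>\<alpha>. P (fst \<alpha>)) \<longleftrightarrow> net_eventually A r (\<lambda>\<alpha>. P (x \<alpha>))" for P
  proof
    assume "net_eventually A' r' (\<lambda>\<alpha>. P (fst \<alpha>))"
    then obtain p where p: "p \<in> A'" "\<forall>q\<in>A'. r' p q \<longrightarrow> P (fst q)"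
      unfolding net_eventually_def by blast
    then obtain \<beta> where \<beta>: "\<beta> \<in> A" "snd p = T \<beta>" unfolding A'_def by auto
    have "P (x \<alpha>)" if "\<alpha> \<in> A" "r \<beta> \<alpha>" for \<alpha>
      using p(2) \<beta> that inA' mono by (force simp: r'_def)
    then show "net_eventually A r (\<lambda>\<alpha>. P (x \<alpha>))"
      unfolding net_eventually_def using \<beta> by blast
  next
    assume "net_eventually A r (\<lambda>\<alpha>. P (x \<alpha>))"
    then obtain \<beta> where \<beta>: "\<beta> \<in> A" "\<forall>\<alpha>\<in>A. r \<beta> \<alpha> \<longrightarrow> P (x \<alpha>)"
      unfolding net_eventually_def by blast
    then have "\<forall>a\<in>T \<beta>. P a" by (auto simp: T_def)
    then have "\<forall>q\<in>A'. r' (x \<beta>, T \<beta>) q \<longrightarrow> P (fst q)"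
      unfolding A'_def r'_def by auto
    then show "net_eventually A' r' (\<lambda>\<alpha>. P (fst \<alpha>))"
      unfolding net_eventually_def using inA'[OF \<beta>(1)] by blast
  qed
  ultimately show thesis using that[of A' r' fst] by blast
qed


section \<open>uo-Lebesgue topologies\<close>

definition solid :: "'a::vector_lattice set \<Rightarrow> bool" where
  "solid S \<longleftrightarrow> (\<forall>x y. y \<in> S \<longrightarrow> \<bar>x\<bar> \<le> \<bar>y\<bar> \<longrightarrow> x \<in> S)"

definition linear_topology :: "'a::real_vector topology \<Rightarrow> bool" where
  "linear_topology \<tau> \<longleftrightarrow> topspace \<tau> = UNIV
     \<and> continuous_map (prod_topology \<tau> \<tau>) \<tau> (\<lambda>(x, y). x + y)
     \<and> continuous_map (prod_topology euclideanreal \<tau>) \<tau> (\<lambda>(c, x). c *\<^sub>R x)"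

definition locally_solid :: "'a::vector_lattice topology \<Rightarrow> bool" where
  "locally_solid \<tau> \<longleftrightarrow>
     (\<forall>U. openin \<tau> U \<longrightarrow> 0 \<in> U \<longrightarrow>
        (\<exists>V W. openin \<tau> W \<and> 0 \<in> W \<and> W \<subseteq> V \<and> solid V \<and> V \<subseteq> U))"

definition uo_Lebesgue :: "'a::vector_lattice topology \<Rightarrow> bool" where
  "uo_Lebesgue \<tau> \<longleftrightarrow> linear_topology \<tau> \<and> locally_solid \<tau>
     \<and> (\<forall>(A::('a \<times> 'a set) set) r x.
          directed A r \<longrightarrow> uo_converges A r x 0 \<longrightarrow> net_converges \<tau> A r x 0)"

lemma uo_Lebesgue_all_nets:
  fixes x :: "'i \<Rightarrow> 'a::vector_lattice"
  assumes "uo_Lebesgue \<tau>" and dir: "directed A r" and uo: "uo_converges A r x 0"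
  shows "net_converges \<tau> A r x 0"
proof -
  obtain A' :: "('a \<times> 'a set) set" and r' x' where
    *: "directed A' r'"
      "\<And>P. net_eventually A' r' (\<lambda>\<alpha>. P (x' \<alpha>)) \<longleftrightarrow> net_eventually A r (\<lambda>\<alpha>. P (x \<alpha>))"
    using net_reindex[OF dir] by metis
  have ev: "net_eventually A' r' (\<lambda>\<alpha>. \<bar>0 - inf \<bar>x' \<alpha> - 0\<bar> y\<bar> \<le> d)
      \<longleftrightarrow> net_eventually A r (\<lambda>\<alpha>. \<bar>0 - inf \<bar>x \<alpha> - 0\<bar> y\<bar> \<le> d)" for y d
    by (rule *(2))
  have "uo_converges A' r' x' 0"
    using uo unfolding uo_converges_def order_converges_def ev .
  with assms(1) *(1) have "net_converges \<tau> A' r' x' 0"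
    unfolding uo_Lebesgue_def by blast
  then show ?thesis
    unfolding net_converges_def by (simp add: *(2)[of "\<lambda>a. a \<in> _"])
qed

text \<open>Meaningful if there is exactly one such topology.\<close>

definition uo_Lebesgue_topology :: "'a::vector_lattice topology" where
  "uo_Lebesgue_topology = (THE \<tau>. Hausdorff_space \<tau> \<and> uo_Lebesgue \<tau>)"


section \<open>The order continuous dual\<close>

definition order_bounded_functional :: "('a::vector_lattice \<Rightarrow> real) \<Rightarrow> bool" where
  "order_bounded_functional \<phi> \<longleftrightarrow> linear \<phi> \<and> (\<forall>a b. bounded (\<phi> ` {a..b}))"

definition order_continuous_functional :: "('a::vector_lattice \<Rightarrow> real) \<Rightarrow> bool" where
  "order_continuous_functional \<phi> \<longleftrightarrow>
     (\<forall>(A::('a \<times> 'a set) set) r x.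
        directed A r \<longrightarrow> order_converges A r x 0 \<longrightarrow>
        net_converges euclideanreal A r (\<lambda>\<alpha>. \<phi> (x \<alpha>)) 0)"

lemma order_continuous_functional_all_nets:
  fixes x :: "'i \<Rightarrow> 'a::vector_lattice"
  assumes "order_continuous_functional \<phi>" and dir: "directed A r"
    and o: "order_converges A r x 0"
  shows "net_converges euclideanreal A r (\<lambda>\<alpha>. \<phi> (x \<alpha>)) 0"
proof -
  obtain A' :: "('a \<times> 'a set) set" and r' x' where
    *: "directed A' r'"
      "\<And>P. net_eventually A' r' (\<lambda>\<alpha>. P (x' \<alpha>)) \<longleftrightarrow> net_eventually A r (\<lambda>\<alpha>. P (x \<alpha>))"
    using net_reindex[OF dir] by metis
  have "order_converges A' r' x' 0"
    using o unfolding order_converges_def *(2)[of "\<lambda>a. \<bar>0 - a\<bar> \<le> _"] .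
  with assms(1) *(1) have "net_converges euclideanreal A' r' (\<lambda>\<alpha>. \<phi> (x' \<alpha>)) 0"
    unfolding order_continuous_functional_def by blast
  then show ?thesis
    unfolding net_converges_def by (simp add: *(2)[of "\<lambda>a. \<phi> a \<in> _"])
qed

definition oc_dual :: "('a::vector_lattice \<Rightarrow> real) set" where
  "oc_dual = {\<phi>. order_bounded_functional \<phi> \<and> order_continuous_functional \<phi>}"

definition functional_le :: "('a::vector_lattice \<Rightarrow> real) \<Rightarrow> ('a \<Rightarrow> real) \<Rightarrow> bool" where
  "functional_le \<phi> \<psi> \<longleftrightarrow> (\<forall>x\<ge>0. \<phi> x \<le> \<psi> x)"

text \<open>The modulus of \<open>\<phi>\<close> in \<open>oc_dual\<close>: the supremum of \<open>\<phi>\<close> and \<open>-\<phi>\<close> for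
  \<open>functional_le\<close> (not the pointwise one).\<close>

definition functional_modulus :: "('a::vector_lattice \<Rightarrow> real) \<Rightarrow> 'a \<Rightarrow> real" where
  "functional_modulus \<phi> = (THE \<psi>. \<psi> \<in> oc_dual
     \<and> functional_le \<phi> \<psi> \<and> functional_le (\<lambda>x. - \<phi> x) \<psi>
     \<and> (\<forall>\<theta>\<in>oc_dual. functional_le \<phi> \<theta> \<longrightarrow> functional_le (\<lambda>x. - \<phi> x) \<theta> \<longrightarrow> functional_le \<psi> \<theta>))"

definition oc_dual_ideal :: "('a::vector_lattice \<Rightarrow> real) set \<Rightarrow> bool" where
  "oc_dual_ideal I \<longleftrightarrow> I \<subseteq> oc_dual \<and> (\<lambda>x. 0) \<in> I
     \<and> (\<forall>\<phi>\<in>I. \<forall>\<psi>\<in>I. (\<lambda>x. \<phi> x + \<psi> x) \<in> I) \<and> (\<forall>c. \<forall>\<phi>\<in>I. (\<lambda>x. c * \<phi> x) \<in> I)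
     \<and> (\<forall>\<phi>\<in>I. \<forall>\<psi>\<in>oc_dual. functional_le (functional_modulus \<psi>) (functional_modulus \<phi>) \<longrightarrow> \<psi> \<in> I)"

definition separates_points :: "('a \<Rightarrow> real) set \<Rightarrow> bool" where
  "separates_points I \<longleftrightarrow> (\<forall>x y. x \<noteq> y \<longrightarrow> (\<exists>\<phi>\<in>I. \<phi> x \<noteq> \<phi> y))"

definition weak_topology_by :: "('a \<Rightarrow> real) set \<Rightarrow> 'a topology" where
  "weak_topology_by I = topology_generated_by {\<phi> -` U | \<phi> U. \<phi> \<in> I \<and> open U}"

definition seminorm_topology :: "('a::real_vector \<Rightarrow> real) set \<Rightarrow> 'a topology" where
  "seminorm_topology P =
     topology_generated_by {{y. p (y - x) < \<epsilon>} | p x \<epsilon>. p \<in> P \<and> 0 < \<epsilon>}"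

definition absolute_weak_topology_by :: "('a::vector_lattice \<Rightarrow> real) set \<Rightarrow> 'a topology" where
  "absolute_weak_topology_by I = seminorm_topology {\<lambda>x. functional_modulus \<phi> \<bar>x\<bar> | \<phi>. \<phi> \<in> I}"

end

theory Submission
  imports Defs
begin

text \<open>The candidate for the topology is generated by the gauges \<open>x \<mapsto> \<phi> (\<bar>x\<bar> \<sqinter> e)\<close>, where
  \<open>\<phi>\<close> runs through the positive elements of a separating ideal \<open>I\<close> of the order continuous dual.
  If a net is uo-null, then \<open>\<bar>x\<bar> \<sqinter> e\<close> is order null along it, so the gauges tend to zero; and since
  \<open>\<bar>x\<bar>\<close> lies below a multiple of \<open>\<bar>x\<bar> \<sqinter> e\<close>, the gauges separate the points.

  \<^bold>\<open>Uniqueness\<close>, in the sharp form \<open>uo_Lebesgue_eq_truncated_topology\<close>: every Hausdorff uo-Lebesgue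
  topology \<open>\<tau>\<close> equals the one generated by these gauges, for every separating \<open>I\<close>.  Both inclusions
  compare two kinds of bands, the null band of a positive functional and the intersection of a
  sequence of solid \<open>\<tau>\<close>-neighbourhoods with \<open>V (Suc n) + V (Suc n) \<subseteq> V n\<close>.  Each kind shrinks to \<open>0\<close>,
  the first because \<open>I\<close> separates points and the second because \<open>\<tau>\<close> is Hausdorff, and
  \<open>separating_bands_exhaust\<close> then shows that countably many members of one kind have their
  intersection inside a given member of the other.  After this reduction both inclusions are
  arguments of Borel--Cantelli type.  A sequence outside a \<open>\<tau>\<close>-neighbourhood whose gauges
  are summable would be uo-null after a modification on a null band, contradicting that \<open>\<tau>\<close> is
  uo-Lebesgue.  Conversely, if \<open>\<phi>\<close> were large on all neighbourhoods, an approximate limit superior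
  of elements of \<open>V n\<close> would lie in the intersection of the \<open>V n\<close> but not in the null band.  The lattice
  is not assumed to be Dedekind complete: suprema are replaced by upper bounds that are almost
  optimal for \<open>\<phi>\<close> (\<open>upper_bounds_minus_descends_to_zero\<close>) and band projections by the order
  density of a band plus its disjoint complement (\<open>band_plus_disjoint_order_dense\<close>).

  \<^bold>\<open>Closures.\<close>  The weak and the absolute weak closure of a subspace agree because both topologies have
  the dual \<open>I\<close>: a functional dominated by \<open>x \<mapsto> \<phi> \<bar>x\<bar>\<close> with \<open>\<phi>\<close> in \<open>I\<close> is in \<open>I\<close> because \<open>I\<close> is an
  ideal, and the Hahn--Banach theorem separates.  The topology of the gauges is coarser than the absolute weak topology.  For the remaining inclusion let
  \<open>x\<close> with \<open>\<bar>x\<bar> \<le> c *\<^sub>R e\<close> be close to \<open>b\<close> in the subalgebra for the gauge of \<open>\<phi>\<close>.  If \<open>b\<close> is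
  truncated at \<open>\<plusminus> c *\<^sub>R e\<close>, it becomes close to \<open>x\<close> for the seminorm \<open>y \<mapsto> \<phi> \<bar>y\<bar>\<close>, and the truncation is a norm limit of polynomials in
  \<open>b\<close> without constant term, so that it can be replaced by an element of the subalgebra.  Finally,
  norm limits are absolute weak limits, so the norm closure changes nothing.\<close>

section \<open>Sets decreasing to zero\<close>

text \<open>Most vanishing statements below use the Archimedean property in this form: a set that is stable
  under adding \<open>q\<close> contains all multiples of \<open>q\<close>.\<close>

lemma archimedean_translation:
  fixes q x :: "'a::vector_lattice"
  assumes "0 \<in> S" "\<And>s. s \<in> S \<Longrightarrow> s + q \<in> S" "\<And>s. s \<in> S \<Longrightarrow> s \<le> x" "0 \<le> q"
  shows "q = 0"
proof -
  have "real n *\<^sub>R q \<in> S" for n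
  proof (induction n)
    case (Suc n)
    have "real (Suc n) *\<^sub>R q = real n *\<^sub>R q + q"
      by (simp add: scaleR_add_left add.commute)
    then show ?case using assms(2)[OF Suc] by simp
  qed (use assms(1) in simp)
  then show ?thesis using archimedean[OF assms(4)] assms(3) by blast
qed

text \<open>Only the range of a dominating net matters for order convergence, so that nets decreasing to zero
  can be traded for downward directed sets with infimum \<open>0\<close>.\<close>

definition descends_to_zero :: "'a::vector_lattice set \<Rightarrow> bool" where
  "descends_to_zero D \<longleftrightarrow> D \<noteq> {} \<and> (\<forall>a\<in>D. \<forall>b\<in>D. \<exists>c\<in>D. c \<le> a \<and> c \<le> b)
     \<and> (\<forall>d\<in>D. 0 \<le> d) \<and> (\<forall>z. (\<forall>d\<in>D. z \<le> d) \<longrightarrow> z \<le> 0)"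

lemma descends_to_zeroI:
  assumes "D \<noteq> {}" "\<And>a b. a \<in> D \<Longrightarrow> b \<in> D \<Longrightarrow> \<exists>c\<in>D. c \<le> a \<and> c \<le> b"
    and pos: "\<And>d. d \<in> D \<Longrightarrow> 0 \<le> d"
    and low: "\<And>w. 0 \<le> w \<Longrightarrow> (\<And>d. d \<in> D \<Longrightarrow> w \<le> d) \<Longrightarrow> w = 0"
  shows "descends_to_zero D"
proof -
  have "z \<le> 0" if "\<forall>d\<in>D. z \<le> d" for z
  proof -
    have "sup z 0 = 0" using that pos by (intro low) auto
    then show ?thesis by (metis sup_ge1)
  qed
  then show ?thesis using assms(1,2) pos unfolding descends_to_zero_def by blast
qed

lemma descends_to_zero_lower:
  "descends_to_zero D \<Longrightarrow> (\<And>d. d \<in> D \<Longrightarrow> z \<le> d) \<Longrightarrow> z \<le> 0"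
  unfolding descends_to_zero_def by simp

lemma descends_to_zero_directed:
  assumes "descends_to_zero D"
  shows "directed D (\<lambda>a b. b \<le> a)" and "decreases_to_zero D (\<lambda>a b. b \<le> a) (\<lambda>a. a)"
  using assms unfolding directed_def decreases_to_zero_def descends_to_zero_def
  by (blast intro: order_trans)+

lemma descends_to_zero_order_converges:
  assumes "descends_to_zero D"
  shows "order_converges D (\<lambda>a b. b \<le> a) (\<lambda>a. a) 0"
  unfolding order_converges_def
proof (intro exI conjI ballI)
  show "directed D (\<lambda>a b. b \<le> a)" "decreases_to_zero D (\<lambda>a b. b \<le> a) (\<lambda>a. a)"
    using descends_to_zero_directed[OF assms] .
  fix d assume d: "d \<in> D"
  have "\<bar>0 - a\<bar> \<le> d" if "a \<in> D" "a \<le> d" for a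
    using that assms by (simp add: descends_to_zero_def)
  then show "net_eventually D (\<lambda>a b. b \<le> a) (\<lambda>\<alpha>. \<bar>0 - \<alpha>\<bar> \<le> d)"
    unfolding net_eventually_def using d by blast
qed

lemma order_converges_descends_to_zero:
  fixes x :: "'i \<Rightarrow> 'a::vector_lattice"
  assumes "order_converges A r x l"
  obtains D where "descends_to_zero D"
    "\<And>d. d \<in> D \<Longrightarrow> net_eventually A r (\<lambda>\<alpha>. \<bar>l - x \<alpha>\<bar> \<le> d)"
proof -
  obtain B :: "'a set" and s y where *: "directed B s" "decreases_to_zero B s y"
    "\<forall>\<beta>\<in>B. net_eventually A r (\<lambda>\<alpha>. \<bar>l - x \<alpha>\<bar> \<le> y \<beta>)"
    using assms unfolding order_converges_def by blast
  have "\<exists>c\<in>y ` B. c \<le> a \<and> c \<le> b" if ab: "a \<in> y ` B" "b \<in> y ` B" for a b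
  proof -
    obtain \<beta> \<gamma> where \<beta>: "\<beta> \<in> B" "a = y \<beta>" and \<gamma>: "\<gamma> \<in> B" "b = y \<gamma>"
      using ab by (elim imageE) simp
    then obtain \<delta> where "\<delta> \<in> B" "s \<beta> \<delta>" "s \<gamma> \<delta>"
      using *(1) unfolding directed_def by metis
    then show ?thesis using *(2) \<beta> \<gamma> unfolding decreases_to_zero_def
      by (intro bexI[of _ "y \<delta>"]) simp_all
  qed
  moreover have "B \<noteq> {}" using *(1) unfolding directed_def by blast
  ultimately have "descends_to_zero (y ` B)"
    using *(2) unfolding descends_to_zero_def decreases_to_zero_def by simp
  then show thesis using that *(3) by blast
qed

lemma order_convergesI_set:
  assumes "descends_to_zero D"
    "\<And>d. d \<in> D \<Longrightarrow> net_eventually A r (\<lambda>\<alpha>. \<bar>l - x \<alpha>\<bar> \<le> d)"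
  shows "order_converges A r x l"
  using order_convergesI[OF descends_to_zero_directed[OF assms(1)]] assms(2) by blast

text \<open>An increasing family need not have a supremum, but its upper bounds come arbitrarily close to it:
  if \<open>w\<close> lies below all gaps \<open>d - s\<close>, then \<open>d - w\<close> is again an upper bound, and so are all
  \<open>d - n *\<^sub>R w\<close>.\<close>

lemma upper_bounds_minus_descends_to_zero:
  fixes S :: "'a::vector_lattice set"
  assumes ne: "S \<noteq> {}" and dir: "\<And>a b. a \<in> S \<Longrightarrow> b \<in> S \<Longrightarrow> \<exists>c\<in>S. a \<le> c \<and> b \<le> c"
    and bd: "\<And>s. s \<in> S \<Longrightarrow> s \<le> u"
  shows "descends_to_zero {d - s | d s. s \<in> S \<and> (\<forall>t\<in>S. t \<le> d)}" (is "descends_to_zero ?D")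
proof (rule descends_to_zeroI)
  obtain s0 where s0: "s0 \<in> S" using ne by blast
  then show "?D \<noteq> {}" using bd by blast
  show "\<exists>c\<in>?D. c \<le> a \<and> c \<le> b" if "a \<in> ?D" "b \<in> ?D" for a b
  proof -
    obtain d s d' s' where *: "a = d - s" "s \<in> S" "\<forall>t\<in>S. t \<le> d" "b = d' - s'" "s' \<in> S" "\<forall>t\<in>S. t \<le> d'"
      using \<open>a \<in> ?D\<close> \<open>b \<in> ?D\<close> by blast
    obtain c where "c \<in> S" "s \<le> c" "s' \<le> c" using dir[OF *(2) *(5)] by blast
    moreover have "\<forall>t\<in>S. t \<le> inf d d'" using *(3,6) by simp
    ultimately have "inf d d' - c \<in> ?D" using \<open>c \<in> S\<close> by blast
    then show ?thesis unfolding *(1,4)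
      by (rule bexI[rotated]) (use \<open>s \<le> c\<close> \<open>s' \<le> c\<close> in \<open>auto intro: diff_mono\<close>)
  qed
  show "0 \<le> d" if "d \<in> ?D" for d using that by auto
  fix w assume w: "0 \<le> w" "\<And>d. d \<in> ?D \<Longrightarrow> w \<le> d"
  show "w = 0"
  proof (rule archimedean_translation[of "{t. \<forall>s\<in>S. s \<le> u - t}" w "u - s0"])
    show "0 \<in> {t. \<forall>s\<in>S. s \<le> u - t}" using bd by simp
    show "t + w \<in> {t. \<forall>s\<in>S. s \<le> u - t}" if "t \<in> {t. \<forall>s\<in>S. s \<le> u - t}" for t
      using w(2)[of "u - t - s" for s] that by (force simp: algebra_simps)
    show "t \<le> u - s0" if "t \<in> {t. \<forall>s\<in>S. s \<le> u - t}" for t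
      using that s0 by (auto simp: le_diff_eq add.commute)
  qed (rule w)
qed

section \<open>Disjointness and bands\<close>

lemma inf_add_le:
  fixes w a b :: "'a::lattice_ab_group_add"
  assumes "0 \<le> w" "0 \<le> a" "0 \<le> b"
  shows "inf w (a + b) \<le> inf w a + inf w b"
proof -
  have "inf w (a + b) \<le> inf (inf (w + w) (a + w)) (inf (w + b) (a + b))"
  proof (intro inf_greatest)
    have 1: "inf w (a + b) \<le> w" by simp
    show "inf w (a + b) \<le> w + w" "inf w (a + b) \<le> a + w" "inf w (a + b) \<le> w + b"
      using add_mono[OF 1 assms(1)] add_mono[OF assms(2) 1] add_mono[OF 1 assms(3)] by simp_all
  qed simp
  also have "\<dots> = inf w a + inf w b"
    by (simp add: add_inf_distrib_left add_inf_distrib_right)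
  finally show ?thesis .
qed

lemma disjoint_add_le:
  fixes a b c :: "'a::lattice_ab_group_add"
  assumes "inf a b = 0" "a \<le> c" "b \<le> c"
  shows "a + b \<le> c"
  using assms add_eq_inf_sup[of a b] by simp

text \<open>The positive part of the disjoint complement of \<open>N\<close>.\<close>

definition disjoint_cone :: "'a::vector_lattice set \<Rightarrow> 'a set" where
  "disjoint_cone N = {q. 0 \<le> q \<and> (\<forall>w\<in>N. 0 \<le> w \<longrightarrow> inf w q = 0)}"

lemma disjoint_cone_mono: "N \<subseteq> M \<Longrightarrow> disjoint_cone M \<subseteq> disjoint_cone N"
  unfolding disjoint_cone_def by blast

lemma disjoint_cone_le:
  assumes "q \<in> disjoint_cone N" "0 \<le> p" "p \<le> q"
  shows "p \<in> disjoint_cone N"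
proof -
  have "inf w p = 0" if "w \<in> N" "0 \<le> w" for w
  proof (rule antisym)
    have "inf w p \<le> inf w q" using assms by (meson inf_mono order_refl)
    moreover have "inf w q = 0" using that assms(1) unfolding disjoint_cone_def by blast
    ultimately show "inf w p \<le> 0" by simp
  qed (use that assms in simp)
  then show ?thesis using assms unfolding disjoint_cone_def by simp
qed

lemma disjoint_cone_add:
  assumes "p \<in> disjoint_cone N" "q \<in> disjoint_cone N"
  shows "p + q \<in> disjoint_cone N"
proof -
  have pq: "0 \<le> p" "0 \<le> q" using assms unfolding disjoint_cone_def by auto
  have "inf w (p + q) = 0" if "w \<in> N" "0 \<le> w" for w
  proof (rule antisym)
    have "inf w p = 0" "inf w q = 0" using that assms unfolding disjoint_cone_def by auto
    then show "inf w (p + q) \<le> 0" using inf_add_le[OF that(2) pq] by simp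
  qed (use that pq in simp)
  then show ?thesis using pq unfolding disjoint_cone_def by simp
qed

lemma disjoint_cone_sup:
  assumes "p \<in> disjoint_cone N" "q \<in> disjoint_cone N"
  shows "sup p q \<in> disjoint_cone N"
proof -
  have "0 \<le> p" "0 \<le> q" using assms unfolding disjoint_cone_def by auto
  then show ?thesis
    using disjoint_cone_le[OF disjoint_cone_add[OF assms], of "sup p q"]
    by (simp add: le_supI1)
qed

text \<open>Order closedness is stated for suprema of the sets \<open>N \<inter> {0..x}\<close> only.  These sets are directed,
  because \<open>N\<close> is solid and closed under addition, so that this is the usual notion of a band.\<close>

definition band :: "'a::vector_lattice set \<Rightarrow> bool" where
  "band N \<longleftrightarrow> 0 \<in> N \<and> solid N \<and> (\<forall>x\<in>N. \<forall>y\<in>N. x + y \<in> N) \<and>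
     (\<forall>x\<ge>0. descends_to_zero {x - s | s. s \<in> N \<and> 0 \<le> s \<and> s \<le> x} \<longrightarrow> x \<in> N)"

lemma solid_leD: "solid S \<Longrightarrow> y \<in> S \<Longrightarrow> 0 \<le> x \<Longrightarrow> x \<le> y \<Longrightarrow> x \<in> S"
  unfolding solid_def by (metis abs_of_nonneg order_trans)

lemma solid_abs_iff: "solid S \<Longrightarrow> \<bar>x\<bar> \<in> S \<longleftrightarrow> x \<in> S"
  unfolding solid_def by (metis abs_idempotent order_refl)

text \<open>If \<open>x\<close> is not in \<open>N\<close>, it is not the supremum of \<open>N \<inter> {0..x}\<close>, which leaves room for some \<open>q > 0\<close>
  below all \<open>x - s\<close>.  Such a \<open>q\<close> is disjoint from \<open>N\<close>: for \<open>w\<close> in \<open>N\<close>, adding \<open>inf w q\<close> never leaves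
  \<open>N \<inter> {0..x}\<close>.\<close>

lemma band_disjoint_part:
  fixes x :: "'a::vector_lattice"
  assumes N: "band N" and x: "0 \<le> x" "x \<notin> N"
  obtains q where "q \<in> disjoint_cone N" "0 \<le> q" "q \<noteq> 0" "q \<le> x"
proof -
  let ?S = "{s. s \<in> N \<and> 0 \<le> s \<and> s \<le> x}"
  let ?D = "{x - s | s. s \<in> ?S}"
  have N0: "0 \<in> N" and solN: "solid N" and addN: "\<And>x y. x \<in> N \<Longrightarrow> y \<in> N \<Longrightarrow> x + y \<in> N"
    using N unfolding band_def by auto
  have supS: "sup s t \<in> ?S" if "s \<in> ?S" "t \<in> ?S" for s t
  proof -
    have "sup s t \<le> s + t" "0 \<le> sup s t" using that by (auto simp: le_supI1)
    then have "sup s t \<in> N" using solid_leD[OF solN addN] that by blast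
    then show ?thesis using that by (simp add: le_supI1)
  qed
  have nD: "\<not> descends_to_zero ?D" using N x unfolding band_def by auto
  have "\<exists>q. 0 \<le> q \<and> (\<forall>s\<in>?S. q \<le> x - s) \<and> q \<noteq> 0"
  proof (rule ccontr)
    assume neg: "\<not> ?thesis"
    have "descends_to_zero ?D"
    proof (rule descends_to_zeroI)
      show "?D \<noteq> {}" using N0 x by blast
      show "\<exists>c\<in>?D. c \<le> a \<and> c \<le> b" if "a \<in> ?D" "b \<in> ?D" for a b
      proof -
        obtain s t where "a = x - s" "s \<in> ?S" "b = x - t" "t \<in> ?S"
          using \<open>a \<in> ?D\<close> \<open>b \<in> ?D\<close> by blast
        moreover from this have "x - sup s t \<in> ?D" using supS[of s t] by blast
        ultimately show ?thesis
          by (intro bexI[of _ "x - sup s t"] conjI) (simp_all add: diff_left_mono del: mem_Collect_eq)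
      qed
      show "0 \<le> d" if "d \<in> ?D" for d using that by auto
      show "w = 0" if w: "0 \<le> w" "\<And>d. d \<in> ?D \<Longrightarrow> w \<le> d" for w
      proof -
        have "\<forall>s\<in>?S. w \<le> x - s" using w(2) by blast
        then show ?thesis using neg w(1) by blast
      qed
    qed
    then show False using nD by simp
  qed
  then obtain q where q: "0 \<le> q" "\<And>s. s \<in> ?S \<Longrightarrow> q \<le> x - s" "q \<noteq> 0" by blast
  have "inf w q = 0" if w: "w \<in> N" "0 \<le> w" for w
  proof (rule archimedean_translation[of ?S _ x])
    show t0: "0 \<le> inf w q" using w q by simp
    have tN: "inf w q \<in> N" using solid_leD[OF solN w(1) t0] by simp
    show "s + inf w q \<in> ?S" if s: "s \<in> ?S" for s
    proof -
      have "s + inf w q \<le> x" using q(2)[OF s]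
        by (metis add.commute inf.coboundedI2 le_diff_eq)
      then show ?thesis using s tN t0 addN by simp
    qed
  qed (use N0 x in auto)
  moreover have "q \<le> x" using q(2)[of 0] N0 x by simp
  ultimately show thesis using that q unfolding disjoint_cone_def by blast
qed

text \<open>A substitute for band projections: an element \<open>w > 0\<close> below all \<open>x - (a + b)\<close> could be added to
  \<open>a\<close> again and again if it were in \<open>N\<close>, and otherwise it would dominate some \<open>q > 0\<close> disjoint from \<open>N\<close>
  that could be added to \<open>b\<close> again and again.\<close>

lemma band_plus_disjoint_order_dense:
  fixes x :: "'a::vector_lattice"
  assumes N: "band N" and x: "0 \<le> x"
  shows "descends_to_zero {x - (a + b) | a b. a \<in> N \<and> 0 \<le> a \<and> a \<le> x \<and> b \<in> disjoint_cone N \<and> b \<le> x}"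
    (is "descends_to_zero ?D")
proof (rule descends_to_zeroI)
  have N0: "0 \<in> N" and solN: "solid N" and addN: "\<And>x y. x \<in> N \<Longrightarrow> y \<in> N \<Longrightarrow> x + y \<in> N"
    using N unfolding band_def by auto
  have d0: "0 \<in> disjoint_cone N" unfolding disjoint_cone_def by (simp add: inf.absorb2)
  have dp: "0 \<le> b" if "b \<in> disjoint_cone N" for b using that unfolding disjoint_cone_def by blast
  show "?D \<noteq> {}" using N0 d0 x by blast
  have abx: "a + b \<le> x" if "a \<in> N" "0 \<le> a" "a \<le> x" "b \<in> disjoint_cone N" "b \<le> x" for a b
    using that disjoint_add_le[of a b x] unfolding disjoint_cone_def by blast
  show "0 \<le> d" if "d \<in> ?D" for d using that abx by force
  show "\<exists>c\<in>?D. c \<le> d \<and> c \<le> d'" if "d \<in> ?D" "d' \<in> ?D" for d d'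
  proof -
    obtain a b a' b' where
      d: "d = x - (a + b)" "a \<in> N" "0 \<le> a" "a \<le> x" "b \<in> disjoint_cone N" "b \<le> x" and
      d': "d' = x - (a' + b')" "a' \<in> N" "0 \<le> a'" "a' \<le> x" "b' \<in> disjoint_cone N" "b' \<le> x"
      using \<open>d \<in> ?D\<close> \<open>d' \<in> ?D\<close> by blast
    have "sup a a' \<in> N"
      using solid_leD[OF solN addN[OF d(2) d'(2)], of "sup a a'"] d d' by (simp add: le_supI1)
    moreover have "sup b b' \<in> disjoint_cone N" using disjoint_cone_sup d d' by blast
    moreover have "0 \<le> sup a a'" "sup a a' \<le> x" "sup b b' \<le> x" using d d' by (auto intro: le_supI1)
    ultimately have "x - (sup a a' + sup b b') \<in> ?D" by blast
    then show ?thesis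
      by (rule bexI[rotated]) (unfold d(1) d'(1), intro conjI diff_left_mono add_mono sup_ge1 sup_ge2)
  qed
  fix w assume w: "0 \<le> w" "\<And>d. d \<in> ?D \<Longrightarrow> w \<le> d"
  have wab: "a + b + w \<le> x" if "a \<in> N" "0 \<le> a" "a \<le> x" "b \<in> disjoint_cone N" "b \<le> x" for a b
  proof -
    have "w \<le> x - (a + b)" by (rule w(2)) (use that in blast)
    then show ?thesis by (simp add: le_diff_eq add.commute)
  qed
  show "w = 0"
  proof (cases "w \<in> N")
    case True
    show ?thesis
    proof (rule archimedean_translation[of "{a. a \<in> N \<and> 0 \<le> a \<and> a \<le> x}" w x])
      show "s + w \<in> {a. a \<in> N \<and> 0 \<le> a \<and> a \<le> x}" if "s \<in> {a. a \<in> N \<and> 0 \<le> a \<and> a \<le> x}" for s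
        using that wab[of s 0] d0 x w(1) addN True by auto
    qed (use N0 x w in auto)
  next
    case False
    then obtain q where q: "q \<in> disjoint_cone N" "0 \<le> q" "q \<noteq> 0" "q \<le> w"
      using band_disjoint_part[OF N w(1)] by blast
    have "q = 0"
    proof (rule archimedean_translation[of "{b \<in> disjoint_cone N. b \<le> x}" q x])
      show "s + q \<in> {b \<in> disjoint_cone N. b \<le> x}" if "s \<in> {b \<in> disjoint_cone N. b \<le> x}" for s
      proof -
        have "s + q \<le> s + w" using q by simp
        also have "\<dots> \<le> x" using wab[of 0 s] that N0 x by simp
        finally show ?thesis using that q disjoint_cone_add by blast
      qed
    qed (use d0 x q in auto)
    then show ?thesis using q by blast
  qed
qed

text \<open>The exhaustion principle behind both halves of the uniqueness proof: if the bands shrink to \<open>0\<close>, their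
  disjoint complements fill up \<open>u\<close>.  Indeed, some \<open>w > 0\<close> below all \<open>u - b\<close> would be missed by one of
  the bands and hence dominate some \<open>q > 0\<close> disjoint from that band; adding \<open>q\<close> to an admissible
  \<open>b\<close> would give an admissible element again.\<close>

lemma separating_bands_exhaust:
  fixes u :: "'a::vector_lattice"
  assumes u: "0 \<le> u" and ne: "\<N> \<noteq> {}" and band: "\<And>N. N \<in> \<N> \<Longrightarrow> band N"
    and dir: "\<And>N M. N \<in> \<N> \<Longrightarrow> M \<in> \<N> \<Longrightarrow> \<exists>L\<in>\<N>. L \<subseteq> N \<and> L \<subseteq> M"
    and sep: "\<Inter>\<N> \<subseteq> {0}"
  shows "descends_to_zero {u - b | b. b \<le> u \<and> (\<exists>N\<in>\<N>. b \<in> disjoint_cone N)}"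
    (is "descends_to_zero ?D")
proof (rule descends_to_zeroI)
  let ?S = "{b. b \<le> u \<and> (\<exists>N\<in>\<N>. b \<in> disjoint_cone N)}"
  have "0 \<in> disjoint_cone N" for N :: "'a set" unfolding disjoint_cone_def by (simp add: inf.absorb2)
  then have S0: "0 \<in> ?S" using u ne by blast
  then show "?D \<noteq> {}" by blast
  show "0 \<le> d" if "d \<in> ?D" for d using that by auto
  have common: "\<exists>L\<in>\<N>. p \<in> disjoint_cone L \<and> q \<in> disjoint_cone L"
    if "N \<in> \<N>" "M \<in> \<N>" "p \<in> disjoint_cone N" "q \<in> disjoint_cone M" for p q N M
    using dir[OF that(1,2)] that(3,4) disjoint_cone_mono by blast
  show "\<exists>c\<in>?D. c \<le> d \<and> c \<le> d'" if "d \<in> ?D" "d' \<in> ?D" for d d'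
  proof -
    obtain b b' where b: "d = u - b" "d' = u - b'" "b \<in> ?S" "b' \<in> ?S"
      using \<open>d \<in> ?D\<close> \<open>d' \<in> ?D\<close> by blast
    obtain N M where NM: "N \<in> \<N>" "M \<in> \<N>" "b \<in> disjoint_cone N" "b' \<in> disjoint_cone M"
      using b(3,4) by blast
    obtain L where "L \<in> \<N>" "b \<in> disjoint_cone L" "b' \<in> disjoint_cone L"
      using common[OF NM] by blast
    then have "u - sup b b' \<in> ?D" using b disjoint_cone_sup by (auto intro!: exI[of _ "sup b b'"])
    then show ?thesis by (rule bexI[rotated]) (auto simp: b intro!: diff_left_mono)
  qed
  fix w assume w: "0 \<le> w" "\<And>d. d \<in> ?D \<Longrightarrow> w \<le> d"
  show "w = 0"
  proof (rule ccontr)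
    assume "w \<noteq> 0"
    then obtain N where N: "N \<in> \<N>" "w \<notin> N" using sep by blast
    then obtain q where q: "q \<in> disjoint_cone N" "0 \<le> q" "q \<noteq> 0" "q \<le> w"
      using band_disjoint_part[OF band[OF N(1)] w(1)] by blast
    have "q = 0"
    proof (rule archimedean_translation[of ?S q u])
      show "s + q \<in> ?S" if s: "s \<in> ?S" for s
      proof -
        have "w \<le> u - s" using w(2) s by blast
        then have "s + q \<le> u" using q(4)
          by (metis add.commute le_diff_eq order_trans)
        moreover obtain L where "L \<in> \<N>" "s \<in> disjoint_cone L" "q \<in> disjoint_cone L"
          using s common[OF _ N(1) _ q(1)] by blast
        ultimately show ?thesis using disjoint_cone_add by blast
      qed
    qed (use S0 q in auto)
    then show False using q by blast
  qed
qed

section \<open>Order continuous functionals and their moduli\<close>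

text \<open>The positive elements of \<open>oc_dual\<close>, with order continuity phrased by sets decreasing to zero.\<close>

definition normal_functional :: "('a::vector_lattice \<Rightarrow> real) \<Rightarrow> bool" where
  "normal_functional \<phi> \<longleftrightarrow> linear \<phi> \<and> (\<forall>x\<ge>0. 0 \<le> \<phi> x)
     \<and> (\<forall>D \<epsilon>. descends_to_zero D \<longrightarrow> 0 < \<epsilon> \<longrightarrow> (\<exists>d\<in>D. \<phi> d < \<epsilon>))"

lemma normal_functionalD:
  assumes "normal_functional \<phi>"
  shows "linear \<phi>" "0 \<le> x \<Longrightarrow> 0 \<le> \<phi> x"
    "descends_to_zero D \<Longrightarrow> 0 < \<epsilon> \<Longrightarrow> \<exists>d\<in>D. \<phi> d < \<epsilon>"
  using assms unfolding normal_functional_def by auto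

lemma normal_functional_mono:
  assumes "normal_functional \<phi>" "x \<le> y" shows "\<phi> x \<le> \<phi> y"
proof -
  have "0 \<le> \<phi> (y - x)" using assms normal_functionalD(2) by (metis diff_ge_0_iff_ge)
  then show ?thesis using linear_diff[OF normal_functionalD(1)[OF assms(1)]] by simp
qed

lemma normal_functional_abs_le:
  assumes "normal_functional \<phi>" shows "\<bar>\<phi> x\<bar> \<le> \<phi> \<bar>x\<bar>"
  using normal_functional_mono[OF assms abs_ge_self] normal_functional_mono[OF assms abs_ge_minus_self]
    linear_neg[OF normal_functionalD(1)[OF assms]] by (simp add: abs_le_iff)

lemma normal_functional_zero: "normal_functional (\<lambda>x. 0)"
  unfolding normal_functional_def descends_to_zero_def by (auto simp: linear_zero)

lemma normal_functional_add:
  assumes "normal_functional \<phi>" "normal_functional \<psi>"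
  shows "normal_functional (\<lambda>x. \<phi> x + \<psi> x)"
proof -
  have "\<exists>d\<in>D. \<phi> d + \<psi> d < \<epsilon>" if D: "descends_to_zero D" and \<epsilon>: "0 < \<epsilon>" for D \<epsilon>
  proof -
    obtain a b where ab: "a \<in> D" "b \<in> D" "\<phi> a < \<epsilon> / 2" "\<psi> b < \<epsilon> / 2"
      using normal_functionalD(3)[OF _ D, of _ "\<epsilon> / 2"] assms \<epsilon> by (metis half_gt_zero)
    then obtain c where c: "c \<in> D" "c \<le> a" "c \<le> b" using D unfolding descends_to_zero_def by blast
    show ?thesis
      using normal_functional_mono[OF assms(1) c(2)] normal_functional_mono[OF assms(2) c(3)] ab
      by (intro bexI[OF _ c(1)]) simp
  qed
  then show ?thesis
    using assms unfolding normal_functional_def by (auto intro: linear_compose_add)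
qed

lemma normal_functional_scale:
  assumes "normal_functional \<phi>" "0 \<le> c"
  shows "normal_functional (\<lambda>x. c * \<phi> x)"
proof (cases "c = 0")
  case False
  then have c: "0 < c" using assms by simp
  have "\<exists>d\<in>D. c * \<phi> d < \<epsilon>" if D: "descends_to_zero D" and \<epsilon>: "0 < \<epsilon>" for D \<epsilon>
    using normal_functionalD(3)[OF assms(1) D, of "\<epsilon> / c"] \<epsilon> c by (auto simp: field_simps)
  moreover have "linear (\<lambda>x. c * \<phi> x)"
    using linear_compose_scale_right[OF normal_functionalD(1)[OF assms(1)], of c] by simp
  ultimately show ?thesis
    using assms unfolding normal_functional_def by auto
qed (simp add: normal_functional_zero)

text \<open>A supremum of \<open>s\<close> up to \<open>\<epsilon>\<close>, measured by \<open>\<phi>\<close>.\<close>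

lemma normal_functional_increasing_gap:
  fixes s :: "nat \<Rightarrow> 'a::vector_lattice"
  assumes \<phi>: "normal_functional \<phi>" and s: "\<And>i j. i \<le> j \<Longrightarrow> s i \<le> s j" "\<And>i. s i \<le> u" and \<epsilon>: "0 < \<epsilon>"
  shows "\<exists>d i. (\<forall>i. s i \<le> d) \<and> \<phi> (d - s i) < \<epsilon>"
proof -
  have "descends_to_zero {d - t | d t. t \<in> range s \<and> (\<forall>t'\<in>range s. t' \<le> d)}"
  proof (rule upper_bounds_minus_descends_to_zero[where u = u])
    show "\<exists>c\<in>range s. a \<le> c \<and> b \<le> c" if ab: "a \<in> range s" "b \<in> range s" for a b
    proof -
      obtain i j where "a = s i" "b = s j" using ab by blast
      then have "a \<le> s (max i j) \<and> b \<le> s (max i j)" using s(1)[of i "max i j"] s(1)[of j "max i j"] by simp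
      then show ?thesis by blast
    qed
  qed (use s(2) in auto)
  from normal_functionalD(3)[OF \<phi> this \<epsilon>] show ?thesis by auto
qed

text \<open>Order boundedness and order continuity are inherited from the dominating functional.\<close>

lemma oc_dual_dominated:
  fixes f \<phi> :: "'a::vector_lattice \<Rightarrow> real"
  assumes lin: "linear f" and \<phi>: "normal_functional \<phi>" and le: "\<And>x. \<bar>f x\<bar> \<le> \<phi> \<bar>x\<bar>"
  shows "f \<in> oc_dual"
proof -
  have "bounded (f ` {a..b})" for a b
  proof (rule boundedI)
    fix r assume "r \<in> f ` {a..b}"
    then obtain x where x: "r = f x" "a \<le> x" "x \<le> b" by auto
    have "x \<le> \<bar>a\<bar> + \<bar>b\<bar>" "- x \<le> \<bar>a\<bar> + \<bar>b\<bar>"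
      using x(2,3) abs_ge_self[of b] abs_ge_minus_self[of a]
      by (meson abs_ge_zero add_increasing add_increasing2 neg_le_iff_le order_trans)+
    then have "\<bar>x\<bar> \<le> \<bar>a\<bar> + \<bar>b\<bar>" by (rule abs_leI)
    then show "norm r \<le> \<phi> (\<bar>a\<bar> + \<bar>b\<bar>)"
      using le[of x] normal_functional_mono[OF \<phi>] x(1) by (metis order_trans real_norm_def)
  qed
  moreover have "order_continuous_functional f"
    unfolding order_continuous_functional_def
  proof (intro allI impI)
    fix A :: "('a \<times> 'a set) set" and r and x :: "'a \<times> 'a set \<Rightarrow> 'a"
    assume dir: "directed A r" and o: "order_converges A r x 0"
    obtain D where D: "descends_to_zero D"
      "\<And>d. d \<in> D \<Longrightarrow> net_eventually A r (\<lambda>\<alpha>. \<bar>0 - x \<alpha>\<bar> \<le> d)"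
      using order_converges_descends_to_zero[OF o] by blast
    show "net_converges euclideanreal A r (\<lambda>\<alpha>. f (x \<alpha>)) 0"
      unfolding net_converges_def
    proof (intro conjI allI impI)
      fix U assume "openin euclideanreal U" "(0::real) \<in> U"
      then obtain \<epsilon> where \<epsilon>: "0 < \<epsilon>" "\<And>t. \<bar>t\<bar> < \<epsilon> \<Longrightarrow> t \<in> U"
        unfolding open_openin[symmetric] open_dist by (auto simp: dist_real_def)
      obtain d where d: "d \<in> D" "\<phi> d < \<epsilon>" using normal_functionalD(3)[OF \<phi> D(1) \<epsilon>(1)] by blast
      have "f (x \<alpha>) \<in> U" if "\<bar>0 - x \<alpha>\<bar> \<le> d" for \<alpha>
        using le[of "x \<alpha>"] normal_functional_mono[OF \<phi> that] d(2) by (intro \<epsilon>(2)) simp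
      then show "net_eventually A r (\<lambda>\<alpha>. f (x \<alpha>) \<in> U)"
        using D(2)[OF d(1)] unfolding net_eventually_def by blast
    qed simp
  qed
  ultimately show ?thesis
    using lin unfolding oc_dual_def order_bounded_functional_def by blast
qed

lemma normal_functional_in_oc_dual: "normal_functional \<phi> \<Longrightarrow> \<phi> \<in> oc_dual"
  by (rule oc_dual_dominated) (auto intro: normal_functionalD normal_functional_abs_le)

lemma oc_dual_small:
  assumes "\<phi> \<in> oc_dual" "descends_to_zero D" "0 < \<epsilon>"
  shows "\<exists>d\<in>D. \<forall>d'\<in>D. d' \<le> d \<longrightarrow> \<bar>\<phi> d'\<bar> < \<epsilon>"
proof -
  have "net_converges euclideanreal D (\<lambda>a b. b \<le> a) \<phi> 0"
    using order_continuous_functional_all_nets[of \<phi> D _ "\<lambda>a. a"] assms(1)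
      descends_to_zero_directed(1) descends_to_zero_order_converges assms(2)
    unfolding oc_dual_def by blast
  then have "net_eventually D (\<lambda>a b. b \<le> a) (\<lambda>a. \<phi> a \<in> {- \<epsilon><..<\<epsilon>})"
    unfolding net_converges_def using assms(3) by (auto dest!: spec[of _ "{- \<epsilon><..<\<epsilon>}"])
  then show ?thesis unfolding net_eventually_def by (auto simp: abs_less_iff) (metis minus_less_iff)
qed

lemma oc_dual_linear: "\<phi> \<in> oc_dual \<Longrightarrow> linear \<phi>"
  unfolding oc_dual_def order_bounded_functional_def by blast

text \<open>Writing \<open>x = a - b\<close> with positive \<open>a\<close> and \<open>b\<close>, additivity makes \<open>s a - s b\<close> independent of the choice.\<close>

lemma cone_functional_extends:
  fixes s :: "'a::vector_lattice \<Rightarrow> real"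
  assumes add: "\<And>x y. 0 \<le> x \<Longrightarrow> 0 \<le> y \<Longrightarrow> s (x + y) = s x + s y"
    and scale: "\<And>c x. 0 \<le> c \<Longrightarrow> 0 \<le> x \<Longrightarrow> s (c *\<^sub>R x) = c * s x"
  obtains \<theta> where "linear \<theta>" "\<And>x. 0 \<le> x \<Longrightarrow> \<theta> x = s x"
proof -
  define \<theta> where "\<theta> x = s (pprt x) - s (- nprt x)" for x
  have pn: "0 \<le> pprt x" "0 \<le> - nprt x" "x = pprt x - (- nprt x)" for x :: 'a
    using prts[of x] nprt_le_zero[of x] by (auto simp del: nprt_le_zero)
  have diff: "\<theta> (a - b) = s a - s b" if ab: "0 \<le> a" "0 \<le> b" for a b
  proof -
    have "pprt (a - b) + b = a + (- nprt (a - b))"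
      using pn(3)[of "a - b"] by (simp add: algebra_simps)
    then have "s (pprt (a - b)) + s b = s a + s (- nprt (a - b))"
      using add[OF pn(1) ab(2)] add[OF ab(1) pn(2)] by metis
    then show ?thesis unfolding \<theta>_def by simp
  qed
  have "linear \<theta>"
  proof (rule linearI)
    fix x y :: 'a
    have "(pprt x + pprt y) - (- nprt x + - nprt y) = (pprt x + nprt x) + (pprt y + nprt y)"
      by (simp add: algebra_simps)
    also have "\<dots> = x + y" by (simp only: prts[symmetric])
    finally have "\<theta> (x + y) = s (pprt x + pprt y) - s (- nprt x + - nprt y)"
      using diff[of "pprt x + pprt y" "- nprt x + - nprt y"] pn(1,2) by (simp only: add_nonneg_nonneg)
    also have "\<dots> = \<theta> x + \<theta> y" unfolding \<theta>_def
      using add[OF pn(1)[of x] pn(1)[of y]] add[OF pn(2)[of x] pn(2)[of y]] by linarith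
    finally show "\<theta> (x + y) = \<theta> x + \<theta> y" .
  next
    fix c x
    show "\<theta> (c *\<^sub>R x) = c *\<^sub>R \<theta> x"
    proof (cases "0 \<le> c")
      case True
      have "c *\<^sub>R x = c *\<^sub>R pprt x - c *\<^sub>R (- nprt x)"
        using pn(3)[of x] by (metis scaleR_diff_right)
      then have "\<theta> (c *\<^sub>R x) = s (c *\<^sub>R pprt x) - s (c *\<^sub>R (- nprt x))"
        using diff pn(1,2) True by (metis scaleR_nonneg_nonneg)
      then show ?thesis unfolding \<theta>_def using scale[OF True] pn(1,2) by (simp only: right_diff_distrib real_scaleR_def)
    next
      case False
      then have c: "0 \<le> - c" by simp
      have "c *\<^sub>R x = (- c) *\<^sub>R (- nprt x) - (- c) *\<^sub>R pprt x"
        using pn(3)[of x] by (metis minus_diff_eq scaleR_diff_right scaleR_minus_left scaleR_minus_right minus_minus)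
      then have "\<theta> (c *\<^sub>R x) = s ((- c) *\<^sub>R (- nprt x)) - s ((- c) *\<^sub>R pprt x)"
        using diff pn(1,2) c by (metis scaleR_nonneg_nonneg)
      then show ?thesis unfolding \<theta>_def using scale[OF c] pn(1,2) by (simp add: algebra_simps del: scaleR_minus_left scaleR_minus_right)
    qed
  qed
  moreover have "\<theta> x = s x" if "0 \<le> x" for x
  proof -
    have "s 0 = 0" using scale[of 0 0] by simp
    then show ?thesis using diff[OF that, of 0] by simp
  qed
  ultimately show thesis using that by blast
qed

lemma linear_eq_on_positive_cone:
  fixes \<phi> \<psi> :: "'a::vector_lattice \<Rightarrow> real"
  assumes "linear \<phi>" "linear \<psi>" and eq: "\<And>x. 0 \<le> x \<Longrightarrow> \<phi> x = \<psi> x"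
  shows "\<phi> = \<psi>"
proof
  fix x
  have "\<phi> (pprt x - pprt (- x)) = \<psi> (pprt x - pprt (- x))"
    unfolding assms(1,2)[THEN linear_diff] using eq by (simp del: pprt_neg)
  then show "\<phi> x = \<psi> x" using prts[of x] by (simp add: pprt_neg)
qed

lemma diff_inf_self:
  fixes a b :: "'a::lattice_ab_group_add"
  shows "a - inf a b = sup 0 (a - b)"
  by (simp add: diff_inf_eq_sup add_sup_distrib_left)

lemma riesz_decomposition:
  fixes x y z :: "'a::lattice_ab_group_add"
  assumes "0 \<le> x" "0 \<le> y" "0 \<le> z" "z \<le> x + y"
  obtains a b where "z = a + b" "0 \<le> a" "a \<le> x" "0 \<le> b" "b \<le> y"
proof (rule that[of "inf z x" "z - inf z x"])
  show "z = inf z x + (z - inf z x)" by (metis add.commute diff_add_cancel)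
  show "0 \<le> z - inf z x" by (simp only: diff_ge_0_iff_ge inf_le1)
  have "z - x \<le> y" using assms(4) by (simp add: algebra_simps)
  then show "z - inf z x \<le> y" using assms(2) by (simp only: diff_inf_self le_sup_iff)
qed (use assms in auto)

text \<open>The Riesz--Kantorovich formula \<open>\<theta> x = Sup (\<phi> ` {0..x})\<close>, additive on the cone by Riesz decomposition.
  For order continuity let \<open>c \<le> x\<close> be in a set decreasing to zero and \<open>0 \<le> y \<le> x\<close>.  Then
  \<open>y - inf y c \<le> x - c\<close> gives \<open>\<theta> c \<le> (\<theta> x - \<phi> y) + \<phi> (inf y c)\<close>; the first term is small for a
  suitable \<open>y\<close>, and then the second for small \<open>c\<close>.\<close>

lemma oc_dual_positive_part:
  fixes \<phi> :: "'a::vector_lattice \<Rightarrow> real"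
  assumes \<phi>: "\<phi> \<in> oc_dual"
  obtains \<theta> where "normal_functional \<theta>" "\<And>x y. 0 \<le> y \<Longrightarrow> y \<le> x \<Longrightarrow> \<phi> y \<le> \<theta> x"
    "\<And>x c. 0 \<le> x \<Longrightarrow> (\<And>y. 0 \<le> y \<Longrightarrow> y \<le> x \<Longrightarrow> \<phi> y \<le> c) \<Longrightarrow> \<theta> x \<le> c"
proof -
  define s where "s x = Sup (\<phi> ` {0..x})" for x
  note lin = oc_dual_linear[OF \<phi>]
  have bdd: "bdd_above (\<phi> ` {0..x})" for x
    using \<phi> unfolding oc_dual_def order_bounded_functional_def by (simp add: bounded_imp_bdd_above)
  have upper: "\<phi> y \<le> s x" if "0 \<le> y" "y \<le> x" for x y
    unfolding s_def using that by (intro cSup_upper bdd) auto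
  have least: "s x \<le> c" if "0 \<le> x" "\<And>y. 0 \<le> y \<Longrightarrow> y \<le> x \<Longrightarrow> \<phi> y \<le> c" for x c
    unfolding s_def using that by (intro cSup_least) auto
  have add: "s (x + y) = s x + s y" if xy: "0 \<le> x" "0 \<le> y" for x y
  proof (rule antisym)
    show "s (x + y) \<le> s x + s y"
    proof (rule least)
      fix z assume "0 \<le> z" "z \<le> x + y"
      then obtain a b where "z = a + b" "0 \<le> a" "a \<le> x" "0 \<le> b" "b \<le> y"
        using riesz_decomposition xy by blast
      then show "\<phi> z \<le> s x + s y" using upper linear_add[OF lin] by (simp add: add_mono)
    qed (use xy in simp)
    have "s x \<le> s (x + y) - s y"
    proof (rule least[OF xy(1)])
      fix a assume a: "0 \<le> a" "a \<le> x"
      have "s y \<le> s (x + y) - \<phi> a"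
      proof (rule least[OF xy(2)])
        fix b assume b: "0 \<le> b" "b \<le> y"
        have "\<phi> (a + b) \<le> s (x + y)" using a b by (intro upper add_nonneg_nonneg add_mono)
        then show "\<phi> b \<le> s (x + y) - \<phi> a" using linear_add[OF lin] by simp
      qed
      then show "\<phi> a \<le> s (x + y) - s y" by simp
    qed
    then show "s x + s y \<le> s (x + y)" by simp
  qed
  have scale_le: "c * s x \<le> s (c *\<^sub>R x)" if c: "0 < c" and x: "0 \<le> x" for c x
  proof -
    have "s x \<le> s (c *\<^sub>R x) / c"
    proof (rule least[OF x])
      fix y assume y: "0 \<le> y" "y \<le> x"
      have "\<phi> (c *\<^sub>R y) \<le> s (c *\<^sub>R x)"
        using y c by (intro upper scaleR_nonneg_nonneg scaleR_left_mono) auto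
      then show "\<phi> y \<le> s (c *\<^sub>R x) / c" using linear_scale[OF lin] c by (simp add: field_simps)
    qed
    then show ?thesis using c by (simp add: field_simps)
  qed
  have scale: "s (c *\<^sub>R x) = c * s x" if c: "0 \<le> c" and x: "0 \<le> x" for c x
  proof (cases "c = 0")
    case True
    have "s 0 = 0" using add[of 0 0] by simp
    then show ?thesis using True by simp
  next
    case False
    then have c: "0 < c" using c by simp
    then have "inverse c * s (c *\<^sub>R x) \<le> s x"
      using scale_le[of "inverse c" "c *\<^sub>R x"] x by (simp add: scaleR_nonneg_nonneg)
    then show ?thesis using scale_le[OF c x] c by (simp add: field_simps antisym)
  qed
  obtain \<theta> where \<theta>: "linear \<theta>" "\<And>x. 0 \<le> x \<Longrightarrow> \<theta> x = s x"
    using cone_functional_extends[of s] add scale by blast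
  have \<theta>_upper: "\<phi> y \<le> \<theta> x" if "0 \<le> y" "y \<le> x" for x y
    using upper[OF that] \<theta>(2)[of x] that by (metis order_trans)
  have \<theta>_least: "\<theta> x \<le> c" if "0 \<le> x" "\<And>y. 0 \<le> y \<Longrightarrow> y \<le> x \<Longrightarrow> \<phi> y \<le> c" for x c
    using least[OF that] \<theta>(2)[OF that(1)] by simp
  have pos: "0 \<le> \<theta> x" if "0 \<le> x" for x
    using \<theta>_upper[of 0 x] that linear_0[OF lin] by simp
  have "\<exists>d\<in>D. \<theta> d < \<epsilon>" if D: "descends_to_zero D" and \<epsilon>: "0 < \<epsilon>" for D \<epsilon>
  proof -
    have Dpos: "\<And>d. d \<in> D \<Longrightarrow> 0 \<le> d" using D unfolding descends_to_zero_def by blast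
    obtain x where x: "x \<in> D" using D unfolding descends_to_zero_def by blast
    have "\<exists>y. 0 \<le> y \<and> y \<le> x \<and> \<theta> x - \<epsilon> / 2 < \<phi> y"
      using \<theta>_least[OF Dpos[OF x], of "\<theta> x - \<epsilon> / 2"] \<epsilon> by force
    then obtain y where y: "0 \<le> y" "y \<le> x" "\<theta> x - \<epsilon> / 2 < \<phi> y" by blast
    have "descends_to_zero ((\<lambda>d. inf y d) ` D)"
    proof (rule descends_to_zeroI)
      show "\<exists>c\<in>(\<lambda>d. inf y d) ` D. c \<le> a \<and> c \<le> b"
        if ab: "a \<in> (\<lambda>d. inf y d) ` D" "b \<in> (\<lambda>d. inf y d) ` D" for a b
      proof -
        obtain d d' where dd: "d \<in> D" "d' \<in> D" "a = inf y d" "b = inf y d'" using ab by blast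
        then obtain c where "c \<in> D" "c \<le> d" "c \<le> d'" using D unfolding descends_to_zero_def by blast
        then show ?thesis using dd by (intro bexI[of _ "inf y c"]) (auto intro: le_infI2)
      qed
      show "(\<lambda>d. inf y d) ` D \<noteq> {}" using x by blast
      show "0 \<le> d" if "d \<in> (\<lambda>d. inf y d) ` D" for d using that Dpos y by auto
      fix w assume w: "0 \<le> w" "\<And>d. d \<in> (\<lambda>d. inf y d) ` D \<Longrightarrow> w \<le> d"
      have "w \<le> d" if "d \<in> D" for d using w(2)[OF imageI[OF that]] by simp
      then have "w \<le> 0" using D unfolding descends_to_zero_def by blast
      then show "w = 0" using w(1) by simp
    qed
    from oc_dual_small[OF \<phi> this, of "\<epsilon> / 2"] \<epsilon>
    obtain d where d: "d \<in> D" "\<And>d'. d' \<in> D \<Longrightarrow> inf y d' \<le> inf y d \<Longrightarrow> \<bar>\<phi> (inf y d')\<bar> < \<epsilon> / 2" by auto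
    obtain c where c: "c \<in> D" "c \<le> d" "c \<le> x" using D x d(1) unfolding descends_to_zero_def by blast
    have small: "\<phi> (inf y c) < \<epsilon> / 2"
      using d(2)[OF c(1)] c(2) by (metis abs_less_iff inf_mono order_refl)
    have "y - inf y c \<le> x - c" "0 \<le> y - inf y c"
      using diff_right_mono[OF y(2), of c] c(3) by (simp_all only: diff_inf_self le_sup_iff sup_ge1) simp
    then have "\<phi> (y - inf y c) \<le> \<theta> (x - c)" by (intro \<theta>_upper)
    then have "\<phi> y - \<phi> (inf y c) \<le> \<theta> x - \<theta> c"
      by (simp only: linear_diff[OF lin] linear_diff[OF \<theta>(1)])
    then have "\<theta> c < \<epsilon>" using y(3) small by linarith
    then show ?thesis using c(1) by blast
  qed
  then have "normal_functional \<theta>" using pos \<theta>(1) unfolding normal_functional_def by blast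
  then show thesis using that \<theta>_upper \<theta>_least by blast
qed

text \<open>The supremum of \<open>\<phi>\<close> and \<open>-\<phi>\<close> is \<open>\<theta> + \<theta>'\<close>, the sum of their positive parts.\<close>

lemma functional_modulus_properties:
  fixes \<phi> :: "'a::vector_lattice \<Rightarrow> real"
  assumes \<phi>: "\<phi> \<in> oc_dual"
  shows "normal_functional (functional_modulus \<phi>)"
    and "functional_le \<phi> (functional_modulus \<phi>)"
    and "functional_le (\<lambda>x. - \<phi> x) (functional_modulus \<phi>)"
    and "\<And>\<theta>. \<theta> \<in> oc_dual \<Longrightarrow> functional_le \<phi> \<theta> \<Longrightarrow> functional_le (\<lambda>x. - \<phi> x) \<theta>
      \<Longrightarrow> functional_le (functional_modulus \<phi>) \<theta>"
proof -
  let ?P = "\<lambda>\<psi>. \<psi> \<in> oc_dual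
     \<and> functional_le \<phi> \<psi> \<and> functional_le (\<lambda>x. - \<phi> x) \<psi>
     \<and> (\<forall>\<theta>\<in>oc_dual. functional_le \<phi> \<theta> \<longrightarrow> functional_le (\<lambda>x. - \<phi> x) \<theta> \<longrightarrow> functional_le \<psi> \<theta>)"
  note lin = oc_dual_linear[OF \<phi>]
  obtain \<theta> where \<theta>: "normal_functional \<theta>" "\<And>x y. 0 \<le> y \<Longrightarrow> y \<le> x \<Longrightarrow> \<phi> y \<le> \<theta> x"
    "\<And>x c. 0 \<le> x \<Longrightarrow> (\<And>y. 0 \<le> y \<Longrightarrow> y \<le> x \<Longrightarrow> \<phi> y \<le> c) \<Longrightarrow> \<theta> x \<le> c"
    using oc_dual_positive_part[OF \<phi>] by blast
  have mlin: "linear (\<lambda>x. - \<phi> x)"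
    using linear_compose_neg[OF lin] .
  have "(\<lambda>x. - \<phi> x) \<in> oc_dual"
  proof -
    have "bounded ((\<lambda>x. - \<phi> x) ` {a..b})" for a b
    proof -
      have "bounded (uminus ` (\<phi> ` {a..b}))"
        using \<phi> unfolding oc_dual_def order_bounded_functional_def by (simp add: bounded_uminus)
      then show ?thesis by (simp add: image_image)
    qed
    moreover have "order_continuous_functional (\<lambda>x. - \<phi> x)"
      unfolding order_continuous_functional_def
    proof (intro allI impI)
      fix A :: "('a \<times> 'a set) set" and r and x :: "'a \<times> 'a set \<Rightarrow> 'a"
      assume "directed A r" "order_converges A r x 0"
      then have c: "net_converges euclideanreal A r (\<lambda>\<alpha>. \<phi> (x \<alpha>)) 0"
        using \<phi> unfolding oc_dual_def order_continuous_functional_def by blast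
      show "net_converges euclideanreal A r (\<lambda>\<alpha>. - \<phi> (x \<alpha>)) 0"
        unfolding net_converges_def
      proof (intro conjI allI impI)
        fix U :: "real set" assume U: "openin euclideanreal U" "0 \<in> U"
        have "open (uminus ` U)" using U(1) by (simp add: open_negations)
        then have "net_eventually A r (\<lambda>\<alpha>. \<phi> (x \<alpha>) \<in> uminus ` U)"
          using c U(2) unfolding net_converges_def by force
        then show "net_eventually A r (\<lambda>\<alpha>. - \<phi> (x \<alpha>) \<in> U)"
          by (simp add: image_iff net_eventually_def) (metis minus_minus)
      qed simp
    qed
    ultimately show ?thesis
      using mlin unfolding oc_dual_def order_bounded_functional_def by blast
  qed
  then obtain \<theta>' where \<theta>': "normal_functional \<theta>'" "\<And>x y. 0 \<le> y \<Longrightarrow> y \<le> x \<Longrightarrow> - \<phi> y \<le> \<theta>' x"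
    "\<And>x c. 0 \<le> x \<Longrightarrow> (\<And>y. 0 \<le> y \<Longrightarrow> y \<le> x \<Longrightarrow> - \<phi> y \<le> c) \<Longrightarrow> \<theta>' x \<le> c"
    using oc_dual_positive_part[of "\<lambda>x. - \<phi> x"] by blast
  define \<psi> where "\<psi> x = \<theta> x + \<theta>' x" for x
  have \<psi>n: "normal_functional \<psi>" unfolding \<psi>_def using normal_functional_add \<theta>(1) \<theta>'(1) by blast
  have "functional_le \<phi> \<psi>"
    unfolding functional_le_def \<psi>_def
    using \<theta>(2)[of x x for x] normal_functionalD(2)[OF \<theta>'(1)] by (simp add: add_increasing2)
  moreover have "functional_le (\<lambda>x. - \<phi> x) \<psi>"
    unfolding functional_le_def \<psi>_def
    using \<theta>'(2)[of x x for x] normal_functionalD(2)[OF \<theta>(1)] by (simp add: add_increasing)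
  moreover have "functional_le \<psi> \<eta>"
    if \<eta>: "\<eta> \<in> oc_dual" "functional_le \<phi> \<eta>" "functional_le (\<lambda>x. - \<phi> x) \<eta>" for \<eta>
    unfolding functional_le_def
  proof (intro allI impI)
    fix x :: 'a assume x: "0 \<le> x"
    note \<eta>l = oc_dual_linear[OF \<eta>(1)]
    have \<eta>': "\<phi> y \<le> \<eta> y" "- \<phi> y \<le> \<eta> y" if "0 \<le> y" for y
      using \<eta> that unfolding functional_le_def by auto
    have "\<theta> x \<le> \<eta> x - \<theta>' x"
    proof (rule \<theta>(3)[OF x])
      fix y assume y: "0 \<le> y" "y \<le> x"
      have "\<theta>' x \<le> \<eta> x - \<phi> y"
      proof (rule \<theta>'(3)[OF x])
        fix z assume z: "0 \<le> z" "z \<le> x"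
        \<comment> \<open>Since \<open>\<phi> y - \<phi> z\<close> does not change when \<open>inf y z\<close> is subtracted from \<open>y\<close> and \<open>z\<close>, and the
           resulting disjoint elements have a sum below \<open>x\<close>, \<open>\<eta> x\<close> dominates both parts together.\<close>
        let ?i = "inf y z"
        have i: "0 \<le> y - ?i" "0 \<le> z - ?i" "0 \<le> x - (y - ?i) - (z - ?i)"
        proof (simp_all only: diff_ge_0_iff_ge inf_le1 inf_le2)
          have "y + z = sup y z + ?i" by (rule add_eq_inf_sup)
          then have "(y - ?i) + (z - ?i) = sup y z - ?i"
            by (metis add_diff_add add_diff_cancel_right diff_add_cancel)
          also have "\<dots> \<le> sup y z" using y z by (metis diff_left_mono diff_zero le_inf_iff)
          also have "\<dots> \<le> x" using y z by simp
          finally show "z - ?i \<le> x - (y - ?i)" by (simp only: le_diff_eq add.commute)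
        qed
        have "0 \<le> \<eta> (x - (y - ?i) - (z - ?i))"
          using \<eta>'[OF i(3)] by linarith
        then have "\<eta> (y - ?i) + \<eta> (z - ?i) \<le> \<eta> x" by (simp only: linear_diff[OF \<eta>l])
        moreover have "\<phi> (y - ?i) \<le> \<eta> (y - ?i)" "- \<phi> (z - ?i) \<le> \<eta> (z - ?i)" using \<eta>' i by auto
        ultimately have "\<phi> (y - ?i) - \<phi> (z - ?i) \<le> \<eta> x" by linarith
        then show "- \<phi> z \<le> \<eta> x - \<phi> y" by (simp only: linear_diff[OF lin])
      qed
      then show "\<phi> y \<le> \<eta> x - \<theta>' x" by simp
    qed
    then show "\<psi> x \<le> \<eta> x" unfolding \<psi>_def by simp
  qed
  ultimately have P: "?P \<psi>" using normal_functional_in_oc_dual[OF \<psi>n] by blast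
  have "functional_modulus \<phi> = \<psi>"
    unfolding functional_modulus_def
  proof (rule the_equality[of ?P, OF P])
    fix \<eta> assume \<eta>: "?P \<eta>"
    then have "functional_le \<eta> \<psi>" "functional_le \<psi> \<eta>" using P by blast+
    then have eq: "\<eta> x = \<psi> x" if "0 \<le> x" for x
      using that unfolding functional_le_def by (simp add: antisym)
    have l: "linear \<eta>" "linear \<psi>" using \<eta> P oc_dual_linear by blast+
    show "\<eta> = \<psi>" using linear_eq_on_positive_cone[OF l eq] .
  qed
  then show "normal_functional (functional_modulus \<phi>)"
    "functional_le \<phi> (functional_modulus \<phi>)"
    "functional_le (\<lambda>x. - \<phi> x) (functional_modulus \<phi>)"
    "\<And>\<theta>. \<theta> \<in> oc_dual \<Longrightarrow> functional_le \<phi> \<theta> \<Longrightarrow> functional_le (\<lambda>x. - \<phi> x) \<theta>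
      \<Longrightarrow> functional_le (functional_modulus \<phi>) \<theta>"
    using P \<psi>n by auto
qed

lemma functional_modulus_normal:
  assumes "normal_functional \<phi>" shows "functional_modulus \<phi> = \<phi>"
proof -
  have oc: "\<phi> \<in> oc_dual" by (rule normal_functional_in_oc_dual[OF assms])
  note m = functional_modulus_properties[OF oc]
  have le: "functional_le (functional_modulus \<phi>) \<phi>"
    using m(4)[OF oc] normal_functionalD(2)[OF assms] unfolding functional_le_def
    by (meson neg_le_0_iff_le order_refl order_trans)
  have eq: "functional_modulus \<phi> x = \<phi> x" if "0 \<le> x" for x
    using le m(2) that unfolding functional_le_def by (simp add: antisym)
  have l: "linear (functional_modulus \<phi>)" "linear \<phi>" using m(1) assms normal_functionalD by blast+
  show ?thesis using linear_eq_on_positive_cone[OF l eq] .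
qed

lemma abs_le_functional_modulus:
  assumes "\<phi> \<in> oc_dual" shows "\<bar>\<phi> x\<bar> \<le> functional_modulus \<phi> \<bar>x\<bar>"
proof -
  note m = functional_modulus_properties[OF assms]
  have p: "\<bar>\<phi> y\<bar> \<le> functional_modulus \<phi> y" if "0 \<le> y" for y
    using m(2,3) that unfolding functional_le_def by (auto intro: abs_leI)
  have "\<bar>\<phi> x\<bar> = \<bar>\<phi> (pprt x) + \<phi> (nprt x)\<bar>"
    using prts[of x] linear_add[OF oc_dual_linear[OF assms]] by metis
  also have "\<dots> \<le> \<bar>\<phi> (pprt x)\<bar> + \<bar>\<phi> (- nprt x)\<bar>"
    using linear_neg[OF oc_dual_linear[OF assms], of "nprt x"] by linarith
  also have "\<dots> \<le> functional_modulus \<phi> (pprt x) + functional_modulus \<phi> (- nprt x)"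
    using p[of "pprt x"] p[of "- nprt x"] by (intro add_mono) simp_all
  also have "\<dots> = functional_modulus \<phi> \<bar>x\<bar>"
    using linear_add[OF normal_functionalD(1)[OF m(1)]] by (metis abs_prts diff_conv_add_uminus)
  finally show ?thesis .
qed

text \<open>The positive cone of the ideal \<open>I\<close>.\<close>

definition normal_members :: "('a::vector_lattice \<Rightarrow> real) set \<Rightarrow> ('a \<Rightarrow> real) set" where
  "normal_members I = {\<phi> \<in> I. normal_functional \<phi>}"

lemma functional_modulus_image_ideal:
  assumes "oc_dual_ideal I"
  shows "functional_modulus ` I = normal_members I"
proof
  have "functional_modulus \<phi> \<in> normal_members I" if "\<phi> \<in> I" for \<phi>
  proof -
    have oc: "\<phi> \<in> oc_dual" using assms that unfolding oc_dual_ideal_def by blast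
    have n: "normal_functional (functional_modulus \<phi>)" by (rule functional_modulus_properties[OF oc])
    have "functional_modulus \<phi> \<in> I"
      using assms that normal_functional_in_oc_dual[OF n] functional_modulus_normal[OF n]
      unfolding oc_dual_ideal_def functional_le_def by (metis order_refl)
    then show ?thesis using n unfolding normal_members_def by blast
  qed
  then show "functional_modulus ` I \<subseteq> normal_members I" by blast
  show "normal_members I \<subseteq> functional_modulus ` I"
    unfolding normal_members_def using functional_modulus_normal by force
qed

lemma normal_members_add:
  assumes "oc_dual_ideal I" "\<phi> \<in> normal_members I" "\<psi> \<in> normal_members I"
  shows "(\<lambda>x. \<phi> x + \<psi> x) \<in> normal_members I"
  using assms normal_functional_add unfolding normal_members_def oc_dual_ideal_def by blast

lemma normal_members_scale:
  assumes "oc_dual_ideal I" "\<phi> \<in> normal_members I" "0 \<le> c"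
  shows "(\<lambda>x. c * \<phi> x) \<in> normal_members I"
  using assms normal_functional_scale unfolding normal_members_def oc_dual_ideal_def by blast

lemma normal_members_zero: "oc_dual_ideal I \<Longrightarrow> (\<lambda>x. 0) \<in> normal_members I"
  using normal_functional_zero unfolding normal_members_def oc_dual_ideal_def by blast

lemma normal_members_separate:
  assumes "oc_dual_ideal I" "separates_points I" "x \<noteq> 0"
  shows "\<exists>\<phi>\<in>normal_members I. 0 < \<phi> \<bar>x\<bar>"
proof -
  obtain \<phi> where \<phi>: "\<phi> \<in> I" "\<phi> x \<noteq> \<phi> 0" using assms unfolding separates_points_def by metis
  have oc: "\<phi> \<in> oc_dual" using assms \<phi> unfolding oc_dual_ideal_def by blast
  have "\<phi> x \<noteq> 0" using \<phi>(2) linear_0[OF oc_dual_linear[OF oc]] by simp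
  then have "0 < functional_modulus \<phi> \<bar>x\<bar>" using abs_le_functional_modulus[OF oc, of x] by linarith
  then show ?thesis using functional_modulus_image_ideal[OF assms(1)] \<phi>(1) by blast
qed

text \<open>This is what makes \<open>I\<close> the full dual of the absolute weak topology: a functional dominated by a
  seminorm \<open>x \<mapsto> \<phi> \<bar>x\<bar>\<close> of that topology has a modulus below \<open>\<phi>\<close>.\<close>

lemma oc_dual_ideal_dominated:
  assumes "oc_dual_ideal I" "linear f" "\<phi> \<in> normal_members I" "\<And>x. \<bar>f x\<bar> \<le> \<phi> \<bar>x\<bar>"
  shows "f \<in> I"
proof -
  have \<phi>: "\<phi> \<in> I" "normal_functional \<phi>" using assms(3) unfolding normal_members_def by auto
  have oc: "f \<in> oc_dual" by (rule oc_dual_dominated[OF assms(2) \<phi>(2) assms(4)])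
  have "functional_le f \<phi>" "functional_le (\<lambda>x. - f x) \<phi>"
    unfolding functional_le_def using assms(4) by (metis abs_le_iff abs_of_nonneg)+
  then have "functional_le (functional_modulus f) (functional_modulus \<phi>)"
    using functional_modulus_properties(4)[OF oc normal_functional_in_oc_dual[OF \<phi>(2)]]
      functional_modulus_normal[OF \<phi>(2)] by simp
  then show ?thesis using assms(1) \<phi>(1) oc unfolding oc_dual_ideal_def by blast
qed

section \<open>Topologies given by subadditive gauges\<close>

text \<open>Homogeneity is not included, because \<open>x \<mapsto> \<phi> (inf \<bar>x\<bar> e)\<close> fails it.  Subadditivity makes the sets
  \<open>{y. p (y - x) < \<epsilon>}\<close> open, and directedness makes them a neighbourhood base at \<open>x\<close>.\<close>

definition gauge_family :: "('a::real_vector \<Rightarrow> real) set \<Rightarrow> bool" where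
  "gauge_family P \<longleftrightarrow> P \<noteq> {} \<and> (\<forall>p\<in>P. \<forall>q\<in>P. \<exists>r\<in>P. \<forall>x. p x \<le> r x \<and> q x \<le> r x)
     \<and> (\<forall>p\<in>P. p 0 = 0 \<and> (\<forall>x y. p (x + y) \<le> p x + p y))"

lemma openin_seminorm_topology:
  assumes P: "gauge_family P"
  shows "openin (seminorm_topology P) U \<longleftrightarrow> (\<forall>x\<in>U. \<exists>p\<in>P. \<exists>\<epsilon>>0. \<forall>y. p (y - x) < \<epsilon> \<longrightarrow> y \<in> U)"
    (is "_ \<longleftrightarrow> ?R U")
proof
  have dir: "\<exists>r\<in>P. \<forall>x. p x \<le> r x \<and> q x \<le> r x" if "p \<in> P" "q \<in> P" for p q
    using P that unfolding gauge_family_def by auto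
  have add: "p (x + y) \<le> p x + p y" if "p \<in> P" for p x y
    using P that unfolding gauge_family_def by auto
  let ?B = "{{y. p (y - x) < \<epsilon>} | p x \<epsilon>. p \<in> P \<and> 0 < \<epsilon>}"
  assume "openin (seminorm_topology P) U"
  then have "generate_topology_on ?B U"
    unfolding seminorm_topology_def openin_topology_generated_by_iff .
  then show "?R U"
  proof induction
    case (Int a b)
    show ?case
    proof
      fix x assume "x \<in> a \<inter> b"
      then have x: "x \<in> a" "x \<in> b" by auto
      obtain p \<epsilon> where p: "p \<in> P" "\<epsilon> > 0" "\<And>y. p (y - x) < \<epsilon> \<Longrightarrow> y \<in> a"
        using Int.IH(1) x(1) by blast
      obtain q \<delta> where q: "q \<in> P" "\<delta> > 0" "\<And>y. q (y - x) < \<delta> \<Longrightarrow> y \<in> b"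
        using Int.IH(2) x(2) by blast
      obtain r where r: "r \<in> P" "\<And>x. p x \<le> r x" "\<And>x. q x \<le> r x" using dir[OF p(1) q(1)] by blast
      have "y \<in> a \<inter> b" if "r (y - x) < min \<epsilon> \<delta>" for y
        using p(3)[of y] q(3)[of y] r(2,3)[of "y - x"] that by auto
      then show "\<exists>p\<in>P. \<exists>\<epsilon>>0. \<forall>y. p (y - x) < \<epsilon> \<longrightarrow> y \<in> a \<inter> b"
        using r(1) p(2) q(2) by (intro bexI[OF _ r(1)] exI[of _ "min \<epsilon> \<delta>"]) simp
    qed
  next
    case (UN K)
    show ?case
    proof
      fix x assume "x \<in> \<Union>K"
      then obtain k where k: "k \<in> K" "x \<in> k" by blast
      then obtain p \<epsilon> where "p \<in> P" "\<epsilon> > 0" "\<forall>y. p (y - x) < \<epsilon> \<longrightarrow> y \<in> k" using UN by blast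
      then show "\<exists>p\<in>P. \<exists>\<epsilon>>0. \<forall>y. p (y - x) < \<epsilon> \<longrightarrow> y \<in> \<Union>K" using k by blast
    qed
  next
    case (Basis s)
    then obtain p x \<epsilon> where s: "s = {y. p (y - x) < \<epsilon>}" "p \<in> P" "0 < \<epsilon>" by blast
    show ?case
    proof
      fix z assume z: "z \<in> s"
      have "y \<in> s" if "p (y - z) < \<epsilon> - p (z - x)" for y
        using add[OF s(2), of "y - z" "z - x"] that s(1) by simp
      then show "\<exists>p\<in>P. \<exists>\<epsilon>>0. \<forall>y. p (y - z) < \<epsilon> \<longrightarrow> y \<in> s"
        using z s by (intro bexI[OF _ s(2)] exI[of _ "\<epsilon> - p (z - x)"]) simp
    qed
  qed simp
next
  assume R: "?R U"
  have "\<exists>T. openin (seminorm_topology P) T \<and> x \<in> T \<and> T \<subseteq> U" if x: "x \<in> U" for x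
  proof -
    obtain p \<epsilon> where p: "p \<in> P" "\<epsilon> > 0" "\<forall>y. p (y - x) < \<epsilon> \<longrightarrow> y \<in> U" using R x by blast
    have "openin (seminorm_topology P) {y. p (y - x) < \<epsilon>}"
      unfolding seminorm_topology_def by (rule topology_generated_by_Basis) (use p in blast)
    moreover have "p 0 = 0" using P p(1) unfolding gauge_family_def by blast
    ultimately show ?thesis using p by (intro exI[of _ "{y. p (y - x) < \<epsilon>}"]) auto
  qed
  then show "openin (seminorm_topology P) U" by (subst openin_subopen) blast
qed

lemma openin_gauge_ball:
  assumes P: "gauge_family P" and p: "p \<in> P"
  shows "openin (seminorm_topology P) {y. p (y - x) < \<epsilon>}"
  unfolding openin_seminorm_topology[OF P]
proof
  fix z assume z: "z \<in> {y. p (y - x) < \<epsilon>}"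
  have add: "p (u + v) \<le> p u + p v" for u v using P p unfolding gauge_family_def by blast
  have "p (y - x) < \<epsilon>" if "p (y - z) < \<epsilon> - p (z - x)" for y
    using add[of "y - z" "z - x"] that by simp
  then show "\<exists>q\<in>P. \<exists>\<delta>>0. \<forall>y. q (y - z) < \<delta> \<longrightarrow> y \<in> {y. p (y - x) < \<epsilon>}"
    using z by (intro bexI[OF _ p] exI[of _ "\<epsilon> - p (z - x)"]) simp
qed

lemma topspace_seminorm_topology:
  assumes P: "gauge_family P" shows "topspace (seminorm_topology P) = UNIV"
proof -
  obtain p where "p \<in> P" using P unfolding gauge_family_def by blast
  then have "openin (seminorm_topology P) UNIV"
    unfolding openin_seminorm_topology[OF P] using zero_less_one by blast
  then show ?thesis using openin_subset by fastforce
qed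

lemma in_closure_seminorm_topology:
  assumes P: "gauge_family P"
  shows "x \<in> seminorm_topology P closure_of B \<longleftrightarrow> (\<forall>p\<in>P. \<forall>\<epsilon>>0. \<exists>b\<in>B. p (b - x) < \<epsilon>)"
proof
  assume x: "x \<in> seminorm_topology P closure_of B"
  show "\<forall>p\<in>P. \<forall>\<epsilon>>0. \<exists>b\<in>B. p (b - x) < \<epsilon>"
  proof (intro ballI allI impI)
    fix p and \<epsilon> :: real assume p: "p \<in> P" "0 < \<epsilon>"
    have "p 0 = 0" using P p(1) unfolding gauge_family_def by blast
    then have "x \<in> {y. p (y - x) < \<epsilon>}" using p(2) by simp
    then show "\<exists>b\<in>B. p (b - x) < \<epsilon>"
      using x[unfolded in_closure_of, THEN conjunct2, rule_format, of "{y. p (y - x) < \<epsilon>}"]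
        openin_gauge_ball[OF P p(1), of x \<epsilon>] by auto
  qed
next
  assume *: "\<forall>p\<in>P. \<forall>\<epsilon>>0. \<exists>b\<in>B. p (b - x) < \<epsilon>"
  show "x \<in> seminorm_topology P closure_of B"
    unfolding in_closure_of topspace_seminorm_topology[OF P]
  proof (intro conjI allI impI)
    fix T assume "x \<in> T \<and> openin (seminorm_topology P) T"
    then obtain p \<epsilon> where "p \<in> P" "0 < \<epsilon>" "\<forall>y. p (y - x) < \<epsilon> \<longrightarrow> y \<in> T"
      unfolding openin_seminorm_topology[OF P] by blast
    then show "\<exists>y. y \<in> B \<and> y \<in> T" using * by blast
  qed simp
qed


definition truncated :: "'a::vector_lattice \<Rightarrow> ('a \<Rightarrow> real) \<Rightarrow> 'a \<Rightarrow> real" where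
  "truncated e \<phi> x = \<phi> (inf \<bar>x\<bar> e)"

lemma inf_scale_le:
  fixes x y :: "'a::vector_lattice"
  assumes "0 \<le> x" "0 \<le> y" "0 \<le> c"
  shows "inf (c *\<^sub>R x) y \<le> max 1 c *\<^sub>R inf x y"
proof -
  let ?m = "max 1 c"
  have m: "0 < ?m" "1 \<le> ?m" "c \<le> ?m" by auto
  have "inf (c *\<^sub>R x) y \<le> c *\<^sub>R x" by simp
  also have "\<dots> \<le> ?m *\<^sub>R x" using assms m by (intro scaleR_right_mono)
  finally have 1: "inverse ?m *\<^sub>R inf (c *\<^sub>R x) y \<le> x"
    using m(1) by (simp add: pos_divideR_le_eq)
  have "inf (c *\<^sub>R x) y \<le> 1 *\<^sub>R y" by simp
  also have "\<dots> \<le> ?m *\<^sub>R y" using assms m by (intro scaleR_right_mono)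
  finally have "inverse ?m *\<^sub>R inf (c *\<^sub>R x) y \<le> y"
    using m(1) by (simp add: pos_divideR_le_eq)
  with 1 have "inverse ?m *\<^sub>R inf (c *\<^sub>R x) y \<le> inf x y" by (rule le_infI)
  then show ?thesis unfolding pos_divideR_le_eq[OF m(1)] .
qed

lemma abs_scale: "\<bar>c *\<^sub>R x\<bar> = \<bar>c\<bar> *\<^sub>R \<bar>x\<bar>" for x :: "'a::vector_lattice"
proof -
  have le: "\<bar>c *\<^sub>R x\<bar> \<le> \<bar>c\<bar> *\<^sub>R \<bar>x\<bar>" for c and x :: 'a
  proof (cases "0 \<le> c")
    case True
    then have "c *\<^sub>R x \<le> c *\<^sub>R \<bar>x\<bar>" "c *\<^sub>R (- x) \<le> c *\<^sub>R \<bar>x\<bar>"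
      by (simp_all only: scaleR_left_mono abs_ge_self abs_ge_minus_self)
    then show ?thesis using True by (intro abs_leI) simp_all
  next
    case False
    then have "(- c) *\<^sub>R x \<le> (- c) *\<^sub>R \<bar>x\<bar>" "(- c) *\<^sub>R (- x) \<le> (- c) *\<^sub>R \<bar>x\<bar>"
      by (simp_all only: scaleR_left_mono abs_ge_self abs_ge_minus_self neg_0_le_iff_le linear)
    then show ?thesis using False by (intro abs_leI) simp_all
  qed
  show ?thesis
  proof (cases "c = 0")
    case False
    have "\<bar>x\<bar> \<le> \<bar>inverse c\<bar> *\<^sub>R \<bar>c *\<^sub>R x\<bar>" using le[of "inverse c" "c *\<^sub>R x"] False by simp
    then have "\<bar>c\<bar> *\<^sub>R \<bar>x\<bar> \<le> \<bar>c\<bar> *\<^sub>R (\<bar>inverse c\<bar> *\<^sub>R \<bar>c *\<^sub>R x\<bar>)" by (rule scaleR_left_mono) simp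
    also have "\<dots> = \<bar>c *\<^sub>R x\<bar>" using False by (simp add: abs_mult[symmetric])
    finally show ?thesis using le by (simp add: antisym)
  qed simp
qed

lemma truncated_properties:
  fixes e :: "'a::vector_lattice"
  assumes e: "0 \<le> e" and \<phi>: "normal_functional \<phi>"
  shows "truncated e \<phi> 0 = 0" and "0 \<le> truncated e \<phi> x"
    and "truncated e \<phi> (x + y) \<le> truncated e \<phi> x + truncated e \<phi> y"
    and "\<bar>x\<bar> \<le> \<bar>y\<bar> \<Longrightarrow> truncated e \<phi> x \<le> truncated e \<phi> y"
    and "truncated e \<phi> (c *\<^sub>R x) \<le> max 1 \<bar>c\<bar> * truncated e \<phi> x"
    and "truncated e \<phi> x \<le> \<phi> \<bar>x\<bar>"
proof -
  note mono = normal_functional_mono[OF \<phi>] and lin = normal_functionalD(1)[OF \<phi>]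
  show "truncated e \<phi> 0 = 0" using e linear_0[OF lin] by (simp add: truncated_def inf.absorb1)
  show "0 \<le> truncated e \<phi> x" using e normal_functionalD(2)[OF \<phi>] by (simp add: truncated_def)
  have "inf \<bar>x + y\<bar> e \<le> inf e (\<bar>x\<bar> + \<bar>y\<bar>)"
    using abs_triangle_ineq[of x y] by (auto intro: le_infI1)
  also have "\<dots> \<le> inf \<bar>x\<bar> e + inf \<bar>y\<bar> e"
    using inf_add_le[OF e, of "\<bar>x\<bar>" "\<bar>y\<bar>"] by (simp add: inf_commute)
  finally show "truncated e \<phi> (x + y) \<le> truncated e \<phi> x + truncated e \<phi> y"
    unfolding truncated_def using mono linear_add[OF lin] by metis
  show "truncated e \<phi> x \<le> truncated e \<phi> y" if "\<bar>x\<bar> \<le> \<bar>y\<bar>"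
    unfolding truncated_def by (intro mono inf_mono that order_refl)
  have "inf \<bar>c *\<^sub>R x\<bar> e \<le> max 1 \<bar>c\<bar> *\<^sub>R inf \<bar>x\<bar> e"
    unfolding abs_scale by (rule inf_scale_le) (use e in auto)
  then show "truncated e \<phi> (c *\<^sub>R x) \<le> max 1 \<bar>c\<bar> * truncated e \<phi> x"
    unfolding truncated_def using mono linear_scale[OF lin] by (metis real_scaleR_def)
  show "truncated e \<phi> x \<le> \<phi> \<bar>x\<bar>" unfolding truncated_def by (intro mono) simp
qed

lemma strong_order_unit_bound:
  fixes e x :: "'a::vector_lattice"
  assumes "strong_order_unit e"
  shows "0 \<le> e" and "\<exists>n::nat. 1 \<le> n \<and> \<bar>x\<bar> \<le> real n *\<^sub>R e"
proof -
  obtain c where c: "0 \<le> c" "\<bar>e\<bar> \<le> c *\<^sub>R e" using assms unfolding strong_order_unit_def by blast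
  show e: "0 \<le> e"
  proof (cases "c = 0")
    case False
    then have "0 < c" "0 \<le> c *\<^sub>R e" using c order_trans[OF abs_ge_zero c(2)] by auto
    then have "inverse c *\<^sub>R 0 \<le> inverse c *\<^sub>R (c *\<^sub>R e)" by (intro scaleR_left_mono) auto
    then show ?thesis using \<open>0 < c\<close> by simp
  qed (use c in simp)
  obtain d where d: "0 \<le> d" "\<bar>x\<bar> \<le> d *\<^sub>R e" using assms unfolding strong_order_unit_def by blast
  obtain n :: nat where n: "d \<le> real n" using real_arch_simple by blast
  have "\<bar>x\<bar> \<le> real (Suc n) *\<^sub>R e"
    by (rule order_trans[OF d(2)]) (use n e in \<open>intro scaleR_right_mono, auto\<close>)
  then show "\<exists>n::nat. 1 \<le> n \<and> \<bar>x\<bar> \<le> real n *\<^sub>R e" by (intro exI[of _ "Suc n"]) simp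
qed

text \<open>If \<open>\<bar>x\<bar> \<le> n *\<^sub>R e\<close> then \<open>\<bar>x\<bar> \<le> n *\<^sub>R inf \<bar>x\<bar> e\<close>, so truncation loses no positivity.\<close>

lemma truncated_pos:
  fixes e x :: "'a::vector_lattice"
  assumes e: "strong_order_unit e" and \<phi>: "normal_functional \<phi>" "0 < \<phi> \<bar>x\<bar>"
  shows "0 < truncated e \<phi> x"
proof -
  obtain n :: nat where n: "1 \<le> n" "\<bar>x\<bar> \<le> real n *\<^sub>R e" using strong_order_unit_bound(2)[OF e] by blast
  have "inf (real n *\<^sub>R e) \<bar>x\<bar> \<le> max 1 (real n) *\<^sub>R inf e \<bar>x\<bar>"
    by (rule inf_scale_le) (use strong_order_unit_bound(1)[OF e] in auto)
  then have "\<bar>x\<bar> \<le> real n *\<^sub>R inf \<bar>x\<bar> e"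
    unfolding inf.absorb2[OF n(2)] using n(1) by (simp add: inf_commute max_def split: if_splits)
  then have "\<phi> \<bar>x\<bar> \<le> real n * truncated e \<phi> x"
    unfolding truncated_def using normal_functional_mono[OF \<phi>(1)] linear_scale[OF normal_functionalD(1)[OF \<phi>(1)]]
    by (metis real_scaleR_def)
  then have "0 < real n * truncated e \<phi> x" using \<phi>(2) by simp
  then show ?thesis using n(1) by (simp add: zero_less_mult_iff)
qed

definition truncated_topology :: "'a::vector_lattice \<Rightarrow> ('a \<Rightarrow> real) set \<Rightarrow> 'a topology" where
  "truncated_topology e I = seminorm_topology (truncated e ` normal_members I)"

lemma gauge_family_truncated:
  fixes e :: "'a::vector_lattice"
  assumes e: "0 \<le> e" and I: "oc_dual_ideal I"
  shows "gauge_family (truncated e ` normal_members I)"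
proof -
  have nm: "normal_functional \<phi>" if "\<phi> \<in> normal_members I" for \<phi>
    using that unfolding normal_members_def by blast
  have "\<exists>r\<in>truncated e ` normal_members I. \<forall>x. truncated e \<phi> x \<le> r x \<and> truncated e \<psi> x \<le> r x"
    if "\<phi> \<in> normal_members I" "\<psi> \<in> normal_members I" for \<phi> \<psi>
    using normal_members_add[OF I that] nm[OF that(1)] nm[OF that(2)] e
    by (intro bexI[OF _ imageI[of "\<lambda>x. \<phi> x + \<psi> x"]])
      (auto simp: truncated_def intro!: normal_functionalD(2))
  then show ?thesis
    unfolding gauge_family_def using normal_members_zero[OF I] truncated_properties(1,3)[OF e nm] by auto
qed

lemma gauge_family_absolute_weak:
  fixes I :: "('a::vector_lattice \<Rightarrow> real) set"
  assumes I: "oc_dual_ideal I"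
  shows "gauge_family ((\<lambda>\<phi> x. \<phi> \<bar>x\<bar>) ` normal_members I)"
proof -
  let ?P = "(\<lambda>\<phi> x. \<phi> \<bar>x\<bar>) ` normal_members I"
  have nm: "normal_functional \<phi>" if "\<phi> \<in> normal_members I" for \<phi>
    using that unfolding normal_members_def by blast
  have "\<exists>r\<in>?P. \<forall>x. \<phi> \<bar>x\<bar> \<le> r x \<and> \<psi> \<bar>x\<bar> \<le> r x"
    if "\<phi> \<in> normal_members I" "\<psi> \<in> normal_members I" for \<phi> \<psi>
    using normal_members_add[OF I that] nm[OF that(1)] nm[OF that(2)]
    by (intro bexI[OF _ imageI[of "\<lambda>x. \<phi> x + \<psi> x"]]) (auto intro!: normal_functionalD(2))
  moreover have "\<phi> \<bar>0\<bar> = 0" "\<phi> \<bar>x + y\<bar> \<le> \<phi> \<bar>x\<bar> + \<phi> \<bar>y\<bar>" if "\<phi> \<in> normal_members I" for \<phi> x y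
    using normal_functional_mono[OF nm[OF that] abs_triangle_ineq[of x y]]
      linear_0[OF normal_functionalD(1)[OF nm[OF that]]]
      linear_add[OF normal_functionalD(1)[OF nm[OF that]]] by simp_all
  ultimately show ?thesis unfolding gauge_family_def using normal_members_zero[OF I] by auto
qed

lemma absolute_weak_topology_eq:
  fixes I :: "('a::vector_lattice \<Rightarrow> real) set"
  assumes "oc_dual_ideal I"
  shows "absolute_weak_topology_by I = seminorm_topology ((\<lambda>\<phi> x. \<phi> \<bar>x\<bar>) ` normal_members I)"
proof -
  have "{\<lambda>x. functional_modulus \<phi> \<bar>x\<bar> | \<phi>. \<phi> \<in> I} = (\<lambda>\<phi> x. \<phi> \<bar>x\<bar>) ` functional_modulus ` I" by blast
  then show ?thesis
    unfolding absolute_weak_topology_by_def functional_modulus_image_ideal[OF assms] by simp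
qed

lemma openin_truncated_topology:
  fixes e :: "'a::vector_lattice"
  assumes "0 \<le> e" "oc_dual_ideal I"
  shows "openin (truncated_topology e I) U \<longleftrightarrow>
    (\<forall>x\<in>U. \<exists>\<phi>\<in>normal_members I. \<exists>\<epsilon>>0. \<forall>y. truncated e \<phi> (y - x) < \<epsilon> \<longrightarrow> y \<in> U)"
  unfolding truncated_topology_def openin_seminorm_topology[OF gauge_family_truncated[OF assms]] by simp

lemma openin_absolute_weak_topology:
  fixes I :: "('a::vector_lattice \<Rightarrow> real) set"
  assumes "oc_dual_ideal I"
  shows "openin (absolute_weak_topology_by I) U \<longleftrightarrow>
    (\<forall>x\<in>U. \<exists>\<phi>\<in>normal_members I. \<exists>\<epsilon>>0. \<forall>y. \<phi> \<bar>y - x\<bar> < \<epsilon> \<longrightarrow> y \<in> U)"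
  unfolding absolute_weak_topology_eq[OF assms]
    openin_seminorm_topology[OF gauge_family_absolute_weak[OF assms]] by simp

lemma in_closure_truncated_topology:
  assumes "0 \<le> e" "oc_dual_ideal I"
  shows "x \<in> truncated_topology e I closure_of B \<longleftrightarrow>
    (\<forall>\<phi>\<in>normal_members I. \<forall>\<epsilon>>0. \<exists>b\<in>B. truncated e \<phi> (b - x) < \<epsilon>)"
  unfolding truncated_topology_def in_closure_seminorm_topology[OF gauge_family_truncated[OF assms]] by simp

lemma in_closure_absolute_weak_topology:
  fixes I :: "('a::vector_lattice \<Rightarrow> real) set"
  assumes "oc_dual_ideal I"
  shows "x \<in> absolute_weak_topology_by I closure_of B \<longleftrightarrow>
    (\<forall>\<phi>\<in>normal_members I. \<forall>\<epsilon>>0. \<exists>b\<in>B. \<phi> \<bar>b - x\<bar> < \<epsilon>)"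
  unfolding absolute_weak_topology_eq[OF assms]
    in_closure_seminorm_topology[OF gauge_family_absolute_weak[OF assms]] by simp

text \<open>The uo-Lebesgue property amounts to order continuity of \<open>\<phi>\<close>, since \<open>inf \<bar>x\<bar> e\<close> is order null along
  a uo-null net; the Hausdorff property is \<open>truncated_pos\<close>.  In the continuity of scalar multiplication,
  the gauge of \<open>(d - c) *\<^sub>R x\<close> has to be estimated by \<open>\<bar>d - c\<bar> * \<phi> \<bar>x\<bar>\<close>, because the gauges are not
  homogeneous.\<close>

lemma truncated_topology_uo_Lebesgue:
  fixes e :: "'a::vector_lattice"
  assumes e: "strong_order_unit e" and I: "oc_dual_ideal I" "separates_points I"
  shows "Hausdorff_space (truncated_topology e I)" and "uo_Lebesgue (truncated_topology e I)"
proof -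
  let ?\<tau> = "truncated_topology e I"
  note e0 = strong_order_unit_bound(1)[OF e]
  have nm: "normal_functional \<phi>" if "\<phi> \<in> normal_members I" for \<phi>
    using that unfolding normal_members_def by blast
  note open_iff = openin_truncated_topology[OF e0 I(1)]
  note tr = truncated_properties[OF e0 nm]
  have top: "topspace ?\<tau> = UNIV"
    unfolding truncated_topology_def by (rule topspace_seminorm_topology[OF gauge_family_truncated[OF e0 I(1)]])
  have ball: "openin ?\<tau> {y. truncated e \<phi> (y - x) < \<epsilon>}" if "\<phi> \<in> normal_members I" for \<phi> x \<epsilon>
    unfolding truncated_topology_def
    by (rule openin_gauge_ball[OF gauge_family_truncated[OF e0 I(1)]]) (use that in blast)
  show "Hausdorff_space ?\<tau>"
    unfolding Hausdorff_space_def top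
  proof (intro allI impI)
    fix x y :: 'a assume "x \<in> UNIV \<and> y \<in> UNIV \<and> x \<noteq> y"
    then obtain \<phi> where \<phi>: "\<phi> \<in> normal_members I" "0 < \<phi> \<bar>x - y\<bar>"
      using normal_members_separate[OF I, of "x - y"] by auto
    define \<epsilon> where "\<epsilon> = truncated e \<phi> (x - y) / 2"
    have \<epsilon>: "0 < \<epsilon>" unfolding \<epsilon>_def using truncated_pos[OF e nm[OF \<phi>(1)] \<phi>(2)] by simp
    have "disjnt {z. truncated e \<phi> (z - x) < \<epsilon>} {z. truncated e \<phi> (z - y) < \<epsilon>}"
    proof -
      have False if "truncated e \<phi> (z - x) < \<epsilon>" "truncated e \<phi> (z - y) < \<epsilon>" for z
      proof -
        have "truncated e \<phi> (x - z) \<le> truncated e \<phi> (z - x)"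
          by (rule tr(4)[OF \<phi>(1)]) (simp add: abs_minus_commute)
        then show False using tr(3)[OF \<phi>(1), of "x - z" "z - y"] that unfolding \<epsilon>_def by simp
      qed
      then show ?thesis unfolding disjnt_def by blast
    qed
    moreover have "x \<in> {z. truncated e \<phi> (z - x) < \<epsilon>}" "y \<in> {z. truncated e \<phi> (z - y) < \<epsilon>}"
      using \<epsilon> tr(1)[OF \<phi>(1)] by simp_all
    ultimately show "\<exists>U V. openin ?\<tau> U \<and> openin ?\<tau> V \<and> x \<in> U \<and> y \<in> V \<and> disjnt U V"
      using ball[OF \<phi>(1)] by blast
  qed
  have lin: "linear_topology ?\<tau>"
    unfolding linear_topology_def
  proof (intro conjI top)
    show "continuous_map (prod_topology ?\<tau> ?\<tau>) ?\<tau> (\<lambda>(x, y). x + y)"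
      unfolding continuous_map_def
    proof (intro conjI allI impI)
      fix U assume U: "openin ?\<tau> U"
      show "openin (prod_topology ?\<tau> ?\<tau>)
        {p \<in> topspace (prod_topology ?\<tau> ?\<tau>). (case p of (x, y) \<Rightarrow> x + y) \<in> U}"
        unfolding openin_prod_topology_alt
      proof (intro allI impI)
        fix x y assume "(x, y) \<in> {p \<in> topspace (prod_topology ?\<tau> ?\<tau>). (case p of (x, y) \<Rightarrow> x + y) \<in> U}"
        then have "x + y \<in> U" by simp
        then obtain \<phi> \<epsilon> where \<phi>: "\<phi> \<in> normal_members I" "\<epsilon> > 0"
          "\<And>z. truncated e \<phi> (z - (x + y)) < \<epsilon> \<Longrightarrow> z \<in> U" using U unfolding open_iff by blast
        have "a + b \<in> U" if "truncated e \<phi> (a - x) < \<epsilon> / 2" "truncated e \<phi> (b - y) < \<epsilon> / 2" for a b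
        proof (rule \<phi>(3))
          show "truncated e \<phi> (a + b - (x + y)) < \<epsilon>"
            using tr(3)[OF \<phi>(1), of "a - x" "b - y"] that by (simp add: algebra_simps)
        qed
        then have "{z. truncated e \<phi> (z - x) < \<epsilon> / 2} \<times> {z. truncated e \<phi> (z - y) < \<epsilon> / 2}
            \<subseteq> {p \<in> topspace (prod_topology ?\<tau> ?\<tau>). (case p of (x, y) \<Rightarrow> x + y) \<in> U}"
          unfolding topspace_prod_topology top by auto
        moreover have "x \<in> {z. truncated e \<phi> (z - x) < \<epsilon> / 2}" "y \<in> {z. truncated e \<phi> (z - y) < \<epsilon> / 2}"
          using \<phi>(2) tr(1)[OF \<phi>(1)] by simp_all
        ultimately show "\<exists>V W. openin ?\<tau> V \<and> openin ?\<tau> W \<and> x \<in> V \<and> y \<in> W \<and>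
            V \<times> W \<subseteq> {p \<in> topspace (prod_topology ?\<tau> ?\<tau>). (case p of (x, y) \<Rightarrow> x + y) \<in> U}"
          using ball[OF \<phi>(1)] by blast
      qed
    qed (simp add: top)
    show "continuous_map (prod_topology euclideanreal ?\<tau>) ?\<tau> (\<lambda>(c, x). c *\<^sub>R x)"
      unfolding continuous_map_def
    proof (intro conjI allI impI)
      fix U assume U: "openin ?\<tau> U"
      show "openin (prod_topology euclideanreal ?\<tau>)
        {p \<in> topspace (prod_topology euclideanreal ?\<tau>). (case p of (c, x) \<Rightarrow> c *\<^sub>R x) \<in> U}"
        unfolding openin_prod_topology_alt
      proof (intro allI impI)
        fix c x assume "(c, x) \<in> {p \<in> topspace (prod_topology euclideanreal ?\<tau>). (case p of (c, x) \<Rightarrow> c *\<^sub>R x) \<in> U}"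
        then have "c *\<^sub>R x \<in> U" by simp
        then obtain \<phi> \<epsilon> where \<phi>: "\<phi> \<in> normal_members I" "\<epsilon> > 0"
          "\<And>z. truncated e \<phi> (z - c *\<^sub>R x) < \<epsilon> \<Longrightarrow> z \<in> U" using U unfolding open_iff by blast
        define K where "K = \<phi> \<bar>x\<bar> + 1"
        have K: "0 < K" "\<phi> \<bar>x\<bar> \<le> K" unfolding K_def
          using normal_functionalD(2)[OF nm[OF \<phi>(1)], of "\<bar>x\<bar>"] by auto
        define \<delta> where "\<delta> = min 1 (\<epsilon> / (2 * K))"
        have \<delta>: "0 < \<delta>" "\<delta> \<le> 1" "\<delta> * K \<le> \<epsilon> / 2"
          unfolding \<delta>_def using K \<phi>(2) by (auto simp: min_def field_simps)
        define M where "M = \<bar>c\<bar> + 1"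
        have M: "0 < M" unfolding M_def by simp
        have "d *\<^sub>R a \<in> U" if d: "\<bar>d - c\<bar> < \<delta>" and a: "truncated e \<phi> (a - x) < \<epsilon> / (2 * M)" for d a
        proof (rule \<phi>(3))
          have "max 1 \<bar>d\<bar> \<le> M" unfolding M_def using d \<delta>(2) by auto
          then have "truncated e \<phi> (d *\<^sub>R (a - x)) \<le> M * truncated e \<phi> (a - x)"
            using tr(5)[OF \<phi>(1), of d "a - x"] mult_right_mono[OF _ tr(2)[OF \<phi>(1)]] order_trans by blast
          also have "\<dots> < \<epsilon> / 2" using a M by (simp add: field_simps)
          finally have 1: "truncated e \<phi> (d *\<^sub>R (a - x)) < \<epsilon> / 2" .
          have "truncated e \<phi> ((d - c) *\<^sub>R x) \<le> \<phi> \<bar>(d - c) *\<^sub>R x\<bar>" by (rule tr(6)[OF \<phi>(1)])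
          also have "\<dots> = \<bar>d - c\<bar> * \<phi> \<bar>x\<bar>"
            unfolding abs_scale using linear_scale[OF normal_functionalD(1)[OF nm[OF \<phi>(1)]]] by simp
          also have "\<dots> \<le> \<delta> * K" using d K \<delta> by (intro mult_mono) (auto intro: normal_functionalD(2)[OF nm[OF \<phi>(1)]])
          finally have 2: "truncated e \<phi> ((d - c) *\<^sub>R x) \<le> \<epsilon> / 2" using \<delta>(3) by simp
          have "d *\<^sub>R a - c *\<^sub>R x = d *\<^sub>R (a - x) + (d - c) *\<^sub>R x" by (simp add: algebra_simps)
          then show "truncated e \<phi> (d *\<^sub>R a - c *\<^sub>R x) < \<epsilon>"
            using tr(3)[OF \<phi>(1), of "d *\<^sub>R (a - x)" "(d - c) *\<^sub>R x"] 1 2 by simp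
        qed
        then have "ball c \<delta> \<times> {z. truncated e \<phi> (z - x) < \<epsilon> / (2 * M)}
            \<subseteq> {p \<in> topspace (prod_topology euclideanreal ?\<tau>). (case p of (c, x) \<Rightarrow> c *\<^sub>R x) \<in> U}"
          unfolding topspace_prod_topology top by (auto simp: dist_real_def abs_minus_commute)
        moreover have "openin euclideanreal (ball c \<delta>)" "c \<in> ball c \<delta>"
          "x \<in> {z. truncated e \<phi> (z - x) < \<epsilon> / (2 * M)}"
          using \<phi>(2) tr(1)[OF \<phi>(1)] M \<delta>(1) by simp_all
        ultimately show "\<exists>V W. openin euclideanreal V \<and> openin ?\<tau> W \<and> c \<in> V \<and> x \<in> W \<and>
            V \<times> W \<subseteq> {p \<in> topspace (prod_topology euclideanreal ?\<tau>). (case p of (c, x) \<Rightarrow> c *\<^sub>R x) \<in> U}"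
          using ball[OF \<phi>(1)] by blast
      qed
    qed (simp add: top)
  qed
  have solid_ball: "solid {y. truncated e \<phi> y < \<epsilon>}" if "\<phi> \<in> normal_members I" for \<phi> \<epsilon>
    unfolding solid_def using tr(4)[OF that] by (auto intro: le_less_trans)
  have "locally_solid ?\<tau>"
    unfolding locally_solid_def
  proof (intro allI impI)
    fix U assume "openin ?\<tau> U" "0 \<in> U"
    then obtain \<phi> \<epsilon> where \<phi>: "\<phi> \<in> normal_members I" "\<epsilon> > 0" "\<And>y. truncated e \<phi> (y - 0) < \<epsilon> \<Longrightarrow> y \<in> U"
      unfolding open_iff by blast
    then show "\<exists>V W. openin ?\<tau> W \<and> 0 \<in> W \<and> W \<subseteq> V \<and> solid V \<and> V \<subseteq> U"
      using ball[OF \<phi>(1), of 0 \<epsilon>] solid_ball[OF \<phi>(1), of \<epsilon>] tr(1)[OF \<phi>(1)]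
      by (intro exI[of _ "{y. truncated e \<phi> y < \<epsilon>}"]) auto
  qed
  moreover have "net_converges ?\<tau> A r x 0" if uo: "uo_converges A r x 0"
    for A :: "('a \<times> 'a set) set" and r x
    unfolding net_converges_def top
  proof (intro conjI allI impI)
    fix U assume "openin ?\<tau> U" "0 \<in> U"
    then obtain \<phi> \<epsilon> where \<phi>: "\<phi> \<in> normal_members I" "\<epsilon> > 0" "\<And>y. truncated e \<phi> (y - 0) < \<epsilon> \<Longrightarrow> y \<in> U"
      unfolding open_iff by blast
    have "order_converges A r (\<lambda>\<alpha>. inf \<bar>x \<alpha> - 0\<bar> e) 0"
      using uo e0 unfolding uo_converges_def by blast
    then obtain D where D: "descends_to_zero D"
      "\<And>d. d \<in> D \<Longrightarrow> net_eventually A r (\<lambda>\<alpha>. \<bar>0 - inf \<bar>x \<alpha> - 0\<bar> e\<bar> \<le> d)"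
      by (rule order_converges_descends_to_zero) blast
    obtain d where d: "d \<in> D" "\<phi> d < \<epsilon>" using normal_functionalD(3)[OF nm[OF \<phi>(1)] D(1) \<phi>(2)] by blast
    have "x \<alpha> \<in> U" if "\<bar>0 - inf \<bar>x \<alpha> - 0\<bar> e\<bar> \<le> d" for \<alpha>
    proof (rule \<phi>(3))
      have "0 \<le> inf \<bar>x \<alpha>\<bar> e" using e0 by simp
      then have "inf \<bar>x \<alpha>\<bar> e \<le> d" using that by simp
      then show "truncated e \<phi> (x \<alpha> - 0) < \<epsilon>"
        using normal_functional_mono[OF nm[OF \<phi>(1)], of "inf \<bar>x \<alpha>\<bar> e" d] d(2)
        unfolding truncated_def by simp
    qed
    then show "net_eventually A r (\<lambda>\<alpha>. x \<alpha> \<in> U)"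
      using D(2)[OF d(1)] unfolding net_eventually_def by blast
  qed simp
  ultimately show "uo_Lebesgue ?\<tau>" using lin unfolding uo_Lebesgue_def by blast
qed

section \<open>Solid neighbourhoods of zero\<close>

definition solid_nhd :: "'a::vector_lattice topology \<Rightarrow> 'a set \<Rightarrow> bool" where
  "solid_nhd \<tau> V \<longleftrightarrow> solid V \<and> (\<exists>W. openin \<tau> W \<and> 0 \<in> W \<and> W \<subseteq> V)"

lemma solid_nhd_solid: "solid_nhd \<tau> V \<Longrightarrow> solid V"
  unfolding solid_nhd_def by blast

lemma solid_nhd_zero: "solid_nhd \<tau> V \<Longrightarrow> 0 \<in> V"
  unfolding solid_nhd_def by blast

lemma solid_nhd_Int:
  assumes "solid_nhd \<tau> V" "solid_nhd \<tau> V'" shows "solid_nhd \<tau> (V \<inter> V')"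
proof -
  obtain W W' where "openin \<tau> W" "0 \<in> W" "W \<subseteq> V" "openin \<tau> W'" "0 \<in> W'" "W' \<subseteq> V'"
    using assms unfolding solid_nhd_def by blast
  then have "openin \<tau> (W \<inter> W') \<and> 0 \<in> W \<inter> W' \<and> W \<inter> W' \<subseteq> V \<inter> V'" by auto
  moreover have "solid (V \<inter> V')" using assms unfolding solid_nhd_def solid_def by blast
  ultimately show ?thesis unfolding solid_nhd_def by blast
qed

lemma solid_nhd_INT:
  assumes "\<And>k. k \<le> (n::nat) \<Longrightarrow> solid_nhd \<tau> (V k)" shows "solid_nhd \<tau> (\<Inter>k\<le>n. V k)"
  using assms
proof (induction n)
  case (Suc n)
  then have "solid_nhd \<tau> (V (Suc n) \<inter> (\<Inter>k\<le>n. V k))" by (intro solid_nhd_Int) auto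
  then show ?case by (simp add: atMost_Suc)
qed simp

lemma solid_nhd_below:
  assumes "locally_solid \<tau>" "openin \<tau> U" "0 \<in> U"
  obtains V where "solid_nhd \<tau> V" "V \<subseteq> U"
proof -
  obtain V W where "openin \<tau> W \<and> 0 \<in> W \<and> W \<subseteq> V \<and> solid V \<and> V \<subseteq> U"
    using assms(1)[unfolded locally_solid_def, rule_format, OF assms(2,3)] by (elim exE)
  then show thesis using that[of V] unfolding solid_nhd_def by blast
qed

lemma linear_topology_add_nhds:
  assumes "linear_topology \<tau>" "openin \<tau> U" "x + y \<in> U"
  obtains V W where "openin \<tau> V" "openin \<tau> W" "x \<in> V" "y \<in> W" "\<forall>v\<in>V. \<forall>w\<in>W. v + w \<in> U"
proof -
  have top: "topspace \<tau> = UNIV" and "continuous_map (prod_topology \<tau> \<tau>) \<tau> (\<lambda>(x, y). x + y)"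
    using assms unfolding linear_topology_def by auto
  then have op: "openin (prod_topology \<tau> \<tau>) {p \<in> topspace (prod_topology \<tau> \<tau>). (case p of (x, y) \<Rightarrow> x + y) \<in> U}"
    using assms(2) unfolding continuous_map_def by blast
  have "(x, y) \<in> {p \<in> topspace (prod_topology \<tau> \<tau>). (case p of (x, y) \<Rightarrow> x + y) \<in> U}"
    using assms(3) top by simp
  from op[unfolded openin_prod_topology_alt, rule_format, OF this]
  obtain V W where VW: "openin \<tau> V" "openin \<tau> W" "x \<in> V" "y \<in> W"
    "V \<times> W \<subseteq> {p \<in> topspace (prod_topology \<tau> \<tau>). (case p of (x, y) \<Rightarrow> x + y) \<in> U}"
    by (elim exE conjE)
  have "v + w \<in> U" if "v \<in> V" "w \<in> W" for v w
    using subsetD[OF VW(5), of "(v, w)"] that by simp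
  then show thesis using that VW by blast
qed

lemma solid_nhd_half:
  assumes "linear_topology \<tau>" "locally_solid \<tau>" "solid_nhd \<tau> U"
  obtains V where "solid_nhd \<tau> V" "\<And>x y. x \<in> V \<Longrightarrow> y \<in> V \<Longrightarrow> x + y \<in> U"
proof -
  obtain O' where O': "openin \<tau> O'" "0 \<in> O'" "O' \<subseteq> U" using assms(3) unfolding solid_nhd_def by blast
  have "0 + 0 \<in> O'" using O'(2) by simp
  then obtain V W where VW: "openin \<tau> V" "openin \<tau> W" "0 \<in> V" "0 \<in> W"
    "\<forall>v\<in>V. \<forall>w\<in>W. v + w \<in> O'"
    using linear_topology_add_nhds[OF assms(1) O'(1)] by metis
  obtain S where "solid_nhd \<tau> S" "S \<subseteq> V \<inter> W"
    using solid_nhd_below[OF assms(2), of "V \<inter> W"] VW by blast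
  then show thesis using that VW(5) O'(3) by blast
qed

lemma openin_translate:
  assumes "linear_topology \<tau>" "openin \<tau> U"
  shows "openin \<tau> {y. x + y \<in> U}"
proof -
  have "\<exists>T. openin \<tau> T \<and> y \<in> T \<and> T \<subseteq> {y. x + y \<in> U}" if xy: "x + y \<in> U" for y
  proof -
    obtain V W where "openin \<tau> V" "openin \<tau> W" "x \<in> V" "y \<in> W" "\<forall>v\<in>V. \<forall>w\<in>W. v + w \<in> U"
      by (rule linear_topology_add_nhds[OF assms xy])
    then show ?thesis by blast
  qed
  then show ?thesis by (subst openin_subopen) blast
qed

text \<open>So two locally solid linear topologies can be compared through their solid neighbourhoods of \<open>0\<close>.\<close>

lemma openin_iff_solid_nhd:
  assumes lin: "linear_topology \<tau>" and sol: "locally_solid \<tau>"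
  shows "openin \<tau> U \<longleftrightarrow> (\<forall>x\<in>U. \<exists>V. solid_nhd \<tau> V \<and> (\<forall>v\<in>V. x + v \<in> U))"
proof
  assume U: "openin \<tau> U"
  show "\<forall>x\<in>U. \<exists>V. solid_nhd \<tau> V \<and> (\<forall>v\<in>V. x + v \<in> U)"
  proof
    fix x assume "x \<in> U"
    then have "0 \<in> {y. x + y \<in> U}" by simp
    then show "\<exists>V. solid_nhd \<tau> V \<and> (\<forall>v\<in>V. x + v \<in> U)"
      by (rule solid_nhd_below[OF sol openin_translate[OF lin U]]) blast
  qed
next
  assume R: "\<forall>x\<in>U. \<exists>V. solid_nhd \<tau> V \<and> (\<forall>v\<in>V. x + v \<in> U)"
  have "\<exists>T. openin \<tau> T \<and> x \<in> T \<and> T \<subseteq> U" if x: "x \<in> U" for x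
  proof -
    from bspec[OF R x] obtain V where "solid_nhd \<tau> V" and V0: "\<forall>v\<in>V. x + v \<in> U" by (elim exE conjE)
    then obtain W where V: "openin \<tau> W" "0 \<in> W" "W \<subseteq> V" unfolding solid_nhd_def by blast
    have "openin \<tau> {y. - x + y \<in> W}" by (rule openin_translate[OF lin V(1)])
    moreover have "x \<in> {y. - x + y \<in> W}" using V(2) by simp
    moreover have "{y. - x + y \<in> W} \<subseteq> U"
    proof
      fix y assume "y \<in> {y. - x + y \<in> W}"
      then have "- x + y \<in> V" using V(3) by blast
      then have "x + (- x + y) \<in> U" using V0 by blast
      then show "y \<in> U" by simp
    qed
    ultimately show ?thesis by blast
  qed
  then show "openin \<tau> U" by (subst openin_subopen) blast
qed

lemma Hausdorff_solid_nhd: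
  assumes "linear_topology \<tau>" "locally_solid \<tau>" "Hausdorff_space \<tau>" "x \<noteq> 0"
  obtains V where "solid_nhd \<tau> V" "x \<notin> V"
proof -
  have top: "topspace \<tau> = UNIV" using assms(1) unfolding linear_topology_def by blast
  have "\<exists>U W. openin \<tau> U \<and> openin \<tau> W \<and> 0 \<in> U \<and> x \<in> W \<and> disjnt U W"
    using assms(3)[unfolded Hausdorff_space_def top, rule_format, of 0 x] assms(4) by simp
  then obtain U W where U: "openin \<tau> U" "0 \<in> U" "x \<notin> U" unfolding disjnt_def by blast
  obtain V where "solid_nhd \<tau> V" "V \<subseteq> U" by (rule solid_nhd_below[OF assms(2) U(1,2)])
  then show thesis using that U(3) by blast
qed

lemma order_converges_imp_uo_converges:
  assumes "order_converges A r x (0::'a::vector_lattice)" shows "uo_converges A r x 0"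
  unfolding uo_converges_def
proof (intro allI impI)
  fix y :: 'a assume y: "0 \<le> y"
  obtain D where D: "descends_to_zero D"
    "\<And>d. d \<in> D \<Longrightarrow> net_eventually A r (\<lambda>\<alpha>. \<bar>0 - x \<alpha>\<bar> \<le> d)"
    using order_converges_descends_to_zero[OF assms] by blast
  show "order_converges A r (\<lambda>\<alpha>. inf \<bar>x \<alpha> - 0\<bar> y) 0"
  proof (rule order_convergesI_set[OF D(1)])
    fix d assume d: "d \<in> D"
    have "\<bar>0 - inf \<bar>x \<alpha> - 0\<bar> y\<bar> \<le> d" if "\<bar>0 - x \<alpha>\<bar> \<le> d" for \<alpha>
    proof -
      have "0 \<le> inf \<bar>x \<alpha>\<bar> y" using y by simp
      then have "\<bar>0 - inf \<bar>x \<alpha> - 0\<bar> y\<bar> = inf \<bar>x \<alpha>\<bar> y" by simp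
      then show ?thesis using that by (auto intro: le_infI1)
    qed
    then show "net_eventually A r (\<lambda>\<alpha>. \<bar>0 - inf \<bar>x \<alpha> - 0\<bar> y\<bar> \<le> d)"
      using D(2)[OF d] unfolding net_eventually_def by blast
  qed
qed

text \<open>The Lebesgue property, which is weaker than the uo-Lebesgue property.\<close>

lemma uo_Lebesgue_nhd_meets:
  assumes uo: "uo_Lebesgue \<tau>" and D: "descends_to_zero D" and V: "solid_nhd \<tau> V"
  shows "\<exists>d\<in>D. d \<in> V"
proof -
  have "net_converges \<tau> D (\<lambda>a b. b \<le> a) (\<lambda>a. a) 0"
    using uo_Lebesgue_all_nets[OF uo descends_to_zero_directed(1)[OF D]]
      order_converges_imp_uo_converges[OF descends_to_zero_order_converges[OF D]] by blast
  moreover obtain W where W: "openin \<tau> W" "0 \<in> W" "W \<subseteq> V" using V unfolding solid_nhd_def by blast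
  ultimately have "net_eventually D (\<lambda>a b. b \<le> a) (\<lambda>a. a \<in> W)" unfolding net_converges_def by blast
  then show ?thesis using W(3) unfolding net_eventually_def by blast
qed

section \<open>Bands of a topology and of a functional\<close>

text \<open>The usual base of a pseudometrizable linear topology coarser than \<open>\<tau>\<close>.\<close>

definition halving :: "'a::vector_lattice topology \<Rightarrow> (nat \<Rightarrow> 'a set) \<Rightarrow> bool" where
  "halving \<tau> V \<longleftrightarrow> (\<forall>n. solid_nhd \<tau> (V n)) \<and> (\<forall>n. \<forall>x\<in>V (Suc n). \<forall>y\<in>V (Suc n). x + y \<in> V n)"

lemma halving_mono:
  assumes "halving \<tau> V" "m \<le> n" shows "V n \<subseteq> V m"
  using assms(2)
proof (induction n rule: dec_induct)
  case (step n)
  have "x \<in> V n" if "x \<in> V (Suc n)" for x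
    using assms(1) that solid_nhd_zero unfolding halving_def by (metis add.right_neutral)
  then show ?case using step by blast
qed simp

lemma halving_exists:
  assumes "linear_topology \<tau>" "locally_solid \<tau>" "solid_nhd \<tau> U"
  obtains V where "halving \<tau> V" "V 0 = U"
proof -
  have "\<forall>U. \<exists>V. solid_nhd \<tau> U \<longrightarrow> solid_nhd \<tau> V \<and> (\<forall>x\<in>V. \<forall>y\<in>V. x + y \<in> U)"
    using solid_nhd_half[OF assms(1,2)] by metis
  then obtain h where h: "\<And>U. solid_nhd \<tau> U \<Longrightarrow> solid_nhd \<tau> (h U) \<and> (\<forall>x\<in>h U. \<forall>y\<in>h U. x + y \<in> U)"
    by metis
  define V where "V n = (h ^^ n) U" for n
  have s: "solid_nhd \<tau> (V n)" for n
    by (induction n) (use assms(3) h in \<open>auto simp: V_def\<close>)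
  have "halving \<tau> V" unfolding halving_def using s h by (simp add: V_def)
  then show thesis using that unfolding V_def by simp
qed

text \<open>Countably many such sequences have a common refinement.\<close>

lemma halving_diagonal:
  assumes "\<And>k::nat. halving \<tau> (V k)"
  shows "halving \<tau> (\<lambda>n. \<Inter>k\<le>n. V k n)" and "(\<Inter>n. \<Inter>k\<le>n. V k n) \<subseteq> (\<Inter>n. V j n)"
proof -
  have "solid_nhd \<tau> (\<Inter>k\<le>n. V k n)" for n
    by (rule solid_nhd_INT) (use assms in \<open>simp add: halving_def\<close>)
  moreover have "x + y \<in> V k n" if "x \<in> V k (Suc n)" "y \<in> V k (Suc n)" for x y k n
    using assms[of k] that unfolding halving_def by blast
  ultimately show "halving \<tau> (\<lambda>n. \<Inter>k\<le>n. V k n)" unfolding halving_def by auto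
  show "(\<Inter>n. \<Inter>k\<le>n. V k n) \<subseteq> (\<Inter>n. V j n)"
  proof
    fix x assume x: "x \<in> (\<Inter>n. \<Inter>k\<le>n. V k n)"
    have "x \<in> V j n" for n
    proof -
      have "x \<in> V j (max j n)" using x by simp
      then show ?thesis using halving_mono[OF assms, of n "max j n" j] by auto
    qed
    then show "x \<in> (\<Inter>n. V j n)" by blast
  qed
qed

lemma halving_sum:
  assumes V: "halving \<tau> V" and v: "\<And>j. v j \<in> V (Suc j)"
  shows "(\<Sum>j=n..<n+k. v j) \<in> V n"
proof (induction k arbitrary: n)
  case 0
  have "0 \<in> V n" using V solid_nhd_zero unfolding halving_def by blast
  then show ?case by simp
next
  case (Suc k)
  have "(\<Sum>j=n..<n + Suc k. v j) = v n + (\<Sum>j=Suc n..<Suc n + k. v j)"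
    by (simp add: sum.atLeast_Suc_lessThan)
  then show ?case using v[of n] Suc[of "Suc n"] V unfolding halving_def by simp
qed

text \<open>Order closedness comes from the Lebesgue property: some \<open>x - y\<close> with \<open>y\<close> in the intersection lies in
  \<open>V (Suc n)\<close>, and then \<open>x\<close> lies in \<open>V n\<close>.\<close>

lemma halving_Inter_band:
  assumes uo: "uo_Lebesgue \<tau>" and V: "halving \<tau> V"
  shows "band (\<Inter>n. V n)"
  unfolding band_def
proof (intro conjI ballI allI impI)
  have s: "solid_nhd \<tau> (V n)" for n using V unfolding halving_def by blast
  have add: "x + y \<in> V n" if "x \<in> V (Suc n)" "y \<in> V (Suc n)" for x y n
    using V that unfolding halving_def by blast
  show "0 \<in> (\<Inter>n. V n)" using s solid_nhd_zero by blast
  have "solid (V n)" for n using s solid_nhd_solid by blast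
  then show "solid (\<Inter>n. V n)" unfolding solid_def by blast
  show "x + y \<in> (\<Inter>n. V n)" if "x \<in> (\<Inter>n. V n)" "y \<in> (\<Inter>n. V n)" for x y
    using add that by blast
  fix x :: 'a assume "0 \<le> x" and D: "descends_to_zero {x - s | s. s \<in> (\<Inter>n. V n) \<and> 0 \<le> s \<and> s \<le> x}"
  have "x \<in> V n" for n
  proof -
    obtain y where "y \<in> (\<Inter>n. V n)" "x - y \<in> V (Suc n)"
      using uo_Lebesgue_nhd_meets[OF uo D s[of "Suc n"]] by blast
    then show ?thesis using add[of y n "x - y"] by simp
  qed
  then show "x \<in> (\<Inter>n. V n)" by blast
qed

definition null_band :: "('a::vector_lattice \<Rightarrow> real) \<Rightarrow> 'a set" where
  "null_band \<phi> = {x. \<phi> \<bar>x\<bar> = 0}"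

lemma null_band_band:
  assumes \<phi>: "normal_functional \<phi>" shows "band (null_band \<phi>)"
  unfolding band_def
proof (intro conjI ballI allI impI)
  note mono = normal_functional_mono[OF \<phi>] and pos = normal_functionalD(2)[OF \<phi>]
    and lin = normal_functionalD(1)[OF \<phi>]
  show "0 \<in> null_band \<phi>" unfolding null_band_def using linear_0[OF lin] by simp
  show "solid (null_band \<phi>)"
    unfolding solid_def null_band_def
    using mono pos[OF abs_ge_zero] by (metis antisym mem_Collect_eq)
  show "x + y \<in> null_band \<phi>" if "x \<in> null_band \<phi>" "y \<in> null_band \<phi>" for x y
    using mono[OF abs_triangle_ineq[of x y]] linear_add[OF lin] pos[OF abs_ge_zero, of "x + y"] that
    unfolding null_band_def by simp
  fix x :: 'a assume x: "0 \<le> x" and D: "descends_to_zero {x - s | s. s \<in> null_band \<phi> \<and> 0 \<le> s \<and> s \<le> x}"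
  have "\<phi> x \<le> 0 + \<epsilon>" if \<epsilon>: "0 < \<epsilon>" for \<epsilon>
  proof -
    obtain s where "s \<in> null_band \<phi>" "0 \<le> s" "\<phi> (x - s) < \<epsilon>"
      using normal_functionalD(3)[OF \<phi> D \<epsilon>] by blast
    then show ?thesis using linear_diff[OF lin] unfolding null_band_def by simp
  qed
  then have "\<phi> x \<le> 0" by (rule field_le_epsilon)
  then show "x \<in> null_band \<phi>" using pos[OF x] x unfolding null_band_def by simp
qed

text \<open>If \<open>x\<close> were missed by \<open>N k\<close>, some \<open>q > 0\<close> below \<open>x\<close> and disjoint from \<open>N k\<close> would be disjoint from the
  intersection too, which leaves room for \<open>q\<close> between \<open>x\<close> and the elements of the intersection below
  it.\<close>

lemma band_INT:
  fixes N :: "nat \<Rightarrow> 'a::vector_lattice set"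
  assumes "\<And>k. band (N k)" shows "band (\<Inter>k. N k)"
  unfolding band_def
proof (intro conjI ballI allI impI)
  have N: "0 \<in> N k" "solid (N k)" "\<And>x y. x \<in> N k \<Longrightarrow> y \<in> N k \<Longrightarrow> x + y \<in> N k" for k
    using assms[of k] unfolding band_def by auto
  show "0 \<in> (\<Inter>k. N k)" using N by blast
  show "solid (\<Inter>k. N k)"
    unfolding solid_def
  proof (intro allI impI INT_I)
    fix x y k assume "y \<in> (\<Inter>k. N k)" "\<bar>x\<bar> \<le> \<bar>y\<bar>"
    then show "x \<in> N k" using N(2)[of k, unfolded solid_def, rule_format, of y x] by blast
  qed
  show "x + y \<in> (\<Inter>k. N k)" if "x \<in> (\<Inter>k. N k)" "y \<in> (\<Inter>k. N k)" for x y
    using that by (intro INT_I N(3)) simp_all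
  fix x :: 'a assume x: "0 \<le> x" and D: "descends_to_zero {x - s | s. s \<in> (\<Inter>k. N k) \<and> 0 \<le> s \<and> s \<le> x}"
  have "x \<in> N k" for k
  proof (rule ccontr)
    assume "x \<notin> N k"
    then obtain q where q: "q \<in> disjoint_cone (N k)" "0 \<le> q" "q \<noteq> 0" "q \<le> x"
      using band_disjoint_part[OF assms x] by blast
    have "q \<le> x - s" if "s \<in> (\<Inter>k. N k)" "0 \<le> s" "s \<le> x" for s
    proof -
      have "inf s q = 0" using q(1) that unfolding disjoint_cone_def by blast
      then have "s + q \<le> x" using disjoint_add_le that(3) q(4) by blast
      then show ?thesis by (simp add: le_diff_eq add.commute)
    qed
    then have "q \<le> 0" by (intro descends_to_zero_lower[OF D]) auto
    then show False using q by simp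
  qed
  then show "x \<in> (\<Inter>k. N k)" by blast
qed

section \<open>Uniqueness of the Hausdorff uo-Lebesgue topology\<close>

lemma sum_half_powers: "(\<Sum>j=n..<n+i. (1/2::real) ^ j) \<le> 2 * (1/2) ^ n"
proof -
  have "(\<Sum>j=n..<n+i. (1/2::real) ^ j) = 2 * ((1/2) ^ n - (1/2) ^ (n + i))" by (induction i) auto
  then show ?thesis by simp
qed

text \<open>The Borel--Cantelli argument.  For \<open>u \<ge> 0\<close> the elements dominating a tail of \<open>t n = inf (y n) u\<close>
  decrease to zero: if \<open>w \<ge> 0\<close> is below all of them, almost optimal upper bounds of the tails show that
  every \<open>\<phi> k\<close> vanishes at \<open>w\<close>, so \<open>w\<close> is disjoint from all \<open>y n\<close>; but then \<open>w\<close> can be subtracted from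
  any element dominating a tail.\<close>

lemma geometric_disjoint_uo_null:
  fixes e :: "'a::vector_lattice" and \<phi> :: "nat \<Rightarrow> 'a \<Rightarrow> real"
  assumes e: "strong_order_unit e" and \<phi>: "\<And>k. normal_functional (\<phi> k)"
    and y: "\<And>n. y n \<in> disjoint_cone (\<Inter>k. null_band (\<phi> k))"
    and small: "\<And>k n. k \<le> n \<Longrightarrow> \<phi> k (inf (y n) e) \<le> (1/2) ^ n"
  shows "uo_converges UNIV (\<le>) y 0"
  unfolding uo_converges_def
proof (intro allI impI)
  fix u :: 'a assume u: "0 \<le> u"
  note e0 = strong_order_unit_bound(1)[OF e]
  have y0: "0 \<le> y n" for n using y[of n] unfolding disjoint_cone_def by blast
  obtain m :: nat where m: "1 \<le> m" "\<bar>u\<bar> \<le> real m *\<^sub>R e" using strong_order_unit_bound(2)[OF e] by blast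
  define t where "t n = inf (y n) u" for n
  have t0: "0 \<le> t n" and tu: "t n \<le> u" for n unfolding t_def using y0 u by auto
  have \<phi>t: "\<phi> k (t n) \<le> real m * (1/2) ^ n" if "k \<le> n" for k n
  proof -
    have "t n \<le> inf (real m *\<^sub>R e) (y n)" unfolding t_def using m(2) u by (auto intro: le_infI2)
    also have "\<dots> \<le> max 1 (real m) *\<^sub>R inf e (y n)" by (rule inf_scale_le) (use e0 y0 in auto)
    finally have "t n \<le> real m *\<^sub>R inf (y n) e" using m(1) by (simp add: inf_commute max_def split: if_splits)
    then have "\<phi> k (t n) \<le> \<phi> k (real m *\<^sub>R inf (y n) e)" by (rule normal_functional_mono[OF \<phi>])
    also have "\<dots> = real m * \<phi> k (inf (y n) e)" using linear_scale[OF normal_functionalD(1)[OF \<phi>]] by simp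
    also have "\<dots> \<le> real m * (1/2) ^ n" using small[OF that] by (intro mult_left_mono) auto
    finally show ?thesis .
  qed
  define D where "D = {d. \<exists>n. \<forall>j\<ge>n. t j \<le> d}"
  have Dpos: "0 \<le> d" if "d \<in> D" for d using that t0 unfolding D_def by (auto intro: order_trans)
  have "descends_to_zero D"
  proof (rule descends_to_zeroI)
    have uD: "u \<in> D" unfolding D_def using tu by blast
    then show "D \<noteq> {}" by blast
    show "\<exists>c\<in>D. c \<le> a \<and> c \<le> b" if ab: "a \<in> D" "b \<in> D" for a b
    proof -
      obtain i j where "\<forall>l\<ge>i. t l \<le> a" "\<forall>l\<ge>j. t l \<le> b" using ab unfolding D_def by blast
      then have "\<forall>l\<ge>max i j. t l \<le> inf a b" by simp
      then have "inf a b \<in> D" unfolding D_def by blast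
      then show ?thesis by (rule bexI[rotated]) simp
    qed
    fix w assume w: "0 \<le> w" "\<And>d. d \<in> D \<Longrightarrow> w \<le> d"
    have "\<phi> k w = 0" for k
    proof -
      note mono = normal_functional_mono[OF \<phi>[of k]] and lin = normal_functionalD(1)[OF \<phi>[of k]]
      have bound: "\<phi> k w \<le> (1 + 2 * real m) * (1/2) ^ n" if n: "k \<le> n" for n
      proof -
        \<comment> \<open>Truncated partial sums serve instead of finite suprema: they dominate the terms of the tail,
             and the geometric decay keeps \<open>\<phi> k\<close> small on them.\<close>
        let ?s = "\<lambda>i. inf u (\<Sum>j=n..<n+i. t j)"
        have "?s i \<le> ?s j" if "i \<le> j" for i j
          by (intro inf_mono order_refl sum_mono2) (use that t0 in auto)
        then have "\<exists>d i. (\<forall>i. ?s i \<le> d) \<and> \<phi> k (d - ?s i) < (1/2) ^ n"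
          by (rule normal_functional_increasing_gap[where s = ?s and u = u, OF \<phi>[of k]]) simp_all
        then obtain d i where d: "\<forall>i. ?s i \<le> d" "\<phi> k (d - ?s i) < (1/2) ^ n" by blast
        have "t j \<le> d" if "n \<le> j" for j
        proof -
          have "sum t {j} \<le> sum t {n..<n+(Suc j - n)}"
            by (rule sum_mono2) (use that t0 in auto)
          then have "t j \<le> ?s (Suc j - n)" using tu by simp
          then show ?thesis using d(1) order_trans[of "t j"] by blast
        qed
        then have "d \<in> D" unfolding D_def by blast
        then have "\<phi> k w \<le> \<phi> k d" using w(2) mono by blast
        also have "\<dots> = \<phi> k (d - ?s i) + \<phi> k (?s i)" by (simp only: linear_diff[OF lin] diff_add_cancel)
        also have "\<phi> k (?s i) \<le> \<phi> k (\<Sum>j=n..<n+i. t j)" by (rule mono) simp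
        also have "\<dots> = (\<Sum>j=n..<n+i. \<phi> k (t j))" by (rule linear_sum[OF lin])
        also have "\<dots> \<le> (\<Sum>j=n..<n+i. real m * (1/2) ^ j)" by (rule sum_mono) (use \<phi>t n in auto)
        also have "\<dots> \<le> real m * (2 * (1/2) ^ n)"
          unfolding sum_distrib_left[symmetric] by (intro mult_left_mono sum_half_powers) simp
        finally show ?thesis using d(2) by (simp add: algebra_simps)
      qed
      have "\<phi> k w \<le> 0 + \<epsilon>" if \<epsilon>: "0 < \<epsilon>" for \<epsilon>
      proof -
        obtain n where n: "(1/2::real) ^ n < \<epsilon> / (1 + 2 * real m)"
          using real_arch_pow_inv[of "\<epsilon> / (1 + 2 * real m)" "1/2"] \<epsilon> by auto
        have "(1 + 2 * real m) * (1/2) ^ max n k \<le> (1 + 2 * real m) * (1/2) ^ n"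
          by (intro mult_left_mono power_decreasing) auto
        also have "\<dots> < \<epsilon>" using n by (simp add: field_simps)
        finally show ?thesis using bound[of "max n k"] by simp
      qed
      then have "\<phi> k w \<le> 0" by (rule field_le_epsilon)
      then show ?thesis using normal_functionalD(2)[OF \<phi> w(1)] by (simp add: antisym)
    qed
    then have wN: "w \<in> (\<Inter>k. null_band (\<phi> k))" unfolding null_band_def using w(1) by simp
    have disj: "inf (t j) w = 0" for j
    proof -
      have "t j \<in> disjoint_cone (\<Inter>k. null_band (\<phi> k))"
        by (rule disjoint_cone_le[OF y[of j] t0]) (simp add: t_def)
      then show ?thesis using wN w(1) unfolding disjoint_cone_def by (simp add: inf_commute)
    qed
    show "w = 0"
    proof (rule archimedean_translation[of "{s. u - s \<in> D}" w u])
      show "s + w \<in> {s. u - s \<in> D}" if s: "s \<in> {s. u - s \<in> D}" for s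
      proof -
        obtain n where n: "\<And>j. n \<le> j \<Longrightarrow> t j \<le> u - s" using s unfolding D_def by blast
        have ws: "w \<le> u - s" using w(2) s by blast
        have "t j \<le> u - (s + w)" if "n \<le> j" for j
          using disjoint_add_le[OF disj n[OF that] ws] by (simp add: algebra_simps)
        then show ?thesis unfolding D_def by blast
      qed
      show "s \<le> u" if "s \<in> {s. u - s \<in> D}" for s using Dpos[of "u - s"] that by simp
    qed (use uD w in auto)
  qed (rule Dpos)
  then show "order_converges UNIV (\<le>) (\<lambda>\<alpha>. inf \<bar>y \<alpha> - 0\<bar> u) 0"
  proof (rule order_convergesI_set)
    fix d assume "d \<in> D"
    then obtain n where n: "\<And>j. n \<le> j \<Longrightarrow> t j \<le> d" unfolding D_def by blast
    have "\<bar>0 - inf \<bar>y j - 0\<bar> u\<bar> \<le> d" if "n \<le> j" for j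
      using n[OF that] t0[of j] y0[of j] unfolding t_def by simp
    then show "net_eventually UNIV (\<le>) (\<lambda>\<alpha>. \<bar>0 - inf \<bar>y \<alpha> - 0\<bar> u\<bar> \<le> d)"
      unfolding net_eventually_def by blast
  qed
qed

text \<open>By exhaustion there are \<open>\<phi> n\<close> and \<open>b n \<le> e\<close>, disjoint from the null band of \<open>\<phi> n\<close>, with \<open>e - b n\<close> in
  \<open>V n\<close>.  An element \<open>w \<le> e\<close> of all null bands is disjoint from \<open>b n\<close>, so \<open>w \<le> e - b n\<close>.\<close>

lemma null_bands_below_halving:
  fixes e :: "'a::vector_lattice"
  assumes e: "strong_order_unit e" and I: "oc_dual_ideal I" "separates_points I"
    and uo: "uo_Lebesgue \<tau>" and V: "halving \<tau> V"
  obtains \<phi> :: "nat \<Rightarrow> 'a \<Rightarrow> real" where "\<And>n. \<phi> n \<in> normal_members I"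
    "(\<Inter>k. null_band (\<phi> k)) \<subseteq> (\<Inter>n. V n)"
proof -
  note e0 = strong_order_unit_bound(1)[OF e]
  have nm: "normal_functional \<phi>" if "\<phi> \<in> normal_members I" for \<phi>
    using that unfolding normal_members_def by blast
  let ?N = "null_band ` normal_members I"
  have D: "descends_to_zero {e - b | b. b \<le> e \<and> (\<exists>N\<in>?N. b \<in> disjoint_cone N)}"
  proof (rule separating_bands_exhaust[OF e0])
    show "?N \<noteq> {}" using normal_members_zero[OF I(1)] by blast
    show "band N" if "N \<in> ?N" for N using that null_band_band nm by blast
    show "\<Inter>?N \<subseteq> {0}"
    proof
      fix x assume x: "x \<in> \<Inter>?N"
      show "x \<in> {0}"
      proof (rule ccontr)
        assume "x \<notin> {0}"
        then obtain \<phi> where "\<phi> \<in> normal_members I" "0 < \<phi> \<bar>x\<bar>"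
          using normal_members_separate[OF I, of x] by auto
        moreover then have "x \<in> null_band \<phi>" using x by blast
        ultimately show False unfolding null_band_def by simp
      qed
    qed
    show "\<exists>L\<in>?N. L \<subseteq> N \<and> L \<subseteq> M" if NM: "N \<in> ?N" "M \<in> ?N" for N M
    proof -
      obtain \<phi> \<psi> where p: "\<phi> \<in> normal_members I" "N = null_band \<phi>" "\<psi> \<in> normal_members I" "M = null_band \<psi>"
        using NM by blast
      have "null_band (\<lambda>x. \<phi> x + \<psi> x) \<subseteq> N \<inter> M"
      proof
        fix x assume "x \<in> null_band (\<lambda>x. \<phi> x + \<psi> x)"
        then have "\<phi> \<bar>x\<bar> + \<psi> \<bar>x\<bar> = 0" unfolding null_band_def by simp
        moreover have "0 \<le> \<phi> \<bar>x\<bar>" "0 \<le> \<psi> \<bar>x\<bar>" using normal_functionalD(2)[OF nm] p by simp_all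
        ultimately show "x \<in> N \<inter> M" unfolding p null_band_def by simp
      qed
      then show ?thesis using normal_members_add[OF I(1) p(1,3)] by blast
    qed
  qed
  have "\<exists>\<phi> b. \<phi> \<in> normal_members I \<and> b \<le> e \<and> b \<in> disjoint_cone (null_band \<phi>) \<and> e - b \<in> V n" for n
  proof -
    have "solid_nhd \<tau> (V n)" using V unfolding halving_def by blast
    from uo_Lebesgue_nhd_meets[OF uo D this] show ?thesis by auto
  qed
  then obtain \<phi> b where \<phi>b: "\<And>n. \<phi> n \<in> normal_members I \<and> b n \<le> e
      \<and> b n \<in> disjoint_cone (null_band (\<phi> n)) \<and> e - b n \<in> V n" by metis
  let ?M = "\<Inter>n. V n"
  have M: "0 \<in> ?M" "solid ?M" "\<And>x y. x \<in> ?M \<Longrightarrow> y \<in> ?M \<Longrightarrow> x + y \<in> ?M"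
    using halving_Inter_band[OF uo V] unfolding band_def by auto
  have sol: "solid (V n)" for n using V solid_nhd_solid unfolding halving_def by blast
  have small: "w \<in> ?M" if w: "w \<in> (\<Inter>k. null_band (\<phi> k))" "0 \<le> w" "w \<le> e" for w
  proof -
    have "w \<in> V n" for n
    proof -
      have "inf w (b n) = 0" using \<phi>b[of n] w unfolding disjoint_cone_def by blast
      then have "w + b n \<le> e" using disjoint_add_le w(3) \<phi>b[of n] by blast
      then have "w \<le> e - b n" by (simp add: le_diff_eq)
      then show ?thesis using solid_leD[OF sol _ w(2)] \<phi>b by blast
    qed
    then show ?thesis by blast
  qed
  have "w \<in> ?M" if w: "w \<in> (\<Inter>k. null_band (\<phi> k))" for w
  proof -
    have sN: "solid (\<Inter>k. null_band (\<phi> k))"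
      using band_INT[of "\<lambda>k. null_band (\<phi> k)"] null_band_band nm \<phi>b unfolding band_def by blast
    obtain m :: nat where m: "1 \<le> m" "\<bar>w\<bar> \<le> real m *\<^sub>R e" using strong_order_unit_bound(2)[OF e] by blast
    let ?x = "inverse (real m) *\<^sub>R \<bar>w\<bar>"
    have x0: "0 \<le> ?x" by (intro scaleR_nonneg_nonneg) auto
    have "?x \<le> e" using m by (simp add: pos_divideR_le_eq)
    moreover have "?x \<le> 1 *\<^sub>R \<bar>w\<bar>" using m by (intro scaleR_right_mono) (auto simp: field_simps)
    then have "?x \<in> (\<Inter>k. null_band (\<phi> k))"
      using solid_leD[OF sN _ x0] solid_abs_iff[OF sN] w by (metis scaleR_one)
    ultimately have xM: "?x \<in> ?M" using small x0 by blast
    have "real i *\<^sub>R ?x \<in> ?M" for i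
    proof (induction i)
      case (Suc i)
      have "real (Suc i) *\<^sub>R ?x = real i *\<^sub>R ?x + ?x" by (simp add: scaleR_add_left add.commute algebra_simps)
      then show ?case using M(3)[OF Suc xM] by simp
    qed (use M in simp)
    from this[of m] have "\<bar>w\<bar> \<in> ?M" using m by simp
    then show ?thesis using solid_abs_iff[OF M(2)] by blast
  qed
  then have "(\<Inter>k. null_band (\<phi> k)) \<subseteq> ?M" by (rule subsetI)
  then show thesis using \<phi>b by (intro that[of \<phi>]) simp_all
qed

text \<open>Otherwise there are \<open>x\<close> outside \<open>U\<close> whose gauges for \<open>\<phi> 0, \<dots>, \<phi> n\<close> are below \<open>(1/2) ^ n\<close>, where
  the common null band \<open>N\<close> of the \<open>\<phi> k\<close> is contained in every \<open>V n\<close>.  Up to an element of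
  \<open>V 2\<close>, \<open>\<bar>x\<bar>\<close> is a sum of an element of \<open>N\<close>, which is in \<open>V 2\<close> as well, and of some \<open>y n\<close> disjoint from \<open>N\<close>.
  The \<open>y n\<close> stay outside \<open>V 1\<close>, although they form a uo-null sequence.\<close>

lemma solid_nhd_contains_truncated_ball:
  fixes e :: "'a::vector_lattice"
  assumes e: "strong_order_unit e" and I: "oc_dual_ideal I" "separates_points I"
    and uo: "uo_Lebesgue \<tau>" and U: "solid_nhd \<tau> U"
  shows "\<exists>\<phi>\<in>normal_members I. \<exists>\<epsilon>>0. \<forall>x. truncated e \<phi> x < \<epsilon> \<longrightarrow> x \<in> U"
proof (rule ccontr)
  assume neg: "\<not> ?thesis"
  note e0 = strong_order_unit_bound(1)[OF e]
  have nm: "normal_functional \<phi>" if "\<phi> \<in> normal_members I" for \<phi>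
    using that unfolding normal_members_def by blast
  have lin: "linear_topology \<tau>" "locally_solid \<tau>" using uo unfolding uo_Lebesgue_def by auto
  obtain V where V: "halving \<tau> V" "V 0 = U" by (rule halving_exists[OF lin U])
  have add: "x + y \<in> V n" if "x \<in> V (Suc n)" "y \<in> V (Suc n)" for x y n
    using V(1) that unfolding halving_def by blast
  have nhd: "solid_nhd \<tau> (V n)" for n using V(1) unfolding halving_def by blast
  obtain \<phi> where \<phi>: "\<And>n::nat. \<phi> n \<in> normal_members I" "(\<Inter>k. null_band (\<phi> k)) \<subseteq> (\<Inter>n. V n)"
    using null_bands_below_halving[OF e I uo V(1)] by blast
  let ?N = "\<Inter>k. null_band (\<phi> k)"
  have N: "band ?N" by (intro band_INT null_band_band nm \<phi>)
  define \<psi> where "\<psi> n x = (\<Sum>k\<le>n. \<phi> k x)" for n :: nat and x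
  have \<psi>: "\<psi> n \<in> normal_members I" for n
  proof (induction n)
    case 0
    then show ?case using \<phi>(1)[of 0] unfolding \<psi>_def by simp
  next
    case (Suc n)
    have "\<psi> (Suc n) = (\<lambda>x. \<psi> n x + \<phi> (Suc n) x)" unfolding \<psi>_def by simp
    then show ?case using normal_members_add[OF I(1) Suc \<phi>(1)] by simp
  qed
  have "\<exists>y. y \<in> disjoint_cone ?N \<and> y \<notin> V 1 \<and> \<psi> n (inf y e) < (1/2) ^ n" for n
  proof -
    have "\<exists>x. truncated e (\<psi> n) x < (1/2) ^ n \<and> x \<notin> U" using neg \<psi>[of n] by fastforce
    then obtain x where x: "truncated e (\<psi> n) x < (1/2) ^ n" "x \<notin> U" by blast
    from uo_Lebesgue_nhd_meets[OF uo band_plus_disjoint_order_dense[OF N abs_ge_zero[of x]] nhd[of "Suc (Suc 0)"]]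
    obtain a b where ab: "a \<in> ?N" "b \<in> disjoint_cone ?N" "b \<le> \<bar>x\<bar>" "\<bar>x\<bar> - (a + b) \<in> V (Suc (Suc 0))" by blast
    have "a \<in> V (Suc (Suc 0))" using ab(1) \<phi>(2) by blast
    then have "\<bar>x\<bar> - (a + b) + a \<in> V (Suc 0)" using add ab(4) by blast
    moreover have "b \<in> V (Suc 0) \<Longrightarrow> \<bar>x\<bar> - (a + b) + a + b \<in> V 0" using add calculation by blast
    moreover have "\<bar>x\<bar> - (a + b) + a + b = \<bar>x\<bar>" by simp
    moreover have "\<bar>x\<bar> \<notin> V 0" using x(2) V(2) solid_abs_iff[OF solid_nhd_solid[OF U]] by simp
    ultimately have "b \<notin> V 1" by auto
    moreover have "\<psi> n (inf b e) \<le> truncated e (\<psi> n) x"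
      unfolding truncated_def by (intro normal_functional_mono nm \<psi> inf_mono ab order_refl)
    ultimately show ?thesis using ab(2) x(1) by (intro exI[of _ b]) auto
  qed
  then obtain y where y: "\<And>n. y n \<in> disjoint_cone ?N \<and> y n \<notin> V 1 \<and> \<psi> n (inf (y n) e) < (1/2) ^ n" by metis
  have y0: "0 \<le> y n" for n using y[of n] unfolding disjoint_cone_def by blast
  have "uo_converges UNIV (\<le>) y 0"
  proof (rule geometric_disjoint_uo_null[OF e])
    show "normal_functional (\<phi> k)" for k using nm \<phi>(1) by blast
    show "y n \<in> disjoint_cone ?N" for n using y by blast
    fix k n :: nat assume "k \<le> n"
    have "\<phi> k (inf (y n) e) \<le> \<psi> n (inf (y n) e)"
      unfolding \<psi>_def
      by (rule member_le_sum) (use \<open>k \<le> n\<close> y0 e0 normal_functionalD(2)[OF nm[OF \<phi>(1)]] in auto)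
    then show "\<phi> k (inf (y n) e) \<le> (1/2) ^ n" using y[of n] by linarith
  qed
  moreover have "directed UNIV ((\<le>) :: nat \<Rightarrow> nat \<Rightarrow> bool)"
    unfolding directed_def by (auto intro: max.cobounded1 max.cobounded2)
  ultimately have "net_converges \<tau> UNIV (\<le>) y 0" using uo_Lebesgue_all_nets[OF uo] by blast
  moreover obtain W where W: "openin \<tau> W" "0 \<in> W" "W \<subseteq> V 1" using nhd[of 1] unfolding solid_nhd_def by blast
  ultimately have "net_eventually UNIV (\<le>) (\<lambda>n. y n \<in> W)" unfolding net_converges_def by blast
  then show False using y W(3) unfolding net_eventually_def by blast
qed

text \<open>The counterpart of \<open>null_bands_below_halving\<close> with the two kinds of bands interchanged; the
  neighbourhood sequences found by exhaustion are merged by \<open>halving_diagonal\<close>.\<close>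

lemma halving_band_below_null_band:
  fixes e :: "'a::vector_lattice"
  assumes e0: "0 \<le> e" and uo: "uo_Lebesgue \<tau>" and H: "Hausdorff_space \<tau>" and \<phi>: "normal_functional \<phi>"
  obtains V where "halving \<tau> V" "\<And>w. w \<in> (\<Inter>n. V n) \<Longrightarrow> 0 \<le> w \<Longrightarrow> w \<le> e \<Longrightarrow> \<phi> w = 0"
proof -
  have lin: "linear_topology \<tau>" "locally_solid \<tau>" using uo unfolding uo_Lebesgue_def by auto
  let ?N = "{\<Inter>n. V n | V. halving \<tau> V}"
  have D: "descends_to_zero {e - b | b. b \<le> e \<and> (\<exists>N\<in>?N. b \<in> disjoint_cone N)}"
  proof (rule separating_bands_exhaust[OF e0])
    have "openin \<tau> UNIV" using lin(1) openin_topspace[of \<tau>] unfolding linear_topology_def by simp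
    then have "solid_nhd \<tau> UNIV" unfolding solid_nhd_def solid_def by auto
    then have "halving \<tau> (\<lambda>n. UNIV)" unfolding halving_def by simp
    then show "?N \<noteq> {}" by blast
    show "band N" if "N \<in> ?N" for N using that halving_Inter_band[OF uo] by blast
    show "\<Inter>?N \<subseteq> {0}"
    proof
      fix x assume x: "x \<in> \<Inter>?N"
      show "x \<in> {0}"
      proof (rule ccontr)
        assume "x \<notin> {0}"
        then obtain U where U: "solid_nhd \<tau> U" "x \<notin> U" using Hausdorff_solid_nhd[OF lin H] by blast
        obtain V where V: "halving \<tau> V" "V 0 = U" by (rule halving_exists[OF lin U(1)])
        have "x \<in> (\<Inter>n. V n)" using x V(1) by blast
        then have "x \<in> V 0" by blast
        then show False using V(2) U(2) by simp
      qed
    qed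
    show "\<exists>L\<in>?N. L \<subseteq> N \<and> L \<subseteq> M" if NM: "N \<in> ?N" "M \<in> ?N" for N M
    proof -
      obtain V V' where V: "halving \<tau> V" "N = (\<Inter>n. V n)" "halving \<tau> V'" "M = (\<Inter>n. V' n)"
        using NM by blast
      have "halving \<tau> (\<lambda>n. V n \<inter> V' n)"
        using V(1,3) solid_nhd_Int unfolding halving_def by blast
      then have "(\<Inter>n. V n \<inter> V' n) \<in> ?N" by blast
      then show ?thesis by (rule bexI[rotated]) (auto simp: V)
    qed
  qed
  have "\<exists>V b. halving \<tau> V \<and> b \<le> e \<and> b \<in> disjoint_cone (\<Inter>n. V n) \<and> \<phi> (e - b) < inverse (real (Suc n))" for n
  proof -
    have "0 < inverse (real (Suc n))" by simp
    from normal_functionalD(3)[OF \<phi> D this] show ?thesis by auto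
  qed
  then obtain V b where Vb: "\<And>n. halving \<tau> (V n) \<and> b n \<le> e \<and> b n \<in> disjoint_cone (\<Inter>k. V n k)
    \<and> \<phi> (e - b n) < inverse (real (Suc n))" by metis
  let ?W = "\<lambda>n. \<Inter>k\<le>n. V k n"
  have W: "halving \<tau> ?W" and sub: "(\<Inter>n. ?W n) \<subseteq> (\<Inter>n. V j n)" for j
    using halving_diagonal[of \<tau> V] Vb by blast+
  have "\<phi> w = 0" if w: "w \<in> (\<Inter>n. ?W n)" "0 \<le> w" "w \<le> e" for w
  proof -
    have less: "\<phi> w < inverse (real (Suc n))" for n
    proof -
      have "w \<in> (\<Inter>k. V n k)" using sub w(1) by blast
      then have "inf w (b n) = 0" using Vb[of n] w(2) unfolding disjoint_cone_def by blast
      then have "w + b n \<le> e" using disjoint_add_le w(3) Vb[of n] by blast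
      then have "w \<le> e - b n" by (simp add: le_diff_eq)
      then have "\<phi> w \<le> \<phi> (e - b n)" by (rule normal_functional_mono[OF \<phi>])
      then show ?thesis using Vb[of n] by linarith
    qed
    have "\<phi> w \<le> 0 + \<epsilon>" if \<epsilon>: "0 < \<epsilon>" for \<epsilon>
    proof -
      obtain n where "inverse (real (Suc n)) < \<epsilon>" using reals_Archimedean[OF \<epsilon>] by blast
      then show ?thesis using less[of n] by simp
    qed
    then have "\<phi> w \<le> 0" by (rule field_le_epsilon)
    then show ?thesis using normal_functionalD(2)[OF \<phi> w(2)] by simp
  qed
  then show thesis by (rule that[OF W])
qed

lemma inf_diff_inf_le:
  fixes a b a' b' :: "'a::lattice_ab_group_add"
  assumes "a' \<le> a" "b' \<le> b"
  shows "inf a b - inf a' b' \<le> (a - a') + (b - b')"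
proof -
  let ?s = "(a - a') + (b - b')"
  have "a' + (a - a') \<le> a' + ?s" "b' + (b - b') \<le> b' + ?s" using assms by (simp_all add: add_increasing add_increasing2)
  then have "inf a b \<le> inf (a' + ?s) (b' + ?s)" by (intro inf_mono) simp_all
  also have "\<dots> = inf a' b' + ?s" by (simp only: add_inf_distrib_right)
  finally show ?thesis by (simp only: diff_le_eq add.commute)
qed

text \<open>Otherwise there are \<open>v j\<close> in \<open>W (Suc j) \<inter> {0..e}\<close> with \<open>\<phi> (v j) \<ge> \<epsilon>\<close>.  The partial sums \<open>z n k\<close> of
  \<open>v n, v (Suc n), \<dots>\<close>, truncated at \<open>e\<close>, stay in \<open>W n\<close>.  Let \<open>d n\<close> be an upper bound of \<open>z n\<close> that is
  almost attained by \<open>z n (k n)\<close>, and let \<open>g n\<close> and \<open>f n\<close> be the infima of the first \<open>d i\<close> and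
  \<open>z i (k i)\<close>.  Then \<open>g n\<close> still dominates \<open>v n\<close>, so that \<open>\<phi> (g n) \<ge> \<epsilon>\<close>, and \<open>\<phi> (g n - f n) \<le> \<epsilon> / 2\<close>.
  Thus the \<open>f n\<close> decrease, lie in \<open>W n\<close>, and satisfy \<open>\<phi> (f n) \<ge> \<epsilon> / 2\<close>.  An almost optimal lower bound of
  the \<open>f n\<close> is in all \<open>W n\<close>, where \<open>\<phi>\<close> should vanish.\<close>

lemma truncated_ball_contains_solid_nhd:
  fixes e :: "'a::vector_lattice"
  assumes e0: "0 \<le> e" and uo: "uo_Lebesgue \<tau>" and H: "Hausdorff_space \<tau>" and \<phi>: "normal_functional \<phi>"
    and \<epsilon>: "0 < \<epsilon>"
  shows "\<exists>V. solid_nhd \<tau> V \<and> (\<forall>x\<in>V. truncated e \<phi> x < \<epsilon>)"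
proof (rule ccontr)
  assume neg: "\<not> ?thesis"
  note mono = normal_functional_mono[OF \<phi>] and linf = normal_functionalD(1)[OF \<phi>] and pos = normal_functionalD(2)[OF \<phi>]
  obtain W where W: "halving \<tau> W" and null: "\<And>w. w \<in> (\<Inter>n. W n) \<Longrightarrow> 0 \<le> w \<Longrightarrow> w \<le> e \<Longrightarrow> \<phi> w = 0"
    using halving_band_below_null_band[OF e0 uo H \<phi>] by blast
  have nhd: "solid_nhd \<tau> (W n)" and sol: "solid (W n)" for n
    using W solid_nhd_solid unfolding halving_def by blast+
  have "\<exists>v. v \<in> W (Suc n) \<and> 0 \<le> v \<and> v \<le> e \<and> \<epsilon> \<le> \<phi> v" for n
  proof -
    obtain x where x: "x \<in> W (Suc n)" "\<epsilon> \<le> truncated e \<phi> x" using neg nhd[of "Suc n"] not_le by blast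
    have "inf \<bar>x\<bar> e \<in> W (Suc n)"
      using solid_leD[OF sol, of "\<bar>x\<bar>" "Suc n" "inf \<bar>x\<bar> e"] solid_abs_iff[OF sol] x(1) e0 by simp
    then show ?thesis using e0 x(2) unfolding truncated_def by (intro exI[of _ "inf \<bar>x\<bar> e"]) simp
  qed
  then obtain v where v: "\<And>n. v n \<in> W (Suc n) \<and> 0 \<le> v n \<and> v n \<le> e \<and> \<epsilon> \<le> \<phi> (v n)" by metis
  define z where "z n k = inf e (\<Sum>j=n..<n+k. v j)" for n k
  have sum0: "0 \<le> (\<Sum>j=n..<n+k. v j)" for n k using v by (simp add: sum_nonneg)
  have z0: "0 \<le> z n k" and ze: "z n k \<le> e" for n k unfolding z_def using sum0 e0 by auto
  have zW: "z n k \<in> W n" for n k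
  proof (rule solid_leD[OF sol _ z0])
    show "(\<Sum>j=n..<n+k. v j) \<in> W n" by (rule halving_sum[OF W]) (use v in simp)
  qed (simp add: z_def)
  have zshift: "z n k \<le> z i (n - i + k)" if "i \<le> n" for i n k
    unfolding z_def by (intro inf_mono order_refl sum_mono2) (use that v in auto)
  have zmono: "z n i \<le> z n j" if "i \<le> j" for n i j
    unfolding z_def by (intro inf_mono order_refl sum_mono2) (use that v in auto)
  have "\<exists>d k. (\<forall>k. z n k \<le> d) \<and> \<phi> (d - z n k) < \<epsilon> / 4 * (1/2) ^ n" for n
    by (rule normal_functional_increasing_gap[OF \<phi> zmono ze]) (use \<epsilon> in simp_all)
  then obtain d k where dk: "\<And>n. (\<forall>i. z n i \<le> d n) \<and> \<phi> (d n - z n (k n)) < \<epsilon> / 4 * (1/2) ^ n" by metis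
  define g where "g = rec_nat (d 0) (\<lambda>n r. inf r (d (Suc n)))"
  define f where "f = rec_nat (z 0 (k 0)) (\<lambda>n r. inf r (z (Suc n) (k (Suc n))))"
  have g: "g 0 = d 0" "g (Suc n) = inf (g n) (d (Suc n))"
    and f: "f 0 = z 0 (k 0)" "f (Suc n) = inf (f n) (z (Suc n) (k (Suc n)))" for n
    unfolding g_def f_def by simp_all
  have zd: "z n i \<le> d j" if "j \<le> n" for n i j
    using zshift[OF that, of i] dk order_trans by blast
  have zg: "z m i \<le> g n" if "n \<le> m" for m n i
    using that by (induction n) (auto simp: g zd)
  have fg: "f n \<le> g n" for n
    by (induction n) (use dk in \<open>auto simp: f g intro: le_infI1 le_infI2\<close>)
  have fz: "f n \<le> z n (k n)" for n by (cases n) (auto simp: f)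
  have f0: "0 \<le> f n" for n by (induction n) (auto simp: f z0)
  have gf: "\<phi> (g n - f n) \<le> (\<Sum>j=0..<0+Suc n. \<epsilon> / 4 * (1/2) ^ j)" for n
  proof (induction n)
    case 0
    then show ?case using dk[of 0] by (simp add: f g)
  next
    case (Suc n)
    have "g (Suc n) - f (Suc n) \<le> (g n - f n) + (d (Suc n) - z (Suc n) (k (Suc n)))"
      unfolding f g by (rule inf_diff_inf_le) (use fg dk in auto)
    then have "\<phi> (g (Suc n) - f (Suc n)) \<le> \<phi> (g n - f n) + \<phi> (d (Suc n) - z (Suc n) (k (Suc n)))"
      using mono linear_add[OF linf] by metis
    then show ?case using Suc dk[of "Suc n"] by simp
  qed
  have \<phi>f: "\<epsilon> / 2 \<le> \<phi> (f n)" for n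
  proof -
    have "\<phi> (g n - f n) \<le> \<epsilon> / 4 * (\<Sum>j=0..<0+Suc n. (1/2) ^ j)"
      using gf[of n] unfolding sum_distrib_left .
    also have "\<dots> \<le> \<epsilon> / 4 * (2 * (1/2) ^ 0)" by (intro mult_left_mono sum_half_powers) (use \<epsilon> in simp)
    finally have "\<phi> (g n) - \<phi> (f n) \<le> \<epsilon> / 2" using linear_diff[OF linf] by simp
    moreover have "v n \<le> g n" using zg[of n n 1] v[of n] unfolding z_def by (simp add: inf.absorb2)
    then have "\<epsilon> \<le> \<phi> (g n)" using v[of n] mono order_trans by blast
    ultimately show ?thesis by simp
  qed
  have fdec: "f n \<le> f m" if "m \<le> n" for m n
    using that by (induction n rule: dec_induct) (auto simp: f intro: le_infI1)
  have "\<exists>c n. (\<forall>m. - f m \<le> c) \<and> \<phi> (c - - f n) < \<epsilon> / 4"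
    by (rule normal_functional_increasing_gap[OF \<phi>, where u = 0]) (use fdec f0 \<epsilon> in simp_all)
  then obtain c n where c: "\<forall>m. - f m \<le> c" "\<phi> (c - - f n) < \<epsilon> / 4" by blast
  let ?w = "sup (- c) 0"
  have wf: "?w \<le> f m" for m using c(1)[rule_format, of m] f0[of m] by (simp add: minus_le_iff)
  have "?w \<in> W m" for m
    using solid_leD[OF sol zW[of m "k m"], of ?w] order_trans[OF wf fz] by simp
  moreover have "?w \<le> e" using order_trans[OF wf fz[of 0]] ze order_trans by blast
  ultimately have "\<phi> ?w = 0" by (intro null) auto
  then have "\<phi> (- c) \<le> 0" using mono[of "- c" ?w] by simp
  then have "\<phi> (f n) < \<epsilon> / 4" using c(2) linear_add[OF linf, of c "f n"] linear_neg[OF linf, of c] by simp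
  then show False using \<phi>f[of n] \<epsilon> by simp
qed

lemma uo_Lebesgue_eq_truncated_topology:
  fixes e :: "'a::vector_lattice"
  assumes e: "strong_order_unit e" and I: "oc_dual_ideal I" "separates_points I"
    and uo: "uo_Lebesgue \<tau>" and H: "Hausdorff_space \<tau>"
  shows "\<tau> = truncated_topology e I"
proof (rule topology_eq[THEN iffD2], intro allI iffI)
  note e0 = strong_order_unit_bound(1)[OF e]
  have lin: "linear_topology \<tau>" "locally_solid \<tau>" using uo unfolding uo_Lebesgue_def by auto
  note open1 = openin_iff_solid_nhd[OF lin] and open2 = openin_truncated_topology[OF e0 I(1)]
  fix U
  show "openin (truncated_topology e I) U" if U: "openin \<tau> U"
    unfolding open2
  proof
    fix x assume x: "x \<in> U"
    from bspec[OF U[unfolded open1] x] obtain V where V: "solid_nhd \<tau> V" "\<forall>v\<in>V. x + v \<in> U" by (elim exE conjE)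
    obtain \<phi> \<epsilon> where \<phi>: "\<phi> \<in> normal_members I" "\<epsilon> > 0" "\<And>x. truncated e \<phi> x < \<epsilon> \<Longrightarrow> x \<in> V"
      using solid_nhd_contains_truncated_ball[OF e I uo V(1)] by blast
    have "y \<in> U" if "truncated e \<phi> (y - x) < \<epsilon>" for y
      using bspec[OF V(2) \<phi>(3)[OF that]] by simp
    then show "\<exists>\<phi>\<in>normal_members I. \<exists>\<epsilon>>0. \<forall>y. truncated e \<phi> (y - x) < \<epsilon> \<longrightarrow> y \<in> U"
      using \<phi>(1,2) by blast
  qed
  show "openin \<tau> U" if U: "openin (truncated_topology e I) U"
    unfolding open1
  proof
    fix x assume x: "x \<in> U"
    from bspec[OF U[unfolded open2] x]
    obtain \<phi> \<epsilon> where \<phi>: "\<phi> \<in> normal_members I" "\<epsilon> > 0" "\<forall>y. truncated e \<phi> (y - x) < \<epsilon> \<longrightarrow> y \<in> U" by blast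
    have "normal_functional \<phi>" using \<phi>(1) unfolding normal_members_def by blast
    from truncated_ball_contains_solid_nhd[OF e0 uo H this \<phi>(2)]
    obtain V where V: "solid_nhd \<tau> V" "\<forall>x\<in>V. truncated e \<phi> x < \<epsilon>" by blast
    have "x + v \<in> U" if "v \<in> V" for v using \<phi>(3)[rule_format, of "x + v"] V(2) that by simp
    then show "\<exists>V. solid_nhd \<tau> V \<and> (\<forall>v\<in>V. x + v \<in> U)" using V(1) by blast
  qed
qed

section \<open>Separation of a subspace from a point\<close>

text \<open>The one-dimensional step of the Hahn--Banach theorem.  A functional with values dominated by \<open>p\<close> is
  represented by its graph, a subspace of the product with \<open>real\<close>.\<close>

lemma dominated_graph_extension:
  fixes p :: "'a::real_vector \<Rightarrow> real" and x\<^sub>0 :: 'a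
  assumes add: "\<And>x y. p (x + y) \<le> p x + p y" and hom: "\<And>c x. 0 < c \<Longrightarrow> p (c *\<^sub>R x) = c * p x"
    and M: "subspace M" and dom: "\<And>y a. (y, a) \<in> M \<Longrightarrow> a \<le> p y"
  obtains M' c where "subspace M'" "M \<subseteq> M'" "\<And>y a. (y, a) \<in> M' \<Longrightarrow> a \<le> p y" "(x\<^sub>0, c) \<in> M'"
proof -
  have M0: "(0, 0) \<in> M" using subspace_0[OF M] by (simp add: zero_prod_def)
  define L where "L = (\<lambda>(y, a). a - p (y - x\<^sub>0)) ` M"
  define c where "c = Sup L"
  have le: "l \<le> p (z + x\<^sub>0) - b" if l: "l \<in> L" and z: "(z, b) \<in> M" for l z b
  proof -
    obtain y a where y: "(y, a) \<in> M" "l = a - p (y - x\<^sub>0)" using l unfolding L_def by auto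
    have "(y + z, a + b) \<in> M" using subspace_add[OF M y(1) z] by simp
    then have "a + b \<le> p (y + z)" by (rule dom)
    also have "\<dots> \<le> p (y - x\<^sub>0) + p (z + x\<^sub>0)" using add[of "y - x\<^sub>0" "z + x\<^sub>0"] by simp
    finally show ?thesis using y(2) by simp
  qed
  have ne: "L \<noteq> {}" unfolding L_def using M0 by blast
  have bdd: "bdd_above L" using le[OF _ M0] by (auto intro!: bdd_aboveI)
  have upper: "a - p (y - x\<^sub>0) \<le> c" if "(y, a) \<in> M" for y a
    unfolding c_def by (rule cSup_upper[OF _ bdd]) (use that in \<open>force simp: L_def\<close>)
  have lower: "c \<le> p (z + x\<^sub>0) - b" if "(z, b) \<in> M" for z b
    unfolding c_def by (rule cSup_least[OF ne le[OF _ that]])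
  define M' where "M' = {(y + t *\<^sub>R x\<^sub>0, a + t * c) | y a t. (y, a) \<in> M}"
  have M'I: "(y + t *\<^sub>R x\<^sub>0, a + t * c) \<in> M'" if "(y, a) \<in> M" for y a t
    unfolding M'_def using that by blast
  have M'E: "\<exists>y a t. (y, a) \<in> M \<and> u = (y + t *\<^sub>R x\<^sub>0, a + t * c)" if "u \<in> M'" for u
    using that unfolding M'_def by blast
  have "subspace M'"
  proof (rule subspaceI)
    show "0 \<in> M'" using M'I[OF M0, of 0] by (simp add: zero_prod_def)
    show "u + v \<in> M'" if uv: "u \<in> M'" "v \<in> M'" for u v
    proof -
      obtain y a t where u: "(y, a) \<in> M" "u = (y + t *\<^sub>R x\<^sub>0, a + t * c)" using M'E[OF uv(1)] by blast
      obtain z b s where v: "(z, b) \<in> M" "v = (z + s *\<^sub>R x\<^sub>0, b + s * c)" using M'E[OF uv(2)] by blast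
      have "(y + z, a + b) \<in> M" using subspace_add[OF M u(1) v(1)] by simp
      from M'I[OF this, of "t + s"] show ?thesis unfolding u v by (simp add: algebra_simps)
    qed
    show "k *\<^sub>R u \<in> M'" if u': "u \<in> M'" for k u
    proof -
      obtain y a t where u: "(y, a) \<in> M" "u = (y + t *\<^sub>R x\<^sub>0, a + t * c)" using M'E[OF u'] by blast
      have "(k *\<^sub>R y, k * a) \<in> M" using subspace_scale[OF M u(1), of k] by simp
      from M'I[OF this, of "k * t"] show ?thesis unfolding u by (simp add: algebra_simps)
    qed
  qed
  moreover have "M \<subseteq> M'"
  proof
    fix u assume "u \<in> M"
    then show "u \<in> M'" using M'I[of "fst u" "snd u" 0] by simp
  qed
  moreover have "a' \<le> p y'" if ya': "(y', a') \<in> M'" for y' a'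
  proof -
    obtain y a t where u: "(y, a) \<in> M" "y' = y + t *\<^sub>R x\<^sub>0" "a' = a + t * c"
      using M'E[OF ya'] by blast
    consider "t = 0" | "t > 0" | "t < 0" by linarith
    then show ?thesis
    proof cases
      case 1
      then show ?thesis using u dom by simp
    next
      case 2
      have "(inverse t *\<^sub>R y, inverse t * a) \<in> M" using subspace_scale[OF M u(1), of "inverse t"] by simp
      then have "c \<le> p (inverse t *\<^sub>R y + x\<^sub>0) - inverse t * a" by (rule lower)
      then have "t * c \<le> t * p (inverse t *\<^sub>R y + x\<^sub>0) - a" using 2 by (simp add: field_simps)
      also have "t * p (inverse t *\<^sub>R y + x\<^sub>0) = p (t *\<^sub>R (inverse t *\<^sub>R y + x\<^sub>0))"
        using hom[OF 2] by simp
      also have "t *\<^sub>R (inverse t *\<^sub>R y + x\<^sub>0) = y'" using 2 u(2) by (simp add: scaleR_add_right)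
      finally show ?thesis using u(3) by simp
    next
      case 3
      define s where "s = - t"
      have s: "0 < s" using 3 unfolding s_def by simp
      have "(inverse s *\<^sub>R y, inverse s * a) \<in> M" using subspace_scale[OF M u(1), of "inverse s"] by simp
      then have "inverse s * a - p (inverse s *\<^sub>R y - x\<^sub>0) \<le> c" by (rule upper)
      then have "a - s * c \<le> s * p (inverse s *\<^sub>R y - x\<^sub>0)" using s by (simp add: field_simps)
      also have "s * p (inverse s *\<^sub>R y - x\<^sub>0) = p (s *\<^sub>R (inverse s *\<^sub>R y - x\<^sub>0))"
        using hom[OF s] by simp
      also have "s *\<^sub>R (inverse s *\<^sub>R y - x\<^sub>0) = y'" using s u(2) by (simp add: scaleR_diff_right s_def)
      finally show ?thesis using u(3) unfolding s_def by simp
    qed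
  qed
  moreover have "(x\<^sub>0, c) \<in> M'" using M'I[OF M0, of 1] by simp
  ultimately show thesis by (rule that)
qed

text \<open>The Hahn--Banach theorem.  A dominated subspace \<open>M\<close> is automatically the graph of a function, because
  \<open>(0, t)\<close> and \<open>(0, - t)\<close> in \<open>M\<close> give \<open>t = 0\<close>.\<close>

lemma dominated_extension:
  fixes p :: "'a::real_vector \<Rightarrow> real"
  assumes add: "\<And>x y. p (x + y) \<le> p x + p y" and hom: "\<And>c x. 0 < c \<Longrightarrow> p (c *\<^sub>R x) = c * p x"
    and G: "subspace G" and dom: "\<And>y a. (y, a) \<in> G \<Longrightarrow> a \<le> p y"
  obtains f where "linear f" "\<And>x. f x \<le> p x" "\<And>y a. (y, a) \<in> G \<Longrightarrow> f y = a"
proof -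
  define \<A> where "\<A> = {M. subspace M \<and> G \<subseteq> M \<and> (\<forall>z\<in>M. snd z \<le> p (fst z))}"
  have "\<exists>M\<in>\<A>. \<forall>X\<in>\<A>. M \<subseteq> X \<longrightarrow> X = M"
  proof (rule subset_Zorn_nonempty)
    show "\<A> \<noteq> {}" unfolding \<A>_def using G dom by auto
    fix C assume C: "C \<noteq> {}" "subset.chain \<A> C"
    then have CA: "X \<in> \<A>" if "X \<in> C" for X using that unfolding subset.chain_def by blast
    have Cl: "X \<subseteq> Y \<or> Y \<subseteq> X" if "X \<in> C" "Y \<in> C" for X Y
      using C(2) that unfolding subset.chain_def by blast
    have "subspace (\<Union>C)"
    proof (rule subspaceI)
      show "0 \<in> \<Union>C" using C(1) CA subspace_0 unfolding \<A>_def by blast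
      show "x + y \<in> \<Union>C" if xy: "x \<in> \<Union>C" "y \<in> \<Union>C" for x y
      proof -
        obtain X Y where XY: "X \<in> C" "x \<in> X" "Y \<in> C" "y \<in> Y" using xy by blast
        then obtain Z where "Z \<in> C" "x \<in> Z" "y \<in> Z" using Cl[OF XY(1,3)] by blast
        then show ?thesis using CA subspace_add unfolding \<A>_def by blast
      qed
      show "c *\<^sub>R x \<in> \<Union>C" if x: "x \<in> \<Union>C" for c x
      proof -
        obtain X where "X \<in> C" "x \<in> X" using x by blast
        then show ?thesis using CA subspace_scale unfolding \<A>_def by blast
      qed
    qed
    moreover have "G \<subseteq> \<Union>C" using C(1) CA unfolding \<A>_def by blast
    moreover have "\<forall>z\<in>\<Union>C. snd z \<le> p (fst z)" using CA unfolding \<A>_def by blast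
    ultimately show "\<Union>C \<in> \<A>" unfolding \<A>_def by blast
  qed
  then obtain M where MA: "M \<in> \<A>" and max: "\<And>X. X \<in> \<A> \<Longrightarrow> M \<subseteq> X \<Longrightarrow> X = M" by blast
  have M: "subspace M" "G \<subseteq> M" and Mdom: "\<And>y a. (y, a) \<in> M \<Longrightarrow> a \<le> p y"
    using MA unfolding \<A>_def by auto
  have "p 0 = 0" using hom[of 2 0] by simp
  have uniq: "a = b" if ab: "(x, a) \<in> M" "(x, b) \<in> M" for x a b
  proof -
    have "(0, a - b) \<in> M" "(0, b - a) \<in> M"
      using subspace_diff[OF M(1) ab] subspace_diff[OF M(1) ab(2,1)] by simp_all
    then show ?thesis using Mdom[of 0 "a - b"] Mdom[of 0 "b - a"] \<open>p 0 = 0\<close> by simp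
  qed
  have ex: "\<exists>a. (x, a) \<in> M" for x
  proof -
    obtain M' c where M': "subspace M'" "M \<subseteq> M'" "\<And>y a. (y, a) \<in> M' \<Longrightarrow> a \<le> p y" "(x, c) \<in> M'"
      using dominated_graph_extension[where p = p and M = M and x\<^sub>0 = x, OF add hom M(1) Mdom] by metis
    have "M' \<in> \<A>" unfolding \<A>_def using M' M(2) by auto
    then have "M' = M" using max M'(2) by blast
    then show ?thesis using M'(4) by blast
  qed
  define f where "f x = (THE a. (x, a) \<in> M)" for x
  have f: "(x, f x) \<in> M" for x
    unfolding f_def by (rule theI') (use ex uniq in blast)
  have feq: "f x = a" if "(x, a) \<in> M" for x a using uniq[OF f that] .
  have "linear f"
  proof (rule linearI)
    show "f (x + y) = f x + f y" for x y using subspace_add[OF M(1) f[of x] f[of y]] by (intro feq) simp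
    show "f (c *\<^sub>R x) = c *\<^sub>R f x" for c x using subspace_scale[OF M(1) f[of x], of c] by (intro feq) simp
  qed
  then show thesis using that Mdom[OF f] feq M(2) by blast
qed

text \<open>Extend the functional \<open>b + t *\<^sub>R x\<^sub>0 \<mapsto> t\<close>, which is dominated by \<open>p / \<epsilon>\<close>.\<close>

lemma separate_point_from_subspace:
  fixes p :: "'a::real_vector \<Rightarrow> real"
  assumes add: "\<And>x y. p (x + y) \<le> p x + p y" and hom: "\<And>c x. p (c *\<^sub>R x) = \<bar>c\<bar> * p x"
    and pos: "\<And>x. 0 \<le> p x" and B: "subspace B" and \<epsilon>: "0 < \<epsilon>" and far: "\<And>b. b \<in> B \<Longrightarrow> \<epsilon> \<le> p (b - x\<^sub>0)"
  obtains f where "linear f" "\<And>x. \<bar>f x\<bar> \<le> inverse \<epsilon> * p x" "\<And>b. b \<in> B \<Longrightarrow> f b = 0" "f x\<^sub>0 = 1"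
proof -
  define G where "G = {(b + t *\<^sub>R x\<^sub>0, t) | b t. b \<in> B}"
  have GI: "(b + t *\<^sub>R x\<^sub>0, t) \<in> G" if "b \<in> B" for b t unfolding G_def using that by blast
  have GE: "\<exists>b t. b \<in> B \<and> u = (b + t *\<^sub>R x\<^sub>0, t)" if "u \<in> G" for u using that unfolding G_def by blast
  have "subspace G"
  proof (rule subspaceI)
    show "0 \<in> G" using GI[OF subspace_0[OF B], of 0] by (simp add: zero_prod_def)
    show "u + v \<in> G" if uv: "u \<in> G" "v \<in> G" for u v
    proof -
      obtain b t b' t' where *: "b \<in> B" "u = (b + t *\<^sub>R x\<^sub>0, t)" "b' \<in> B" "v = (b' + t' *\<^sub>R x\<^sub>0, t')"
        using GE[OF uv(1)] GE[OF uv(2)] by blast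
      show ?thesis using GI[OF subspace_add[OF B *(1,3)], of "t + t'"] unfolding * by (simp add: algebra_simps)
    qed
    show "c *\<^sub>R u \<in> G" if u: "u \<in> G" for c u
    proof -
      obtain b t where *: "b \<in> B" "u = (b + t *\<^sub>R x\<^sub>0, t)" using GE[OF u] by blast
      show ?thesis using GI[OF subspace_scale[OF B *(1)], of c "c * t"] unfolding * by (simp add: algebra_simps)
    qed
  qed
  moreover have "t \<le> inverse \<epsilon> * p y" if yt: "(y, t) \<in> G" for y t
  proof (cases "0 < t")
    case True
    obtain b where b: "b \<in> B" "y = b + t *\<^sub>R x\<^sub>0" using GE[OF yt] by blast
    have "\<epsilon> \<le> p ((- inverse t) *\<^sub>R b - x\<^sub>0)" by (rule far[OF subspace_scale[OF B b(1)]])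
    then have "t * \<epsilon> \<le> t * p ((- inverse t) *\<^sub>R b - x\<^sub>0)" using True by simp
    also have "\<dots> = p ((- t) *\<^sub>R ((- inverse t) *\<^sub>R b - x\<^sub>0))"
      unfolding hom[of "- t"] using True by simp
    also have "(- t) *\<^sub>R ((- inverse t) *\<^sub>R b - x\<^sub>0) = y" using True b(2) by (simp add: algebra_simps)
    finally show ?thesis using \<epsilon> by (simp add: field_simps)
  next
    case False
    have "0 \<le> inverse \<epsilon> * p y" using \<epsilon> pos by simp
    then show ?thesis using False by simp
  qed
  moreover have "inverse \<epsilon> * p (x + y) \<le> inverse \<epsilon> * p x + inverse \<epsilon> * p y" for x y
  proof -
    have "inverse \<epsilon> * p (x + y) \<le> inverse \<epsilon> * (p x + p y)" using add \<epsilon> by (intro mult_left_mono) auto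
    then show ?thesis by (simp only: distrib_left)
  qed
  moreover have "inverse \<epsilon> * p (c *\<^sub>R x) = c * (inverse \<epsilon> * p x)" if "0 < c" for c x
    using hom that by simp
  ultimately obtain f where f: "linear f" "\<And>x. f x \<le> inverse \<epsilon> * p x" "\<And>y a. (y, a) \<in> G \<Longrightarrow> f y = a"
    using dominated_extension[where p = "\<lambda>x. inverse \<epsilon> * p x" and G = G] by metis
  have "\<bar>f x\<bar> \<le> inverse \<epsilon> * p x" for x
  proof -
    have "p (- x) = p x" using hom[of "-1" x] by simp
    then show ?thesis using f(2)[of x] f(2)[of "- x"] linear_neg[OF f(1), of x] by (intro abs_leI) simp_all
  qed
  moreover have "f b = 0" if "b \<in> B" for b using f(3)[OF GI[OF that, of 0]] by simp
  moreover have "f x\<^sub>0 = 1" using f(3)[OF GI[OF subspace_0[OF B], of 1]] by simp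
  ultimately show thesis using that f(1) by blast
qed

section \<open>Uniformly closed subalgebras\<close>

text \<open>The \<open>f\<close>-algebra axioms make \<open>a * b\<close> disjoint from \<open>b\<close> and then from itself.\<close>

lemma disjoint_mult_zero:
  fixes a b :: "'a::f_algebra"
  assumes "inf a b = 0" shows "a * b = 0"
proof -
  have ab: "0 \<le> a" "0 \<le> b" using assms by (metis inf.cobounded1, metis inf.cobounded2)
  have "inf (a * b) b = 0" by (rule f_algebra_right[OF assms ab(2)])
  then have "inf b (a * b) = 0" by (simp add: inf_commute)
  then have "inf (a * b) (a * b) = 0" by (rule f_algebra_left[OF _ ab(1)])
  then show ?thesis by simp
qed

lemma inf_pprt_nprt:
  fixes b :: "'a::lattice_ab_group_add" shows "inf (pprt b) (- nprt b) = 0"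
proof -
  have "inf (pprt b) (- nprt b) = inf (b + - nprt b) (0 + - nprt b)"
    using prts[of b] by (metis add.commute add_diff_cancel_left' add_0 diff_conv_add_uminus)
  also have "\<dots> = nprt b + - nprt b" unfolding nprt_def add_inf_distrib_right[symmetric] by simp
  finally show ?thesis by simp
qed

lemma abs_mult_abs_self:
  fixes b :: "'a::f_algebra" shows "\<bar>b\<bar> * \<bar>b\<bar> = b * b"
proof -
  have z: "pprt b * nprt b = 0" "nprt b * pprt b = 0"
    using disjoint_mult_zero[OF inf_pprt_nprt[of b]]
      disjoint_mult_zero[of "- nprt b" "pprt b"] inf_pprt_nprt[of b] by (simp_all add: inf_commute)
  have "b * b = (pprt b + nprt b) * (pprt b + nprt b)" by (simp only: prts[symmetric])
  then show ?thesis unfolding abs_prts using z by (simp add: algebra_simps)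
qed

text \<open>Here \<open>q n\<close> is the power \<open>r ^ n\<close> with \<open>r ^ 0 = e\<close>.  The differences \<open>r ^ n * (e - r)\<close> decrease and
  telescope, so that \<open>n + 1\<close> times the last of them is at most \<open>e\<close>.  This replaces the
  estimate of \<open>t * (1 - t) ^ n\<close> on the unit interval.\<close>

lemma unit_interval_powers:
  fixes e r :: "'a::f_algebra"
  assumes e: "identity_element e" and r: "0 \<le> r" "r \<le> e"
    and q: "q 0 = e" "\<And>n. q (Suc n) = q n * r"
  shows "0 \<le> q n" "0 \<le> q n - q (Suc n)" "q (Suc n) - q (Suc (Suc n)) = (q n - q (Suc n)) * r"
    "real (Suc n) *\<^sub>R (q n - q (Suc n)) \<le> e"
proof -
  have unit: "x * e = x" for x using e unfolding identity_element_def by blast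
  have q0: "0 \<le> q n" for n
  proof (induction n)
    case 0
    then show ?case using r q(1) by (metis order_trans)
  qed (use r q(2) in simp)
  then show "0 \<le> q n" .
  have d0: "0 \<le> q n - q (Suc n)" for n
    using mult_left_mono[OF r(2) q0[of n]] unit q(2) by simp
  then show "0 \<le> q n - q (Suc n)" .
  have step: "q (Suc n) - q (Suc (Suc n)) = (q n - q (Suc n)) * r" for n
    using q(2)[of n] q(2)[of "Suc n"] by (simp only: left_diff_distrib)
  then show "q (Suc n) - q (Suc (Suc n)) = (q n - q (Suc n)) * r" .
  have dec: "q (Suc n) - q (Suc (Suc n)) \<le> q n - q (Suc n)" for n
    unfolding step using mult_left_mono[OF r(2) d0[of n]] unit by simp
  have mono: "q n - q (Suc n) \<le> q k - q (Suc k)" if "k \<le> n" for k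
    using that by (induction n rule: dec_induct) (use dec order_trans in blast)+
  have "real m *\<^sub>R (q n - q (Suc n)) \<le> q 0 - q m" if "m \<le> Suc n" for m
    using that
  proof (induction m)
    case (Suc m)
    have "real (Suc m) *\<^sub>R (q n - q (Suc n)) = real m *\<^sub>R (q n - q (Suc n)) + (q n - q (Suc n))"
      by (simp add: scaleR_add_left add.commute)
    also have "\<dots> \<le> (q 0 - q m) + (q m - q (Suc m))" using Suc mono by (intro add_mono) auto
    finally show ?case by simp
  qed simp
  from this[of "Suc n"] have "real (Suc n) *\<^sub>R (q n - q (Suc n)) \<le> q 0 - q (Suc n)" by simp
  also have "\<dots> \<le> e" using q0[of "Suc n"] q(1) by simp
  finally show "real (Suc n) *\<^sub>R (q n - q (Suc n)) \<le> e" .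
qed

definition uniform_closure :: "'a::vector_lattice \<Rightarrow> 'a set \<Rightarrow> 'a set" where
  "uniform_closure e B = {x. \<forall>\<epsilon>>0. \<exists>b\<in>B. \<bar>x - b\<bar> \<le> \<epsilon> *\<^sub>R e}"

lemma uniform_closure_superset: "0 \<le> e \<Longrightarrow> B \<subseteq> uniform_closure e B"
proof
  fix x assume e: "0 \<le> e" and x: "x \<in> B"
  have "\<exists>b\<in>B. \<bar>x - b\<bar> \<le> \<epsilon> *\<^sub>R e" if "0 < \<epsilon>" for \<epsilon>
    using e that by (intro bexI[OF _ x]) (simp add: scaleR_nonneg_nonneg)
  then show "x \<in> uniform_closure e B" unfolding uniform_closure_def by blast
qed

lemma uniform_closure_idem:
  "uniform_closure e (uniform_closure e B) \<subseteq> uniform_closure e B"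
proof
  fix x assume x: "x \<in> uniform_closure e (uniform_closure e B)"
  have "\<exists>b\<in>B. \<bar>x - b\<bar> \<le> \<epsilon> *\<^sub>R e" if \<epsilon>: "0 < \<epsilon>" for \<epsilon>
  proof -
    have "0 < \<epsilon> / 2" using \<epsilon> by simp
    then obtain y where y: "y \<in> uniform_closure e B" "\<bar>x - y\<bar> \<le> (\<epsilon> / 2) *\<^sub>R e"
      using x unfolding uniform_closure_def by blast
    obtain b where b: "b \<in> B" "\<bar>y - b\<bar> \<le> (\<epsilon> / 2) *\<^sub>R e"
      using y(1) \<open>0 < \<epsilon> / 2\<close> unfolding uniform_closure_def by blast
    have "\<bar>x - b\<bar> \<le> \<bar>x - y\<bar> + \<bar>y - b\<bar>" using abs_triangle_ineq[of "x - y" "y - b"] by simp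
    also have "\<dots> \<le> (\<epsilon> / 2) *\<^sub>R e + (\<epsilon> / 2) *\<^sub>R e" by (intro add_mono y b)
    also have "\<dots> = \<epsilon> *\<^sub>R e" unfolding scaleR_add_left[symmetric] by simp
    finally show ?thesis using b(1) by blast
  qed
  then show "x \<in> uniform_closure e B" unfolding uniform_closure_def by blast
qed

lemma subalgebraD:
  assumes "subalgebra B"
  shows "subspace B" "x \<in> B \<Longrightarrow> y \<in> B \<Longrightarrow> x * y \<in> B"
  using assms unfolding subalgebra_def by auto

lemma uniform_closure_subspace:
  fixes e :: "'a::vector_lattice"
  assumes e: "0 \<le> e" and B: "subspace B"
  shows "subspace (uniform_closure e B)"
proof (rule subspaceI)
  show "0 \<in> uniform_closure e B" using uniform_closure_superset[OF e] subspace_0[OF B] by blast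
  show "x + y \<in> uniform_closure e B" if xy: "x \<in> uniform_closure e B" "y \<in> uniform_closure e B" for x y
    unfolding uniform_closure_def
  proof (intro CollectI allI impI)
    fix \<epsilon> :: real assume "0 < \<epsilon>"
    then have "0 < \<epsilon> / 2" by simp
    then obtain a b where ab: "a \<in> B" "\<bar>x - a\<bar> \<le> (\<epsilon> / 2) *\<^sub>R e" "b \<in> B" "\<bar>y - b\<bar> \<le> (\<epsilon> / 2) *\<^sub>R e"
      using xy unfolding uniform_closure_def by blast
    have "\<bar>(x + y) - (a + b)\<bar> \<le> \<bar>x - a\<bar> + \<bar>y - b\<bar>"
      using abs_triangle_ineq[of "x - a" "y - b"] by (simp add: algebra_simps)
    also have "\<dots> \<le> (\<epsilon> / 2) *\<^sub>R e + (\<epsilon> / 2) *\<^sub>R e" by (intro add_mono ab)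
    also have "\<dots> = \<epsilon> *\<^sub>R e" unfolding scaleR_add_left[symmetric] by simp
    finally show "\<exists>b\<in>B. \<bar>(x + y) - b\<bar> \<le> \<epsilon> *\<^sub>R e" using subspace_add[OF B ab(1,3)] by blast
  qed
  show "c *\<^sub>R x \<in> uniform_closure e B" if x: "x \<in> uniform_closure e B" for c x
    unfolding uniform_closure_def
  proof (intro CollectI allI impI)
    fix \<epsilon> :: real assume \<epsilon>: "0 < \<epsilon>"
    define \<delta> where "\<delta> = \<epsilon> / (\<bar>c\<bar> + 1)"
    have \<delta>: "0 < \<delta>" "\<bar>c\<bar> * \<delta> \<le> \<epsilon>" unfolding \<delta>_def using \<epsilon> by (auto simp: field_simps)
    obtain b where b: "b \<in> B" "\<bar>x - b\<bar> \<le> \<delta> *\<^sub>R e" using x \<delta>(1) unfolding uniform_closure_def by blast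
    have "\<bar>c *\<^sub>R x - c *\<^sub>R b\<bar> = \<bar>c\<bar> *\<^sub>R \<bar>x - b\<bar>" by (simp only: scaleR_diff_right[symmetric] abs_scale)
    also have "\<dots> \<le> \<bar>c\<bar> *\<^sub>R (\<delta> *\<^sub>R e)" using b(2) by (intro scaleR_left_mono) auto
    also have "\<dots> \<le> \<epsilon> *\<^sub>R e" using \<delta>(2) e by (simp add: scaleR_right_mono)
    finally show "\<exists>b\<in>B. \<bar>c *\<^sub>R x - b\<bar> \<le> \<epsilon> *\<^sub>R e" using subspace_scale[OF B b(1)] by blast
  qed
qed

lemma identity_mult_mono:
  fixes e a b :: "'a::f_algebra"
  assumes e: "identity_element e" and "\<bar>a\<bar> \<le> s *\<^sub>R e" "\<bar>b\<bar> \<le> t *\<^sub>R e" "0 \<le> s *\<^sub>R e"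
  shows "\<bar>a * b\<bar> \<le> (s * t) *\<^sub>R e"
proof -
  have "\<bar>a * b\<bar> \<le> \<bar>a\<bar> * \<bar>b\<bar>" by (rule abs_le_mult)
  also have "\<dots> \<le> (s *\<^sub>R e) * (t *\<^sub>R e)" using assms by (intro mult_mono) auto
  also have "\<dots> = (s * t) *\<^sub>R e"
    using e unfolding identity_element_def by (simp add: mult.commute)
  finally show ?thesis .
qed

lemma uniform_closure_subalgebra:
  fixes e :: "'a::f_algebra"
  assumes e: "identity_element e" "strong_order_unit e" and B: "subalgebra B"
  shows "subalgebra (uniform_closure e B)"
  unfolding subalgebra_def
proof (intro conjI ballI)
  note e0 = strong_order_unit_bound(1)[OF e(2)]
  show "subspace (uniform_closure e B)" by (rule uniform_closure_subspace[OF e0 subalgebraD(1)[OF B]])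
  fix x y assume xy: "x \<in> uniform_closure e B" "y \<in> uniform_closure e B"
  obtain m :: nat where m: "1 \<le> m" "\<bar>x\<bar> \<le> real m *\<^sub>R e" using strong_order_unit_bound(2)[OF e(2)] by blast
  show "x * y \<in> uniform_closure e B"
    unfolding uniform_closure_def
  proof (intro CollectI allI impI)
    fix \<epsilon> :: real assume \<epsilon>: "0 < \<epsilon>"
    then have "0 < \<epsilon> / (2 * real m)" using m(1) by simp
    then obtain b where b: "b \<in> B" "\<bar>y - b\<bar> \<le> (\<epsilon> / (2 * real m)) *\<^sub>R e"
      using xy(2) unfolding uniform_closure_def by blast
    obtain n :: nat where n: "1 \<le> n" "\<bar>b\<bar> \<le> real n *\<^sub>R e" using strong_order_unit_bound(2)[OF e(2)] by blast
    have "0 < \<epsilon> / (2 * real n)" using n(1) \<epsilon> by simp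
    then obtain a where a: "a \<in> B" "\<bar>x - a\<bar> \<le> (\<epsilon> / (2 * real n)) *\<^sub>R e"
      using xy(1) unfolding uniform_closure_def by blast
    have "x * y - a * b = x * (y - b) + (x - a) * b" by (simp add: algebra_simps)
    then have "\<bar>x * y - a * b\<bar> \<le> \<bar>x * (y - b)\<bar> + \<bar>(x - a) * b\<bar>" using abs_triangle_ineq by metis
    also have "\<dots> \<le> (real m * (\<epsilon> / (2 * real m))) *\<^sub>R e + (\<epsilon> / (2 * real n) * real n) *\<^sub>R e"
    proof (intro add_mono identity_mult_mono[OF e(1)] m b a n)
      show "0 \<le> real m *\<^sub>R e" "0 \<le> (\<epsilon> / (2 * real n)) *\<^sub>R e"
        using e0 \<epsilon> by (auto intro!: scaleR_nonneg_nonneg)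
    qed
    also have "\<dots> = \<epsilon> *\<^sub>R e" unfolding scaleR_add_left[symmetric] using m n by simp
    finally show "\<exists>b\<in>B. \<bar>x * y - b\<bar> \<le> \<epsilon> *\<^sub>R e" using subalgebraD(2)[OF B a(1) b(1)] by blast
  qed
qed

text \<open>The polynomials given by \<open>p (Suc n) = p n + (b\<^sup>2 - (p n)\<^sup>2) / 2\<close> have no constant term, and
  \<open>\<bar>b\<bar> - p (Suc n) = (\<bar>b\<bar> - p n) * (e - (\<bar>b\<bar> + p n) / 2)\<close>.  Hence they stay between \<open>0\<close> and \<open>\<bar>b\<bar>\<close>, and the error is at
  most \<open>\<bar>b\<bar> * (e - \<bar>b\<bar> / 2) ^ n\<close>, which \<open>unit_interval_powers\<close> bounds by \<open>2 / (n + 1)\<close> times \<open>e\<close>.\<close>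

lemma abs_in_uniform_closure_unit:
  fixes e b :: "'a::f_algebra"
  assumes e: "identity_element e" and B: "subalgebra B" and b: "b \<in> B" "\<bar>b\<bar> \<le> e"
  shows "\<bar>b\<bar> \<in> uniform_closure e B"
proof -
  have unit: "x * e = x" "e * x = x" for x using e unfolding identity_element_def by auto
  have e0: "0 \<le> e" using b(2) abs_ge_zero order_trans by blast
  define p where "p = rec_nat (0::'a) (\<lambda>n y. y + (1/2) *\<^sub>R (b * b - y * y))"
  have p: "p 0 = 0" "p (Suc n) = p n + (1/2) *\<^sub>R (b * b - p n * p n)" for n unfolding p_def by simp_all
  define s where "s = (1/2) *\<^sub>R \<bar>b\<bar>"
  define r where "r = e - s"
  have s0: "0 \<le> s" unfolding s_def by (simp add: scaleR_nonneg_nonneg)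
  have sb: "s + s = \<bar>b\<bar>" unfolding s_def scaleR_add_left[symmetric] by simp
  have se: "s \<le> e" using b(2) s0 sb by (metis add_increasing order_refl order_trans)
  have r: "0 \<le> r" "r \<le> e" unfolding r_def using s0 se by simp_all
  define q where "q = rec_nat e (\<lambda>n y. y * r)"
  have q: "q 0 = e" "q (Suc n) = q n * r" for n unfolding q_def by simp_all
  note pw = unit_interval_powers[where q = q, OF e r q]
  define h where "h n = q n - q (Suc n)" for n
  have pB: "p n \<in> B" for n
  proof (induction n)
    case 0
    then show ?case using subspace_0[OF subalgebraD(1)[OF B]] p by simp
  next
    case (Suc n)
    have "b * b \<in> B" "p n * p n \<in> B" using subalgebraD(2)[OF B] b(1) Suc by blast+
    then show ?case unfolding p
      using Suc subspace_add subspace_scale subspace_diff subalgebraD(1)[OF B] by metis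
  qed
  have comm: "\<bar>b\<bar> * p n = p n * \<bar>b\<bar>" for n
  proof (induction n)
    case (Suc n)
    have 1: "\<bar>b\<bar> * (p n * p n) = (p n * p n) * \<bar>b\<bar>" using Suc by (metis mult.assoc)
    have 2: "\<bar>b\<bar> * (b * b) = (b * b) * \<bar>b\<bar>" unfolding abs_mult_abs_self[of b, symmetric] by (simp only: mult.assoc)
    show ?case unfolding p
      by (simp only: distrib_left distrib_right right_diff_distrib left_diff_distrib
          mult_scaleR_left mult_scaleR_right Suc 1 2)
  qed (simp add: p)
  have main: "0 \<le> p n \<and> p n \<le> \<bar>b\<bar> \<and> \<bar>b\<bar> - p n \<le> h n + h n" for n
  proof (induction n)
    case 0
    have "h 0 = s" unfolding h_def q using unit by (simp add: r_def)
    then show ?case using sb by (simp add: p)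
  next
    case (Suc n)
    let ?d = "\<bar>b\<bar> - p n"
    have d0: "0 \<le> ?d" using Suc by simp
    have sq: "b * b - p n * p n = ?d * (\<bar>b\<bar> + p n)"
      unfolding abs_mult_abs_self[of b, symmetric]
      by (simp only: distrib_left left_diff_distrib comm) simp
    have "0 \<le> ?d * (\<bar>b\<bar> + p n)" using d0 Suc by (intro mult_nonneg_nonneg add_nonneg_nonneg) auto
    then have 1: "0 \<le> p (Suc n)" unfolding p sq using Suc by (simp add: scaleR_nonneg_nonneg)
    have fac: "\<bar>b\<bar> - p (Suc n) = ?d * (e - (1/2) *\<^sub>R (\<bar>b\<bar> + p n))"
      unfolding p sq using unit by (simp add: right_diff_distrib mult_scaleR_right)
    have half: "(1/2) *\<^sub>R (\<bar>b\<bar> + p n) \<le> e"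
    proof -
      have "(1/2) *\<^sub>R (\<bar>b\<bar> + p n) \<le> (1/2) *\<^sub>R (\<bar>b\<bar> + \<bar>b\<bar>)" using Suc by (intro scaleR_left_mono) auto
      also have "\<dots> = \<bar>b\<bar>" unfolding scaleR_2[symmetric] by simp
      finally show ?thesis using b(2) by simp
    qed
    have 2: "p (Suc n) \<le> \<bar>b\<bar>"
      using mult_nonneg_nonneg[OF d0, of "e - (1/2) *\<^sub>R (\<bar>b\<bar> + p n)"] half unfolding fac[symmetric] by simp
    have "s \<le> (1/2) *\<^sub>R (\<bar>b\<bar> + p n)" unfolding s_def using Suc by (intro scaleR_left_mono) auto
    then have "\<bar>b\<bar> - p (Suc n) \<le> ?d * r"
      unfolding fac r_def using d0 by (intro mult_left_mono diff_left_mono)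
    also have "\<dots> \<le> (h n + h n) * r" using Suc r(1) by (intro mult_right_mono) auto
    also have "\<dots> = h (Suc n) + h (Suc n)" unfolding h_def pw(3) by (simp add: distrib_right)
    finally show ?case using 1 2 by blast
  qed
  show ?thesis
    unfolding uniform_closure_def
  proof (intro CollectI allI impI)
    fix \<epsilon> :: real assume \<epsilon>: "0 < \<epsilon>"
    obtain n where n: "inverse (real (Suc n)) < \<epsilon> / 2" using reals_Archimedean[of "\<epsilon> / 2"] \<epsilon> by auto
    have "h n \<le> inverse (real (Suc n)) *\<^sub>R e"
      using pw(4)[of n] unfolding h_def by (subst pos_le_divideR_eq) auto
    also have "\<dots> \<le> (\<epsilon> / 2) *\<^sub>R e" using n e0 by (intro scaleR_right_mono) auto
    finally have "h n + h n \<le> (\<epsilon> / 2) *\<^sub>R e + (\<epsilon> / 2) *\<^sub>R e" by (intro add_mono)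
    also have "\<dots> = \<epsilon> *\<^sub>R e" unfolding scaleR_add_left[symmetric] by simp
    finally have "\<bar>\<bar>b\<bar> - p n\<bar> \<le> \<epsilon> *\<^sub>R e" using main[of n] by (metis abs_of_nonneg diff_ge_0_iff_ge order_trans)
    then show "\<exists>c\<in>B. \<bar>\<bar>b\<bar> - c\<bar> \<le> \<epsilon> *\<^sub>R e" using pB by blast
  qed
qed

lemma abs_in_uniform_closure:
  fixes e b :: "'a::f_algebra"
  assumes e: "identity_element e" "strong_order_unit e" and B: "subalgebra B" and b: "b \<in> uniform_closure e B"
  shows "\<bar>b\<bar> \<in> uniform_closure e B"
proof -
  let ?C = "uniform_closure e B"
  have C: "subalgebra ?C" by (rule uniform_closure_subalgebra[OF e B])
  obtain m :: nat where m: "1 \<le> m" "\<bar>b\<bar> \<le> real m *\<^sub>R e" using strong_order_unit_bound(2)[OF e(2)] by blast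
  let ?b = "inverse (real m) *\<^sub>R b"
  have "\<bar>?b\<bar> \<le> e" using m unfolding abs_scale by (simp add: pos_divideR_le_eq)
  moreover have "?b \<in> ?C" by (rule subspace_scale[OF subalgebraD(1)[OF C] b])
  ultimately have "\<bar>?b\<bar> \<in> uniform_closure e ?C" by (intro abs_in_uniform_closure_unit[OF e(1) C])
  then have "\<bar>?b\<bar> \<in> ?C" using uniform_closure_idem by blast
  then have "real m *\<^sub>R \<bar>?b\<bar> \<in> ?C" by (rule subspace_scale[OF subalgebraD(1)[OF C]])
  moreover have "real m *\<^sub>R \<bar>?b\<bar> = \<bar>b\<bar>" unfolding abs_scale using m by simp
  ultimately show ?thesis by metis
qed

text \<open>As \<open>e\<close> itself need not be approximable, \<open>inf b e = (b + e - \<bar>b - e\<bar>) / 2\<close> is first approximated in the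
  unital algebra \<open>E\<close> spanned by the closure of \<open>B\<close> and \<open>e\<close>.  Multiplication by \<open>e - (e - b / m) ^ n\<close> brings the
  approximation back, because this is a polynomial in \<open>b\<close> without constant term.  The factor changes
  \<open>inf b e\<close> only by \<open>(e - b / m) ^ n * inf b e\<close>, which \<open>unit_interval_powers\<close> bounds by
  \<open>m / (n + 1)\<close> times \<open>e\<close>.\<close>

lemma inf_unit_in_uniform_closure:
  fixes e b :: "'a::f_algebra"
  assumes e: "identity_element e" "strong_order_unit e" and B: "subalgebra B"
    and b: "b \<in> uniform_closure e B" "0 \<le> b"
  shows "inf b e \<in> uniform_closure e B"
proof -
  let ?C = "uniform_closure e B"
  note e0 = strong_order_unit_bound(1)[OF e(2)]
  have unit: "x * e = x" "e * x = x" for x using e(1) unfolding identity_element_def by auto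
  have C: "subalgebra ?C" by (rule uniform_closure_subalgebra[OF e B])
  note Cs = subalgebraD(1)[OF C]
  obtain m :: nat where m: "1 \<le> m" "\<bar>b\<bar> \<le> real m *\<^sub>R e" using strong_order_unit_bound(2)[OF e(2)] by blast
  define s where "s = inverse (real m) *\<^sub>R b"
  have sC: "s \<in> ?C" unfolding s_def by (rule subspace_scale[OF Cs b(1)])
  have sm: "real m *\<^sub>R s = b" unfolding s_def using m(1) by simp
  have s: "0 \<le> s" "s \<le> e" unfolding s_def using m b(2) by (auto simp: pos_divideR_le_eq intro: scaleR_nonneg_nonneg)
  define r where "r = e - s"
  have r: "0 \<le> r" "r \<le> e" unfolding r_def using s by simp_all
  define q where "q = rec_nat e (\<lambda>n y. y * r)"
  have q: "q 0 = e" "q (Suc n) = q n * r" for n unfolding q_def by simp_all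
  note pw = unit_interval_powers[where q = q, OF e(1) r q]
  define x where "x = inf b e"
  have x0: "0 \<le> x" "x \<le> b" "x \<le> e" unfolding x_def using b(2) e0 by auto
  have uC: "e - q n \<in> ?C" for n
  proof (induction n)
    case 0
    then show ?case using subspace_0[OF Cs] q by simp
  next
    case (Suc n)
    have "e - q (Suc n) = (e - q n) + (s - (e - q n) * s)"
      unfolding q r_def using unit by (simp add: algebra_simps)
    moreover have "(e - q n) * s \<in> ?C" by (rule subalgebraD(2)[OF C Suc sC])
    ultimately show ?case using Suc sC subspace_add[OF Cs] subspace_diff[OF Cs] by metis
  qed
  have u: "0 \<le> e - q n" "e - q n \<le> e" for n
  proof -
    have "q n \<le> e"
    proof (induction n)
      case (Suc n)
      then show ?case using pw(2)[of n] by (metis diff_ge_0_iff_ge order_trans)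
    qed (simp add: q)
    then show "0 \<le> e - q n" "e - q n \<le> e" using pw(1)[of n] by simp_all
  qed
  define E where "E = {c + t *\<^sub>R e | c t. c \<in> ?C}"
  have EI: "c + t *\<^sub>R e \<in> E" if "c \<in> ?C" for c t unfolding E_def using that by blast
  have EE: "\<exists>c t. c \<in> ?C \<and> y = c + t *\<^sub>R e" if "y \<in> E" for y using that unfolding E_def by blast
  have E: "subalgebra E"
    unfolding subalgebra_def
  proof (intro conjI ballI)
    show "subspace E"
    proof (rule subspaceI)
      show "0 \<in> E" using EI[OF subspace_0[OF Cs], of 0] by simp
      show "y + z \<in> E" if yz: "y \<in> E" "z \<in> E" for y z
      proof -
        obtain c t c' t' where *: "c \<in> ?C" "y = c + t *\<^sub>R e" "c' \<in> ?C" "z = c' + t' *\<^sub>R e"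
          using EE[OF yz(1)] EE[OF yz(2)] by blast
        show ?thesis using EI[OF subspace_add[OF Cs *(1,3)], of "t + t'"] unfolding * by (simp add: algebra_simps)
      qed
      show "k *\<^sub>R y \<in> E" if y: "y \<in> E" for k y
      proof -
        obtain c t where *: "c \<in> ?C" "y = c + t *\<^sub>R e" using EE[OF y] by blast
        show ?thesis using EI[OF subspace_scale[OF Cs *(1)], of k "k * t"] unfolding * by (simp add: algebra_simps)
      qed
    qed
    fix y z assume yz: "y \<in> E" "z \<in> E"
    obtain c t c' t' where *: "c \<in> ?C" "y = c + t *\<^sub>R e" "c' \<in> ?C" "z = c' + t' *\<^sub>R e"
      using EE[OF yz(1)] EE[OF yz(2)] by blast
    have "y * z = (c * c' + (t' *\<^sub>R c + t *\<^sub>R c')) + (t * t') *\<^sub>R e"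
      unfolding * using unit by (simp add: algebra_simps)
    moreover have "c * c' + (t' *\<^sub>R c + t *\<^sub>R c') \<in> ?C"
      using *(1,3) by (intro subspace_add[OF Cs] subspace_scale[OF Cs] subalgebraD(2)[OF C])
    ultimately show "y * z \<in> E" using EI by metis
  qed
  have "b \<in> E" "e \<in> E" using EI[OF b(1), of 0] EI[OF subspace_0[OF Cs], of 1] by simp_all
  let ?F = "uniform_closure e E"
  have EF: "E \<subseteq> ?F" by (rule uniform_closure_superset[OF e0])
  have Fs: "subspace ?F" by (rule uniform_closure_subspace[OF e0 subalgebraD(1)[OF E]])
  have "\<bar>b - e\<bar> \<in> ?F"
    using \<open>b \<in> E\<close> \<open>e \<in> E\<close> EF Fs by (intro abs_in_uniform_closure[OF e E] subspace_diff) auto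
  moreover have "x = (1/2) *\<^sub>R (b + e - \<bar>b - e\<bar>)"
  proof -
    have E1: "sup b e - inf b e = \<bar>b - e\<bar>"
    proof -
      have "\<bar>b - e\<bar> = sup (b - e) (e - b)" using abs_lattice[of "b - e"] by simp
      have "sup b e - inf b e = sup b e + sup (- b) (- e)" by (simp add: diff_inf_eq_sup sup_commute)
      also have "\<dots> = sup (sup (b - b) (e - b)) (sup (b - e) (e - e))"
        by (simp only: add_sup_distrib_left add_sup_distrib_right diff_conv_add_uminus)
      also have "\<dots> = sup (\<bar>b - e\<bar>) 0" unfolding \<open>\<bar>b - e\<bar> = sup (b - e) (e - b)\<close>
        by (simp add: ac_simps)
      also have "\<dots> = \<bar>b - e\<bar>" by (simp add: sup.absorb1)
      finally show ?thesis .
    qed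
    have E2: "b + e = sup b e + inf b e" by (rule add_eq_inf_sup)
    have gen: "(s + i) - (s - i) = i + i" for s i :: 'a by (simp add: algebra_simps)
    have "b + e - \<bar>b - e\<bar> = (sup b e + inf b e) - (sup b e - inf b e)" by (simp only: E1 E2)
    also have "\<dots> = x + x" unfolding x_def by (rule gen)
    finally show ?thesis by (simp only: scaleR_2[symmetric]) simp
  qed
  ultimately have xF: "x \<in> ?F"
    using \<open>b \<in> E\<close> \<open>e \<in> E\<close> EF Fs subspace_scale subspace_diff subspace_add by (metis subsetD)
  have "x \<in> uniform_closure e ?C"
    unfolding uniform_closure_def[of e ?C]
  proof (intro CollectI allI impI)
    fix \<epsilon> :: real assume \<epsilon>: "0 < \<epsilon>"
    have \<epsilon>2: "0 < \<epsilon> / 2" using \<epsilon> by simp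
    obtain y where y: "y \<in> E" "\<bar>x - y\<bar> \<le> (\<epsilon> / 2) *\<^sub>R e"
      using xF \<epsilon>2 unfolding uniform_closure_def[of e E] by blast
    obtain c t where ct: "c \<in> ?C" "y = c + t *\<^sub>R e" using EE[OF y(1)] by blast
    have "0 < \<epsilon> / (2 * real m)" using \<epsilon> m(1) by simp
    then obtain n where n: "inverse (real (Suc n)) < \<epsilon> / (2 * real m)" using reals_Archimedean by blast
    let ?u = "e - q n"
    have "x - ?u * x = q n * x" using unit by (simp add: left_diff_distrib)
    also have "\<dots> \<le> q n * b" using x0(2) pw(1) by (intro mult_left_mono)
    also have "\<dots> = real m *\<^sub>R (q n * s)" using sm by (metis mult_scaleR_right)
    also have "q n * s = q n - q (Suc n)" unfolding q r_def using unit by (simp add: right_diff_distrib)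
    also have "real m *\<^sub>R (q n - q (Suc n)) \<le> real m *\<^sub>R (inverse (real (Suc n)) *\<^sub>R e)"
      using pw(4)[of n] by (intro scaleR_left_mono) (subst pos_le_divideR_eq, auto)
    also have "\<dots> \<le> (\<epsilon> / 2) *\<^sub>R e"
    proof -
      have "real m * inverse (real (Suc n)) \<le> \<epsilon> / 2" using n m(1) by (simp add: field_simps)
      then show ?thesis using e0 by (simp only: scaleR_scaleR) (rule scaleR_right_mono)
    qed
    finally have 1: "x - ?u * x \<le> (\<epsilon> / 2) *\<^sub>R e" .
    have "0 \<le> q n * x" using x0(1) pw(1) by simp
    then have "0 \<le> x - ?u * x" using unit by (simp add: left_diff_distrib)
    then have 1: "\<bar>x - ?u * x\<bar> \<le> (\<epsilon> / 2) *\<^sub>R e" using 1 by (simp only: abs_of_nonneg)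
    have 2: "\<bar>?u * (x - y)\<bar> \<le> (1 * (\<epsilon> / 2)) *\<^sub>R e"
      by (rule identity_mult_mono[OF e(1) _ y(2)]) (use u[of n] e0 in simp_all)
    have "\<bar>x - ?u * y\<bar> \<le> \<bar>x - ?u * x\<bar> + \<bar>?u * (x - y)\<bar>"
      using abs_triangle_ineq[of "x - ?u * x" "?u * (x - y)"] by (simp add: right_diff_distrib)
    also have "\<dots> \<le> (\<epsilon> / 2) *\<^sub>R e + (1 * (\<epsilon> / 2)) *\<^sub>R e" by (intro add_mono 1 2)
    also have "\<dots> = \<epsilon> *\<^sub>R e" unfolding scaleR_add_left[symmetric] by simp
    finally have 3: "\<bar>x - ?u * y\<bar> \<le> \<epsilon> *\<^sub>R e" .
    have "?u * y = ?u * c + t *\<^sub>R ?u" unfolding ct using unit by (simp add: distrib_left)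
    moreover have "?u * c + t *\<^sub>R ?u \<in> ?C"
      by (intro subspace_add[OF Cs] subspace_scale[OF Cs] subalgebraD(2)[OF C] uC ct)
    ultimately have "?u * y \<in> ?C" by simp
    then show "\<exists>c\<in>?C. \<bar>x - c\<bar> \<le> \<epsilon> *\<^sub>R e" using 3 by blast
  qed
  then show ?thesis using uniform_closure_idem unfolding x_def by blast
qed

text \<open>The truncation of \<open>b\<close> to the order interval between \<open>- c *\<^sub>R e\<close> and \<open>c *\<^sub>R e\<close>.\<close>

definition clamp_unit :: "'a::vector_lattice \<Rightarrow> real \<Rightarrow> 'a \<Rightarrow> 'a" where
  "clamp_unit e c b = inf (pprt b) (c *\<^sub>R e) - inf (pprt (- b)) (c *\<^sub>R e)"

lemma clamp_unit_in_uniform_closure: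
  fixes e b :: "'a::f_algebra"
  assumes e: "identity_element e" "strong_order_unit e" and B: "subalgebra B" and b: "b \<in> B" and c: "0 < c"
  shows "clamp_unit e c b \<in> uniform_closure e B"
proof -
  let ?C = "uniform_closure e B"
  note e0 = strong_order_unit_bound(1)[OF e(2)]
  have Cs: "subspace ?C" by (rule uniform_closure_subspace[OF e0 subalgebraD(1)[OF B]])
  have inf_c: "inf y (c *\<^sub>R e) \<in> ?C" if y: "y \<in> ?C" "0 \<le> y" for y
  proof -
    have "c *\<^sub>R inf (inverse c *\<^sub>R y) e \<in> ?C"
      using y c by (intro subspace_scale[OF Cs] inf_unit_in_uniform_closure[OF e B] scaleR_nonneg_nonneg) auto
    moreover have "c *\<^sub>R inf (inverse c *\<^sub>R y) e = inf y (c *\<^sub>R e)"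
    proof (rule antisym)
      have "c *\<^sub>R inf (inverse c *\<^sub>R y) e \<le> c *\<^sub>R (inverse c *\<^sub>R y)" using c by (intro scaleR_left_mono) auto
      moreover have "c *\<^sub>R inf (inverse c *\<^sub>R y) e \<le> c *\<^sub>R e" using c by (intro scaleR_left_mono) auto
      ultimately show "c *\<^sub>R inf (inverse c *\<^sub>R y) e \<le> inf y (c *\<^sub>R e)" using c by simp
      have "inverse c *\<^sub>R inf y (c *\<^sub>R e) \<le> inverse c *\<^sub>R y" using c by (intro scaleR_left_mono) auto
      moreover have "inverse c *\<^sub>R inf y (c *\<^sub>R e) \<le> inverse c *\<^sub>R (c *\<^sub>R e)" using c by (intro scaleR_left_mono) auto
      ultimately have "inverse c *\<^sub>R inf y (c *\<^sub>R e) \<le> inf (inverse c *\<^sub>R y) e" using c by (intro le_infI) simp_all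
      then show "inf y (c *\<^sub>R e) \<le> c *\<^sub>R inf (inverse c *\<^sub>R y) e" unfolding pos_divideR_le_eq[OF c] .
    qed
    ultimately show ?thesis by metis
  qed
  have pprtC: "pprt y \<in> ?C" if y: "y \<in> B" for y
  proof -
    have yC: "y \<in> ?C" using uniform_closure_superset[OF e0] y by blast
    have "pprt y = (1/2) *\<^sub>R (y + \<bar>y\<bar>)"
    proof -
      have "y + \<bar>y\<bar> = (pprt y + nprt y) + (pprt y - nprt y)" by (simp only: prts[symmetric] abs_prts[symmetric])
      then have "y + \<bar>y\<bar> = 2 *\<^sub>R pprt y" by (simp add: scaleR_2)
      then show ?thesis by simp
    qed
    then show ?thesis
      using subspace_scale[OF Cs subspace_add[OF Cs yC abs_in_uniform_closure[OF e B yC]], of "1/2"] by simp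
  qed
  have "- b \<in> B" using subspace_neg[OF subalgebraD(1)[OF B] b] .
  then show ?thesis unfolding clamp_unit_def
    using b by (intro subspace_diff[OF Cs] inf_c pprtC zero_le_pprt)
qed

lemma abs_inf_diff_le:
  fixes a b c :: "'a::lattice_ab_group_add_abs"
  shows "\<bar>inf a c - inf b c\<bar> \<le> \<bar>a - b\<bar>"
proof -
  have *: "inf a c - inf b c \<le> \<bar>a - b\<bar>" for a b :: 'a
  proof -
    have "a \<le> b + \<bar>a - b\<bar>" using abs_ge_self[of "a - b"] by (metis add.commute diff_le_eq)
    moreover have "c \<le> c + \<bar>a - b\<bar>" by simp
    ultimately have "inf a c \<le> inf (b + \<bar>a - b\<bar>) (c + \<bar>a - b\<bar>)" by (rule inf_mono)
    also have "\<dots> = inf b c + \<bar>a - b\<bar>" by (simp only: add_inf_distrib_right)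
    finally show ?thesis by (simp only: diff_le_eq add.commute)
  qed
  have "- (inf a c - inf b c) \<le> \<bar>a - b\<bar>" using *[of b a] by (metis abs_minus_commute minus_diff_eq)
  then show ?thesis using * by (intro abs_leI)
qed

lemma abs_pprt_diff_le:
  fixes a b :: "'a::lattice_ab_group_add_abs"
  shows "\<bar>pprt a - pprt b\<bar> \<le> \<bar>a - b\<bar>"
proof -
  have *: "pprt a - pprt b \<le> \<bar>a - b\<bar>" for a b :: 'a
  proof -
    have "a \<le> b + \<bar>a - b\<bar>" using abs_ge_self[of "a - b"] by (metis add.commute diff_le_eq)
    moreover have "0 \<le> 0 + \<bar>a - b\<bar>" by simp
    ultimately have "sup a 0 \<le> sup (b + \<bar>a - b\<bar>) (0 + \<bar>a - b\<bar>)" by (rule sup_mono)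
    also have "\<dots> = sup b 0 + \<bar>a - b\<bar>" by (simp only: add_sup_distrib_right)
    finally show ?thesis unfolding pprt_def by (simp only: diff_le_eq add.commute)
  qed
  have "- (pprt a - pprt b) \<le> \<bar>a - b\<bar>" using *[of b a] by (metis abs_minus_commute minus_diff_eq)
  then show ?thesis using * by (intro abs_leI)
qed

text \<open>The truncation fixes \<open>x\<close>, is Lipschitz, and has values bounded by \<open>c *\<^sub>R e\<close>.  Thus the distance of
  \<open>x\<close> to the truncation of \<open>b\<close> is controlled by the truncated distance of \<open>x\<close> to \<open>b\<close>.\<close>

lemma abs_diff_clamp_unit_le:
  fixes e x b :: "'a::vector_lattice"
  assumes e: "0 \<le> e" and c: "0 < c" and x: "\<bar>x\<bar> \<le> c *\<^sub>R e"
  shows "\<bar>x - clamp_unit e c b\<bar> \<le> (2 * max 1 c) *\<^sub>R inf \<bar>b - x\<bar> e"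
proof -
  let ?k = "c *\<^sub>R e" and ?d = "\<bar>b - x\<bar>"
  have k0: "0 \<le> ?k" using c e by (simp add: scaleR_nonneg_nonneg)
  have px: "pprt x \<le> ?k" "pprt (- x) \<le> ?k"
    using x k0 abs_ge_self[of x] abs_ge_minus_self[of x] unfolding pprt_def by (auto intro: order_trans)
  have xx: "x = pprt x - pprt (- x)" using prts[of x] by (simp add: pprt_neg)
  have *: "inf (pprt y) ?k \<le> ?k" "0 \<le> inf (pprt y) ?k" for y using k0 by simp_all
  have d: "\<bar>pprt y - inf (pprt z) ?k\<bar> \<le> inf ?d ?k" if y: "pprt y \<le> ?k" and yz: "\<bar>y - z\<bar> \<le> ?d" for y z
  proof (rule le_infI)
    have "\<bar>inf (pprt y) ?k - inf (pprt z) ?k\<bar> \<le> \<bar>pprt y - pprt z\<bar>" by (rule abs_inf_diff_le)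
    also have "\<dots> \<le> \<bar>y - z\<bar>" by (rule abs_pprt_diff_le)
    also note yz
    finally show "\<bar>pprt y - inf (pprt z) ?k\<bar> \<le> ?d" unfolding inf.absorb1[OF y] .
    show "\<bar>pprt y - inf (pprt z) ?k\<bar> \<le> ?k"
    proof (rule abs_leI)
      show "pprt y - inf (pprt z) ?k \<le> ?k"
        using diff_mono[OF y *(2)[of z]] by simp
      show "- (pprt y - inf (pprt z) ?k) \<le> ?k"
        using diff_mono[OF *(1)[of z] zero_le_pprt[of y]] by (simp only: minus_diff_eq diff_zero)
    qed
  qed
  have "\<bar>- x - - b\<bar> = ?d" by simp
  then have d1: "\<bar>pprt x - inf (pprt b) ?k\<bar> \<le> inf ?d ?k"
    and d2: "\<bar>pprt (- x) - inf (pprt (- b)) ?k\<bar> \<le> inf ?d ?k"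
    using d[OF px(1), of b] d[OF px(2), of "- b"] abs_minus_commute[of x b] by simp_all
  have gen: "(p - n) - (i - j) = (p - i) - (n - j)" for p n i j :: 'a by (simp add: algebra_simps)
  have "x - clamp_unit e c b
      = (pprt x - inf (pprt b) ?k) - (pprt (- x) - inf (pprt (- b)) ?k)"
    unfolding clamp_unit_def by (subst xx) (rule gen)
  then have "\<bar>x - clamp_unit e c b\<bar> \<le> \<bar>pprt x - inf (pprt b) ?k\<bar> + \<bar>pprt (- x) - inf (pprt (- b)) ?k\<bar>"
    by (simp only: abs_triangle_ineq4)
  also have "\<dots> \<le> inf ?d ?k + inf ?d ?k" by (intro add_mono d1 d2)
  also have "\<dots> = 2 *\<^sub>R inf ?k ?d" by (simp only: scaleR_2 inf_commute)
  also have "\<dots> \<le> 2 *\<^sub>R (max 1 c *\<^sub>R inf e ?d)"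
    by (intro scaleR_left_mono inf_scale_le) (use e c in auto)
  finally show ?thesis by (simp only: scaleR_scaleR inf_commute)
qed

section \<open>Closures of subalgebras\<close>

lemma order_unit_norm_less:
  assumes e: "strong_order_unit e" and less: "order_unit_norm e x < r"
  shows "\<bar>x\<bar> \<le> r *\<^sub>R e"
proof -
  have ne: "{c. 0 \<le> c \<and> \<bar>x\<bar> \<le> c *\<^sub>R e} \<noteq> {}"
    using e unfolding strong_order_unit_def by blast
  obtain c where c: "0 \<le> c" "\<bar>x\<bar> \<le> c *\<^sub>R e" "c < r"
    using cInf_lessD[OF ne less[unfolded order_unit_norm_def]] by blast
  have "c *\<^sub>R e \<le> r *\<^sub>R e"
    using c(3) strong_order_unit_bound(1)[OF e] by (intro scaleR_right_mono) auto
  then show ?thesis using c(2) by (rule order_trans[rotated])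
qed

lemma order_unit_norm_le:
  assumes "0 \<le> c" "\<bar>x\<bar> \<le> c *\<^sub>R e" shows "order_unit_norm e x \<le> c"
  unfolding order_unit_norm_def by (rule cInf_lower) (use assms in \<open>auto intro!: bdd_belowI[of _ 0]\<close>)

lemma order_unit_norm_nonneg:
  assumes "strong_order_unit e" shows "0 \<le> order_unit_norm e x"
  unfolding order_unit_norm_def
  by (rule cInf_greatest) (use assms in \<open>auto simp: strong_order_unit_def\<close>)

lemma order_unit_dist_Metric_space:
  fixes e :: "'a::vector_lattice"
  assumes e: "strong_order_unit e"
  shows "Metric_space UNIV (order_unit_dist e)"
proof
  fix x y z :: 'a
  note e0 = strong_order_unit_bound(1)[OF e]
  show "0 \<le> order_unit_dist e x y" unfolding order_unit_dist_def by (rule order_unit_norm_nonneg[OF e])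
  show "order_unit_dist e x y = order_unit_dist e y x"
    unfolding order_unit_dist_def order_unit_norm_def by (simp only: abs_minus_commute)
  show "order_unit_dist e x y = 0 \<longleftrightarrow> x = y"
  proof
    assume z: "order_unit_dist e x y = 0"
    have "real n *\<^sub>R \<bar>x - y\<bar> \<le> e" for n
    proof (cases "n = 0")
      case False
      have "\<bar>x - y\<bar> \<le> inverse (real n) *\<^sub>R e"
        by (rule order_unit_norm_less[OF e]) (use z False in \<open>simp add: order_unit_dist_def\<close>)
      then have "real n *\<^sub>R \<bar>x - y\<bar> \<le> real n *\<^sub>R (inverse (real n) *\<^sub>R e)" by (rule scaleR_left_mono) simp
      then show ?thesis using False by simp
    qed (use e0 in simp)
    then have "\<bar>x - y\<bar> = 0" by (intro archimedean[of _ e]) auto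
    then show "x = y" by simp
  next
    assume "x = y"
    then have "order_unit_dist e x y \<le> 0"
      unfolding order_unit_dist_def by (intro order_unit_norm_le) auto
    then show "order_unit_dist e x y = 0"
      unfolding order_unit_dist_def using order_unit_norm_nonneg[OF e, of "x - y"] by linarith
  qed
  show "order_unit_dist e x z \<le> order_unit_dist e x y + order_unit_dist e y z"
  proof (rule field_le_epsilon)
    fix \<epsilon> :: real assume \<epsilon>: "0 < \<epsilon>"
    define s t where "s = order_unit_dist e x y + \<epsilon> / 2" and "t = order_unit_dist e y z + \<epsilon> / 2"
    have "\<bar>x - y\<bar> \<le> s *\<^sub>R e" "\<bar>y - z\<bar> \<le> t *\<^sub>R e"
      unfolding s_def t_def by (rule order_unit_norm_less[OF e], use \<epsilon> in \<open>simp add: order_unit_dist_def\<close>)+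
    then have "\<bar>x - y\<bar> + \<bar>y - z\<bar> \<le> s *\<^sub>R e + t *\<^sub>R e" by (rule add_mono)
    moreover have "\<bar>x - z\<bar> \<le> \<bar>x - y\<bar> + \<bar>y - z\<bar>" using abs_triangle_ineq[of "x - y" "y - z"] by simp
    ultimately have "\<bar>x - z\<bar> \<le> (s + t) *\<^sub>R e" unfolding scaleR_add_left by (rule order_trans[rotated])
    moreover have "0 \<le> s + t"
      unfolding s_def t_def order_unit_dist_def using \<epsilon> order_unit_norm_nonneg[OF e] by (simp add: add_nonneg_nonneg)
    ultimately have "order_unit_dist e x z \<le> s + t"
      unfolding order_unit_dist_def[of e x z] by (intro order_unit_norm_le)
    then show "order_unit_dist e x z \<le> order_unit_dist e x y + order_unit_dist e y z + \<epsilon>"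
      unfolding s_def t_def by simp
  qed
qed

lemma order_unit_closure_subset_uniform_closure:
  fixes e :: "'a::vector_lattice"
  assumes e: "strong_order_unit e"
  shows "B \<subseteq> order_unit_topology e closure_of B" "order_unit_topology e closure_of B \<subseteq> uniform_closure e B"
proof -
  interpret Metric_space UNIV "order_unit_dist e" by (rule order_unit_dist_Metric_space[OF e])
  show "B \<subseteq> order_unit_topology e closure_of B"
    unfolding order_unit_topology_def by (rule closure_of_subset) simp
  show "order_unit_topology e closure_of B \<subseteq> uniform_closure e B"
  proof
    fix x assume "x \<in> order_unit_topology e closure_of B"
    then have x: "\<And>r. 0 < r \<Longrightarrow> \<exists>b\<in>B. order_unit_dist e x b < r"
      unfolding order_unit_topology_def metric_closure_of by auto
    have "\<exists>b\<in>B. \<bar>x - b\<bar> \<le> \<epsilon> *\<^sub>R e" if \<epsilon>: "0 < \<epsilon>" for \<epsilon>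
    proof -
      obtain b where "b \<in> B" "order_unit_norm e (x - b) < \<epsilon>" using x[OF \<epsilon>] unfolding order_unit_dist_def by blast
      then show ?thesis using order_unit_norm_less[OF e] by blast
    qed
    then show "x \<in> uniform_closure e B" unfolding uniform_closure_def by blast
  qed
qed

text \<open>A positive functional satisfies \<open>\<phi> \<bar>b - x\<bar> \<le> \<delta> * \<phi> e\<close> if \<open>\<bar>b - x\<bar> \<le> \<delta> *\<^sub>R e\<close>.\<close>

lemma uniform_closure_subset_absolute_weak_closure:
  fixes e :: "'a::vector_lattice"
  assumes e: "0 \<le> e" and I: "oc_dual_ideal I"
  shows "uniform_closure e B \<subseteq> absolute_weak_topology_by I closure_of B"
proof
  fix x assume x: "x \<in> uniform_closure e B"
  show "x \<in> absolute_weak_topology_by I closure_of B"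
    unfolding in_closure_absolute_weak_topology[OF I]
  proof (intro ballI allI impI)
    fix \<phi> and \<epsilon> :: real assume \<phi>: "\<phi> \<in> normal_members I" and \<epsilon>: "0 < \<epsilon>"
    have nf: "normal_functional \<phi>" using \<phi> unfolding normal_members_def by blast
    have pe: "0 \<le> \<phi> e" by (rule normal_functionalD(2)[OF nf e])
    define \<delta> where "\<delta> = \<epsilon> / (\<phi> e + 1)"
    have \<delta>: "0 < \<delta>" "\<delta> * \<phi> e < \<epsilon>" unfolding \<delta>_def using \<epsilon> pe by (auto simp: field_simps)
    obtain b where b: "b \<in> B" "\<bar>x - b\<bar> \<le> \<delta> *\<^sub>R e" using x \<delta>(1) unfolding uniform_closure_def by blast
    have "\<phi> \<bar>b - x\<bar> \<le> \<phi> (\<delta> *\<^sub>R e)" using b(2) by (intro normal_functional_mono[OF nf]) (simp only: abs_minus_commute)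
    also have "\<dots> = \<delta> * \<phi> e" using linear_scale[OF normal_functionalD(1)[OF nf]] by simp
    finally show "\<exists>b\<in>B. \<phi> \<bar>b - x\<bar> < \<epsilon>" using b(1) \<delta>(2) by (intro bexI[of _ b]) simp_all
  qed
qed

lemma openin_weak_imp_openin_absolute_weak:
  fixes I :: "('a::vector_lattice \<Rightarrow> real) set"
  assumes I: "oc_dual_ideal I" and U: "openin (weak_topology_by I) U"
  shows "openin (absolute_weak_topology_by I) U"
proof -
  have "generate_topology_on {\<phi> -` U | \<phi> U. \<phi> \<in> I \<and> open U} U"
    using U unfolding weak_topology_by_def openin_topology_generated_by_iff .
  then show ?thesis
  proof induction
    case (Basis s)
    then obtain \<phi> V where s: "s = \<phi> -` V" "\<phi> \<in> I" "open V" by blast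
    have oc: "\<phi> \<in> oc_dual" using I s(2) unfolding oc_dual_ideal_def by blast
    show ?case
      unfolding openin_absolute_weak_topology[OF I]
    proof
      fix x assume "x \<in> s"
      then have "\<phi> x \<in> V" using s(1) by simp
      then obtain \<epsilon> where \<epsilon>: "0 < \<epsilon>" "\<And>t. \<bar>t - \<phi> x\<bar> < \<epsilon> \<Longrightarrow> t \<in> V"
        using s(3) unfolding open_dist by (auto simp: dist_real_def)
      have "y \<in> s" if "functional_modulus \<phi> \<bar>y - x\<bar> < \<epsilon>" for y
      proof -
        have "\<bar>\<phi> y - \<phi> x\<bar> < \<epsilon>"
          using abs_le_functional_modulus[OF oc, of "y - x"] that
          by (simp only: linear_diff[OF oc_dual_linear[OF oc]])
        then show ?thesis using \<epsilon>(2) s(1) by simp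
      qed
      moreover have "functional_modulus \<phi> \<in> normal_members I"
        using functional_modulus_image_ideal[OF I] s(2) by blast
      ultimately show "\<exists>\<psi>\<in>normal_members I. \<exists>\<epsilon>>0. \<forall>y. \<psi> \<bar>y - x\<bar> < \<epsilon> \<longrightarrow> y \<in> s"
        using \<epsilon>(1) by blast
    qed
  qed auto
qed

lemma topspace_weak_topology:
  assumes "oc_dual_ideal I" shows "topspace (weak_topology_by I) = UNIV"
proof -
  have "(\<lambda>x. 0) -` UNIV \<in> {\<phi> -` U | \<phi> U. \<phi> \<in> I \<and> open U}"
    using assms open_UNIV unfolding oc_dual_ideal_def by blast
  then show ?thesis unfolding weak_topology_by_def topology_generated_by_topspace by auto
qed

text \<open>A point outside the absolute weak closure has positive distance from \<open>B\<close> for some seminorm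
  \<open>x \<mapsto> \<phi> \<bar>x\<bar>\<close> with \<open>\<phi>\<close> in \<open>I\<close>.  The separating functional is dominated by a multiple of \<open>\<phi>\<close>, so it is in
  \<open>I\<close>, and it separates for the weak topology as well.\<close>

lemma weak_closure_eq_absolute_weak_closure:
  fixes I :: "('a::vector_lattice \<Rightarrow> real) set"
  assumes I: "oc_dual_ideal I" and B: "subspace B"
  shows "weak_topology_by I closure_of B = absolute_weak_topology_by I closure_of B"
proof
  show "absolute_weak_topology_by I closure_of B \<subseteq> weak_topology_by I closure_of B"
    using openin_weak_imp_openin_absolute_weak[OF I] topspace_weak_topology[OF I]
    unfolding closure_of_def by blast
  show "weak_topology_by I closure_of B \<subseteq> absolute_weak_topology_by I closure_of B"
  proof
    fix x assume x: "x \<in> weak_topology_by I closure_of B"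
    show "x \<in> absolute_weak_topology_by I closure_of B"
    proof (rule ccontr)
      assume "x \<notin> absolute_weak_topology_by I closure_of B"
      then obtain \<phi> \<epsilon> where \<phi>: "\<phi> \<in> normal_members I" "0 < \<epsilon>" "\<And>b. b \<in> B \<Longrightarrow> \<epsilon> \<le> \<phi> \<bar>b - x\<bar>"
        unfolding in_closure_absolute_weak_topology[OF I] by (auto simp: not_less)
      have nf: "normal_functional \<phi>" using \<phi>(1) unfolding normal_members_def by blast
      note lin = normal_functionalD(1)[OF nf]
      have "\<phi> \<bar>u + v\<bar> \<le> \<phi> \<bar>u\<bar> + \<phi> \<bar>v\<bar>" for u v
        using normal_functional_mono[OF nf abs_triangle_ineq[of u v]] linear_add[OF lin] by simp
      moreover have "\<phi> \<bar>c *\<^sub>R u\<bar> = \<bar>c\<bar> * \<phi> \<bar>u\<bar>" for c u unfolding abs_scale linear_scale[OF lin] by simp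
      moreover have "0 \<le> \<phi> \<bar>u\<bar>" for u by (rule normal_functionalD(2)[OF nf]) simp
      ultimately obtain f where f: "linear f" "\<And>u. \<bar>f u\<bar> \<le> inverse \<epsilon> * \<phi> \<bar>u\<bar>"
        "\<And>b. b \<in> B \<Longrightarrow> f b = 0" "f x = 1"
        by (rule separate_point_from_subspace[where p = "\<lambda>u. \<phi> \<bar>u\<bar>", OF _ _ _ B \<phi>(2,3)]) simp_all
      have "(\<lambda>u. inverse \<epsilon> * \<phi> u) \<in> normal_members I"
        by (rule normal_members_scale[OF I \<phi>(1)]) (use \<phi>(2) in simp)
      then have fI: "f \<in> I" using oc_dual_ideal_dominated[OF I f(1)] f(2) by blast
      have "openin (weak_topology_by I) (f -` {0<..})"
        unfolding weak_topology_by_def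
        by (rule topology_generated_by_Basis) (use fI open_greaterThan in blast)
      moreover have "x \<in> f -` {0<..}" using f(4) by simp
      ultimately obtain b where "b \<in> B" "b \<in> f -` {0<..}"
        using x[unfolded in_closure_of, THEN conjunct2, rule_format, of "f -` {0<..}"] by blast
      then show False using f(3) by simp
    qed
  qed
qed

text \<open>The step that uses the multiplication: for a point \<open>x\<close> approximated by \<open>b\<close> in \<open>B\<close>
  for the gauge of \<open>\<phi>\<close>, the truncation of \<open>b\<close> approximates \<open>x\<close> for the seminorm of \<open>\<phi>\<close> and is a uniform
  limit of elements of \<open>B\<close>.\<close>

lemma truncated_closure_eq_absolute_weak_closure:
  fixes e :: "'a::f_algebra"
  assumes e: "identity_element e" "strong_order_unit e" and I: "oc_dual_ideal I" and B: "subalgebra B"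
  shows "truncated_topology e I closure_of B = absolute_weak_topology_by I closure_of B"
proof
  note e0 = strong_order_unit_bound(1)[OF e(2)]
  show "absolute_weak_topology_by I closure_of B \<subseteq> truncated_topology e I closure_of B"
  proof
    fix x assume x: "x \<in> absolute_weak_topology_by I closure_of B"
    show "x \<in> truncated_topology e I closure_of B"
      unfolding in_closure_truncated_topology[OF e0 I]
    proof (intro ballI allI impI)
      fix \<phi> and \<epsilon> :: real assume \<phi>: "\<phi> \<in> normal_members I" "0 < \<epsilon>"
      then obtain b where b: "b \<in> B" "\<phi> \<bar>b - x\<bar> < \<epsilon>"
        using x unfolding in_closure_absolute_weak_topology[OF I] by blast
      have "truncated e \<phi> (b - x) \<le> \<phi> \<bar>b - x\<bar>"
        using truncated_properties(6)[OF e0] \<phi>(1) unfolding normal_members_def by blast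
      then show "\<exists>b\<in>B. truncated e \<phi> (b - x) < \<epsilon>" using b by (intro bexI[of _ b]) simp_all
    qed
  qed
  show "truncated_topology e I closure_of B \<subseteq> absolute_weak_topology_by I closure_of B"
  proof
    fix x assume x: "x \<in> truncated_topology e I closure_of B"
    obtain m :: nat where m: "1 \<le> m" "\<bar>x\<bar> \<le> real m *\<^sub>R e" using strong_order_unit_bound(2)[OF e(2)] by blast
    have xcl: "x \<in> absolute_weak_topology_by I closure_of (uniform_closure e B)"
      unfolding in_closure_absolute_weak_topology[OF I]
    proof (intro ballI allI impI)
      fix \<phi> and \<epsilon> :: real assume \<phi>: "\<phi> \<in> normal_members I" and \<epsilon>: "0 < \<epsilon>"
      have nf: "normal_functional \<phi>" using \<phi> unfolding normal_members_def by blast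
      define K where "K = 2 * max 1 (real m)"
      have K: "0 < K" unfolding K_def by simp
      then have "0 < \<epsilon> / K" using \<epsilon> by simp
      then obtain b where b: "b \<in> B" "truncated e \<phi> (b - x) < \<epsilon> / K"
        using x \<phi> unfolding in_closure_truncated_topology[OF e0 I] by blast
      let ?c = "clamp_unit e (real m) b"
      have "?c \<in> uniform_closure e B"
        by (rule clamp_unit_in_uniform_closure[OF e B b(1)]) (use m(1) in simp)
      moreover have "\<phi> \<bar>?c - x\<bar> < \<epsilon>"
      proof -
        have "\<bar>?c - x\<bar> \<le> K *\<^sub>R inf \<bar>b - x\<bar> e"
          unfolding K_def abs_minus_commute[of ?c] by (rule abs_diff_clamp_unit_le[OF e0 _ m(2)]) (use m(1) in simp)
        then have "\<phi> \<bar>?c - x\<bar> \<le> \<phi> (K *\<^sub>R inf \<bar>b - x\<bar> e)" by (rule normal_functional_mono[OF nf])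
        also have "\<dots> = K * truncated e \<phi> (b - x)"
          unfolding truncated_def linear_scale[OF normal_functionalD(1)[OF nf]] by simp
        also have "\<dots> < \<epsilon>" using b(2) K by (simp add: field_simps)
        finally show ?thesis .
      qed
      ultimately show "\<exists>c\<in>uniform_closure e B. \<phi> \<bar>c - x\<bar> < \<epsilon>" by blast
    qed
    have "absolute_weak_topology_by I closure_of (uniform_closure e B)
        \<subseteq> absolute_weak_topology_by I closure_of (absolute_weak_topology_by I closure_of B)"
      by (rule closure_of_mono[OF uniform_closure_subset_absolute_weak_closure[OF e0 I]])
    then show "x \<in> absolute_weak_topology_by I closure_of B" using xcl by (simp only: closure_of_closure_of) blast
  qed
qed

lemma closure_of_between:
  assumes "B \<subseteq> C" "C \<subseteq> \<tau> closure_of B"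
  shows "\<tau> closure_of C = \<tau> closure_of B"
  using closure_of_mono[OF assms(1), of \<tau>] closure_of_mono[OF assms(2), of \<tau>] by simp

lemma oc_dual_ideal_oc_dual: "oc_dual_ideal oc_dual"
proof -
  have "(\<lambda>x. \<phi> x + \<psi> x) \<in> oc_dual" if "\<phi> \<in> oc_dual" "\<psi> \<in> oc_dual" for \<phi> \<psi> :: "'a::vector_lattice \<Rightarrow> real"
  proof (rule oc_dual_dominated)
    note n = functional_modulus_properties(1)[OF that(1)] functional_modulus_properties(1)[OF that(2)]
    show "normal_functional (\<lambda>x. functional_modulus \<phi> x + functional_modulus \<psi> x)"
      by (rule normal_functional_add[OF n])
    show "linear (\<lambda>x. \<phi> x + \<psi> x)" using that oc_dual_linear linear_compose_add by blast
    show "\<bar>\<phi> x + \<psi> x\<bar> \<le> functional_modulus \<phi> \<bar>x\<bar> + functional_modulus \<psi> \<bar>x\<bar>" for x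
      using abs_le_functional_modulus[OF that(1), of x] abs_le_functional_modulus[OF that(2), of x] by linarith
  qed
  moreover have "(\<lambda>x. c * \<phi> x) \<in> oc_dual" if "\<phi> \<in> oc_dual" for \<phi> :: "'a::vector_lattice \<Rightarrow> real" and c
  proof (rule oc_dual_dominated)
    show "normal_functional (\<lambda>x. \<bar>c\<bar> * functional_modulus \<phi> x)"
      by (rule normal_functional_scale[OF functional_modulus_properties(1)[OF that]]) simp
    show "linear (\<lambda>x. c * \<phi> x)" using linear_compose_scale_right[OF oc_dual_linear[OF that], of c] by simp
    show "\<bar>c * \<phi> x\<bar> \<le> \<bar>c\<bar> * functional_modulus \<phi> \<bar>x\<bar>" for x
      unfolding abs_mult by (rule mult_left_mono[OF abs_le_functional_modulus[OF that]]) simp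
  qed
  ultimately show ?thesis
    unfolding oc_dual_ideal_def using normal_functional_in_oc_dual[OF normal_functional_zero] by blast
qed

theorem theorem6p6:
  fixes e :: "'a::f_algebra"
  assumes "identity_element e"
    and "strong_order_unit e"
    and "order_unit_complete e"
    and "separates_points (oc_dual :: ('a \<Rightarrow> real) set)"
  shows "(\<exists>!\<tau>::'a topology. Hausdorff_space \<tau> \<and> uo_Lebesgue \<tau>) \<and>
    (\<forall>(I::('a \<Rightarrow> real) set) (B::'a set).
       oc_dual_ideal I \<longrightarrow> separates_points I \<longrightarrow> subalgebra B \<longrightarrow>
       uo_Lebesgue_topology closure_of B = weak_topology_by I closure_of B \<and>
       weak_topology_by I closure_of B = absolute_weak_topology_by I closure_of B \<and>
       absolute_weak_topology_by I closure_of B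
         = uo_Lebesgue_topology closure_of (order_unit_topology e closure_of B) \<and>
       uo_Lebesgue_topology closure_of (order_unit_topology e closure_of B)
         = weak_topology_by I closure_of (order_unit_topology e closure_of B) \<and>
       weak_topology_by I closure_of (order_unit_topology e closure_of B)
         = absolute_weak_topology_by I closure_of (order_unit_topology e closure_of B))"
proof -
  note e = assms(1,2) and e0 = strong_order_unit_bound(1)[OF assms(2)]
  let ?P = "\<lambda>\<tau>::'a topology. Hausdorff_space \<tau> \<and> uo_Lebesgue \<tau>"
  have ex: "?P (truncated_topology e I)" if "oc_dual_ideal I" "separates_points I" for I
    using truncated_topology_uo_Lebesgue[OF e(2) that] by blast
  have uniq: "\<tau> = truncated_topology e I" if "oc_dual_ideal I" "separates_points I" "?P \<tau>" for I \<tau>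
    using uo_Lebesgue_eq_truncated_topology[OF e(2) that(1,2)] that(3) by blast
  have ex1: "\<exists>!\<tau>. ?P \<tau>"
    using ex[OF oc_dual_ideal_oc_dual assms(4)] uniq[OF oc_dual_ideal_oc_dual assms(4)] by blast
  have "uo_Lebesgue_topology closure_of B = weak_topology_by I closure_of B \<and>
       weak_topology_by I closure_of B = absolute_weak_topology_by I closure_of B \<and>
       absolute_weak_topology_by I closure_of B
         = uo_Lebesgue_topology closure_of (order_unit_topology e closure_of B) \<and>
       uo_Lebesgue_topology closure_of (order_unit_topology e closure_of B)
         = weak_topology_by I closure_of (order_unit_topology e closure_of B) \<and>
       weak_topology_by I closure_of (order_unit_topology e closure_of B)
         = absolute_weak_topology_by I closure_of (order_unit_topology e closure_of B)"
    if I: "oc_dual_ideal I" "separates_points I" and B: "subalgebra B" for I B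
  proof -
    have "uo_Lebesgue_topology = truncated_topology e I"
      unfolding uo_Lebesgue_topology_def by (rule the_equality[of ?P, OF ex[OF I] uniq[OF I]])
    then have 1: "uo_Lebesgue_topology closure_of B = absolute_weak_topology_by I closure_of B"
      using truncated_closure_eq_absolute_weak_closure[OF e I(1) B] by simp
    have 2: "weak_topology_by I closure_of B = absolute_weak_topology_by I closure_of B"
      by (rule weak_closure_eq_absolute_weak_closure[OF I(1) subalgebraD(1)[OF B]])
    let ?C = "order_unit_topology e closure_of B"
    have C: "B \<subseteq> ?C" "?C \<subseteq> absolute_weak_topology_by I closure_of B"
      using order_unit_closure_subset_uniform_closure[OF e(2), of B]
        uniform_closure_subset_absolute_weak_closure[OF e0 I(1), of B] by auto
    have "uo_Lebesgue_topology closure_of ?C = uo_Lebesgue_topology closure_of B"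
      "weak_topology_by I closure_of ?C = weak_topology_by I closure_of B"
      "absolute_weak_topology_by I closure_of ?C = absolute_weak_topology_by I closure_of B"
      by (rule closure_of_between[OF C(1)], use C(2) 1 2 in simp)+
    then show ?thesis using 1 2 by simp
  qed
  then show ?thesis by (intro conjI[OF ex1] allI impI)
qed

end
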